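(* The repetition threshold for binary rich words is $2+\sqrt{2}/2$; that is, $2+\sqrt2/2$ is the infimum of the set of real numbers $\alpha>1$ such that there exists an infinite binary rich word that is $\alpha$-free. Equivalently, $2+\sqrt2/2$ is the least possible critical exponent of an infinite rich word over $\{0,1\}$.
   Context: A finite word of length $n$ is rich if it has $n$ distinct nonempty palindromic factors; an infinite word is rich if all of its finite factors are rich. A finite word $u=u_1\cdots u_m$ has period $p$ if $u_i=u_{i+p}$ for $1\le i\le m-p$, and then $m/p$ is an exponent of $u$; $w$ contains an $\alpha$-power if it has a nonempty factor with an exponent $\ge \alpha$, and is $\alpha$-free otherwise. The critical exponent of $w$ is the supremum of all rational $\alpha$ such that $w$ contains an $\alpha$-power. The repetition threshold of a language $L$ is the infimum of all real $\alpha>1$ such that some infinite word of $L$ is $\alpha$-free. *)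

theory Defs
  imports
    Complex_Main
    "HOL-Library.Sublist"
    "HOL-Library.Omega_Words_Fun"
    "HOL-Library.Extended_Real"
begin

text \<open>
  Finite words are lists; infinite words are functions on the naturals, as in
  \<^theory>\<open>HOL-Library.Omega_Words_Fun\<close>, where \<open>w [i \<rightarrow> j]\<close> is the
  factor of \<open>w\<close> occupying the positions from \<open>i\<close> up to, but excluding, \<open>j\<close>.
  Positions are counted from 0.
\<close>

definition palindrome :: "'a list \<Rightarrow> bool" where
  "palindrome u \<longleftrightarrow> rev u = u"

definition rich :: "'a list \<Rightarrow> bool" where
  "rich u \<longleftrightarrow> card {v. sublist v u \<and> v \<noteq> [] \<and> palindrome v} = length u"

definition factors :: "'a word \<Rightarrow> 'a list set" where
  "factors w = {w [i \<rightarrow> j] | i j. i \<le> j}"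

definition rich_word :: "'a word \<Rightarrow> bool" where
  "rich_word w \<longleftrightarrow> (\<forall>u \<in> factors w. rich u)"

definition has_period :: "'a list \<Rightarrow> nat \<Rightarrow> bool" where
  "has_period u p \<longleftrightarrow> p \<ge> 1 \<and> (\<forall>i. i + p < length u \<longrightarrow> u ! i = u ! (i + p))"

definition exponents :: "'a list \<Rightarrow> real set" where
  "exponents u = {real (length u) / real p | p. has_period u p}"

definition contains_power :: "'a word \<Rightarrow> real \<Rightarrow> bool" where
  "contains_power w \<alpha> \<longleftrightarrow> (\<exists>u \<in> factors w. u \<noteq> [] \<and> (\<exists>e \<in> exponents u. e \<ge> \<alpha>))"

definition power_free :: "'a word \<Rightarrow> real \<Rightarrow> bool" where
  "power_free w \<alpha> \<longleftrightarrow> \<not> contains_power w \<alpha>"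

text \<open>
  The next two values are extended reals: the critical exponent may be infinite,
  and the infimum of the empty set is \<open>\<infinity>\<close>.
\<close>

definition critical_exponent :: "'a word \<Rightarrow> ereal" where
  "critical_exponent w = (SUP \<alpha> \<in> {\<alpha> :: rat. contains_power w (of_rat \<alpha>)}. ereal (of_rat \<alpha>))"

definition repetition_threshold :: "'a word set \<Rightarrow> ereal" where
  "repetition_threshold L = (INF \<alpha> \<in> {\<alpha> :: real. \<alpha> > 1 \<and> (\<exists>w \<in> L. power_free w \<alpha>)}. ereal \<alpha>)"

definition binary_rich_words :: "nat word set" where
  "binary_rich_words = {w. range w \<subseteq> {0, 1} \<and> rich_word w}"

end

theory Submission
  imports Defs
begin

text \<open>
  Let \<open>f\<close>, \<open>g\<close>, \<open>h\<close> be the morphisms \<open>f: 0 \<mapsto> 0, 1 \<mapsto> 01, 2 \<mapsto> 011\<close>, \<open>g: 0 \<mapsto> 011, 1 \<mapsto> 0121, 2 \<mapsto> 012121\<close>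
  and \<open>h: 0 \<mapsto> 01, 1 \<mapsto> 02, 2 \<mapsto> 022\<close>. Each of them codes a letter by \<open>0\<close> followed by a palindrome without \<open>0\<close>.

  Lower bound: consider the factors that occur infinitely often in a rich binary word \<open>w\<close> without
  powers of some exponent below \<open>2 + sqrt 2 / 2\<close>. A finite search shows that the blocks of \<open>h\<close>
  and of \<open>g\<close> never meet below \<open>f\<close>, so that the words \<open>v\<close> for which \<open>f(h(v))0\<close>, or else \<open>f(g(v))0\<close>, is (up to
  another final \<open>0\<close>) such a factor form a language with the same closure properties.
  Desubstitution preserves the palindromicity of complete returns, and it turns the bound on powers of \<open>w\<close>
  into a bound on weighted powers of \<open>v\<close>. A second search, uniform in the weights, shows that the new
  language can be desubstituted by \<open>h\<close> again, and so on forever. The bound then imposed on the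
  occurrences of the letter \<open>0\<close> after \<open>n\<close> steps contradicts the assumption as \<open>n\<close> grows.

  Upper bound: in \<open>f(h(h(h(...))))\<close> every repetition can be desubstituted until its excess contains no
  \<open>0\<close>, where its exponent is checked directly; the same desubstitution shows that complete returns to
  palindromes are palindromes.
\<close>

text \<open>The morphisms do not preserve exponents: the image of a repetition can be prolonged at
  both ends by the common parts of neighbouring blocks. Hence a repetition is recorded by the
  weights of its period and excess and by a gain for each end. Under \<open>h\<close> these data
  keep one closed form, moved by the linear map taking \<open>(A, C)\<close> to
  \<open>(C, A + 2 * C)\<close>. Its dominant eigenvalue \<open>1 + sqrt 2\<close> is the origin of
  the constant: the letter \<open>N0\<close> forces an excess of about \<open>(A + C) / 2\<close> on
  a period \<open>A\<close>, a ratio tending to \<open>1 + sqrt 2 / 2\<close>, and the exponent is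
  one more. The obstacle is that infinitely many levels have to be searched. The search is therefore
  run on letter patterns that are impossible for all pairs of a cone around the eigendirection.
  Factors occurring infinitely often are used because the beginning of a one-sided word need not
  extend to the left. Richness is used as a statement on complete returns, since that form, unlike
  the counting of palindromes, passes directly through desubstitution.\<close>

hide_const (open) Omega_Words_Fun.prefix Omega_Words_Fun.suffix

section \<open>Palindromes and richness\<close>

text \<open>For a factor-closed language this amounts to richness of all its words. Occurrences of
  \<open>p\<close> may overlap, and \<open>r = p\<close> is included, where the conclusion is
  trivial.\<close>

definition palindromic_returns :: "'a list set \<Rightarrow> bool" where
  "palindromic_returns L \<longleftrightarrow> (\<forall>r\<in>L. \<forall>p. palindrome p \<longrightarrow> p \<noteq> [] \<longrightarrow> prefix p r \<longrightarrow> suffix p r \<longrightarrow>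
     (\<forall>s t. r = s @ p @ t \<longrightarrow> s = [] \<or> t = []) \<longrightarrow> palindrome r)"

definition factorial_lang :: "'a list set \<Rightarrow> bool" where
  "factorial_lang L \<longleftrightarrow> (\<forall>v\<in>L. \<forall>u. sublist u v \<longrightarrow> u \<in> L)"

lemma palindromic_returnsD:
  assumes "palindromic_returns L" "r \<in> L" "palindrome p" "p \<noteq> []" "prefix p r" "suffix p r"
    "\<And>s t. r = s @ p @ t \<Longrightarrow> s = [] \<or> t = []"
  shows "palindrome r"
  using assms unfolding palindromic_returns_def by blast

lemma palindrome_suffix_prefix:
  assumes "palindrome p" "palindrome q" "suffix p q"
  shows "prefix p q"
  using assms unfolding palindrome_def by (metis suffix_to_prefix)

text \<open>Ends of first occurrences: two palindromes ending for the first time at the same position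
  coincide, because the shorter one is also a prefix of the longer one.\<close>

definition first_end :: "'a list \<Rightarrow> 'a list \<Rightarrow> nat" where
  "first_end u p = (LEAST j. j \<le> length u \<and> suffix p (take j u))"

lemma sublist_iff_suffix_take: "sublist p u \<longleftrightarrow> (\<exists>j\<le>length u. suffix p (take j u))"
proof
  assume "sublist p u"
  then obtain s t where "u = s @ p @ t" unfolding sublist_def by blast
  then have "suffix p (take (length s + length p) u)" by (simp add: Sublist.suffix_def)
  then show "\<exists>j\<le>length u. suffix p (take j u)"
    using \<open>u = s @ p @ t\<close> by (intro exI[of _ "length s + length p"]) auto
next
  assume "\<exists>j\<le>length u. suffix p (take j u)"
  then show "sublist p u"
    by (meson sublist_order.order.trans suffix_imp_sublist sublist_take)
qed

lemma first_end:
  assumes "sublist p u"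
  shows "first_end u p \<le> length u" "suffix p (take (first_end u p) u)"
proof -
  have "\<exists>j. j \<le> length u \<and> suffix p (take j u)" using assms sublist_iff_suffix_take by blast
  from LeastI_ex[OF this] show "first_end u p \<le> length u" "suffix p (take (first_end u p) u)"
    unfolding first_end_def by auto
qed

lemma first_end_le: "j \<le> length u \<Longrightarrow> suffix p (take j u) \<Longrightarrow> first_end u p \<le> j"
  unfolding first_end_def by (rule Least_le) auto

lemma first_end_pos:
  assumes "sublist p u" "p \<noteq> []" shows "first_end u p \<noteq> 0"
  using first_end(2)[OF assms(1)] assms(2) by (metis suffix_bot.extremum_uniqueI take_eq_Nil)

lemma first_end_inj_aux:
  assumes "sublist p u" "sublist q u" "palindrome p" "palindrome q" "first_end u p = first_end u q"
    "length p \<le> length q"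
  shows "p = q"
proof (rule ccontr)
  assume ne: "p \<noteq> q"
  let ?j = "first_end u q"
  have sp: "suffix p (take ?j u)" "suffix q (take ?j u)"
    using first_end(2)[OF assms(1)] first_end(2)[OF assms(2)] assms(5) by auto
  then have "suffix p q" using assms(6) suffix_length_suffix by blast
  then have "prefix p q" using palindrome_suffix_prefix assms by blast
  then obtain r where r: "q = p @ r" "r \<noteq> []" using ne by (auto simp: Sublist.prefix_def)
  obtain s where s: "take ?j u = s @ q" using sp by (auto simp: Sublist.suffix_def)
  have jl: "?j \<le> length u" using first_end(1)[OF assms(2)] .
  then have len: "?j = length s + length q" using s by (metis length_append length_take min.absorb2)
  have "take (length s + length p) u = take (length s + length p) (take ?j u)"
    using len r by (simp add: min_def)
  also have "\<dots> = s @ p" using s r by simp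
  finally have "suffix p (take (length s + length p) u)" by (simp add: Sublist.suffix_def)
  then have "first_end u p \<le> length s + length p" using first_end_le[of "length s + length p" u p] len jl r by auto
  then show False using len r assms(5) by auto
qed

abbreviation "pal_factors u \<equiv> {v. sublist v u \<and> v \<noteq> [] \<and> palindrome v}"

lemma inj_on_first_end: "inj_on (first_end u) (pal_factors u)"
  by (rule inj_onI) (metis (no_types, lifting) first_end_inj_aux mem_Collect_eq nle_le)

lemma first_end_range: "first_end u ` pal_factors u \<subseteq> {1..length u}"
  using first_end(1) first_end_pos by fastforce

text \<open>Distinct palindromic factors have distinct first ends, so a word of length n has at most
  n of them; richness says that no position is left out.\<close>

lemma rich_iff_surj: "rich u \<longleftrightarrow> first_end u ` pal_factors u = {1..length u}"
proof -
  have "card (first_end u ` pal_factors u) = card (pal_factors u)"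
    using inj_on_first_end by (rule card_image)
  moreover have "card (first_end u ` pal_factors u) = length u \<longleftrightarrow> first_end u ` pal_factors u = {1..length u}"
  proof
    assume "card (first_end u ` pal_factors u) = length u"
    then show "first_end u ` pal_factors u = {1..length u}"
      by (intro card_subset_eq first_end_range) auto
  qed simp
  ultimately show ?thesis unfolding rich_def by simp
qed

text \<open>The palindrome whose first end is the last position occurs nowhere else in the
  word.\<close>

lemma rich_unioccurrent_suffix:
  assumes "rich r" "r \<noteq> []"
  obtains q where "palindrome q" "q \<noteq> []" "suffix q r" "\<And>s t. r = s @ q @ t \<Longrightarrow> t = []"
proof -
  have "length r \<in> first_end r ` pal_factors r"
    using assms rich_iff_surj[of r] by (auto simp: Suc_le_eq)
  then obtain q where q: "sublist q r" "q \<noteq> []" "palindrome q" "first_end r q = length r" by auto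
  have "suffix q r" using first_end(2)[OF q(1)] q(4) by simp
  moreover have "t = []" if "r = s @ q @ t" for s t
  proof -
    have "suffix q (take (length s + length q) r)" using that by (simp add: Sublist.suffix_def)
    then have "first_end r q \<le> length s + length q" using that by (intro first_end_le) auto
    then show ?thesis using that q(4) by simp
  qed
  ultimately show ?thesis using that q by blast
qed

text \<open>Let \<open>q\<close> be the palindromic suffix occurring only once. If \<open>q\<close>
  were a suffix of \<open>p\<close>, it would be a prefix of \<open>p\<close> and so of
  \<open>r\<close>. Hence, unless \<open>r = p\<close> or \<open>r = q\<close>, the word
  \<open>p\<close> is a proper prefix of \<open>q\<close>; this occurrence of \<open>p\<close> is
  not final in \<open>r\<close>, so it is initial and \<open>r = q\<close> after all.\<close>

lemma rich_returns:
  assumes "\<And>r. r \<in> L \<Longrightarrow> rich r"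
  shows "palindromic_returns L"
  unfolding palindromic_returns_def
proof (intro ballI allI impI)
  fix r p assume r: "r \<in> L" and p: "palindrome p" "p \<noteq> []" "prefix p r" "suffix p r"
    and two: "\<forall>s t. r = s @ p @ t \<longrightarrow> s = [] \<or> t = []"
  have "r \<noteq> []" using p by auto
  then obtain q where q: "palindrome q" "q \<noteq> []" "suffix q r" "\<And>s t. r = s @ q @ t \<Longrightarrow> t = []"
    using rich_unioccurrent_suffix[OF assms[OF r]] by metis
  show "palindrome r"
  proof (cases "r = p \<or> r = q")
    case True then show ?thesis using p q by auto
  next
    case False
    have "\<not> suffix q p"
    proof
      assume "suffix q p"
      then have "prefix q p" using palindrome_suffix_prefix p q by blast
      then obtain t where t: "p = q @ t" by (auto simp: Sublist.prefix_def)
      obtain t' where t': "r = p @ t'" using p by (auto simp: Sublist.prefix_def)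
      have "r = [] @ q @ (t @ t')" using t t' by simp
      from q(4)[OF this] t' False show False by simp
    qed
    then have "suffix p q" using suffix_same_cases p(4) q(3) by blast
    then obtain t where t: "q = p @ t"
      using palindrome_suffix_prefix[OF p(1) q(1)] by (auto simp: Sublist.prefix_def)
    have "t \<noteq> []" using \<open>\<not> suffix q p\<close> t by auto
    obtain s where s: "r = s @ q" using q(3) by (auto simp: Sublist.suffix_def)
    have "s = [] \<or> t = []" using two s t by auto
    then show ?thesis using \<open>t \<noteq> []\<close> s False by auto
  qed
qed

text \<open>At each position take the longest palindromic suffix \<open>q\<close> of the prefix
  ending there. An earlier occurrence of \<open>q\<close> would start a complete return, which is a
  longer palindromic suffix.\<close>

lemma returns_rich:
  assumes L: "palindromic_returns L" "factorial_lang L" and u: "u \<in> L"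
  shows "rich u"
  unfolding rich_iff_surj
proof (rule antisym[OF first_end_range subsetI])
  fix j assume j: "j \<in> {1..length u}"
  define r where "r = take j u"
  have r: "length r = j" "r \<noteq> []" "r \<in> L"
    using j L(2) u unfolding r_def factorial_lang_def by (auto intro: sublist_take)
  define P where "P q \<longleftrightarrow> palindrome q \<and> q \<noteq> [] \<and> suffix q r" for q
  have "P [last r]" using r unfolding P_def palindrome_def
    by (simp add: Sublist.suffix_def) (metis append_butlast_last_id)
  moreover have "\<forall>q. P q \<longrightarrow> length q \<le> length r" 
    unfolding P_def using suffix_length_le by blast
  ultimately obtain q where q: "P q" and mx: "\<And>q'. P q' \<Longrightarrow> length q' \<le> length q"
    using Lattices_Big.ex_has_greatest_nat[of P "[last r]" length "Suc (length r)"] by (metis le_imp_less_Suc)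
  have q': "palindrome q" "q \<noteq> []" "suffix q r" using q P_def by auto
  have "sublist q u" using q'(3) unfolding r_def
    by (meson sublist_order.order.trans suffix_imp_sublist sublist_take)
  have "first_end u q = j"
  proof (rule ccontr)
    assume ne: "first_end u q \<noteq> j"
    have le: "first_end u q \<le> j" using q'(3) j unfolding r_def by (intro first_end_le) auto
    have "suffix q (take (first_end u q) r)"
      using first_end(2)[OF \<open>sublist q u\<close>] le unfolding r_def by (simp add: min_def)
    then obtain s where s: "take (first_end u q) r = s @ q" by (auto simp: Sublist.suffix_def)
    have st: "r = s @ q @ drop (first_end u q) r" "drop (first_end u q) r \<noteq> []"
      using s append_take_drop_id[of "first_end u q" r] le ne r by auto
    \<comment> \<open>The rightmost non-final occurrence of \<open>q\<close> is wanted: the suffix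
      starting there has \<open>q\<close> only at its two ends.\<close>
    define Q where "Q i \<longleftrightarrow> (\<exists>s t. r = s @ q @ t \<and> t \<noteq> [] \<and> length s = i)" for i
    have "Q (length s)" using st Q_def by blast
    moreover have "\<forall>i. Q i \<longrightarrow> i \<le> length r" unfolding Q_def by auto
    ultimately obtain i where i: "Q i" and imx: "\<And>i'. Q i' \<Longrightarrow> i' \<le> i"
      using Nat.ex_has_greatest_nat[of Q "length s" "length r"] by metis
    obtain s1 t1 where s1: "r = s1 @ q @ t1" "t1 \<noteq> []" "length s1 = i" using i Q_def by blast
    define r' where "r' = q @ t1"
    have "suffix r' r" using s1 r'_def by (auto simp: Sublist.suffix_def)
    have "r' \<in> L" using r L(2) \<open>suffix r' r\<close> unfolding factorial_lang_def by (meson suffix_imp_sublist)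
    have "suffix q r'" using q'(3) \<open>suffix r' r\<close> suffix_length_suffix[of q r r'] r'_def by auto
    have "s' = [] \<or> t' = []" if "r' = s' @ q @ t'" for s' t'
    proof (rule ccontr)
      assume c: "\<not> (s' = [] \<or> t' = [])"
      have "r = (s1 @ s') @ q @ t'" using that s1 r'_def by simp
      then have "Q (length (s1 @ s'))" using c Q_def by blast
      from imx[OF this] show False using c s1 by simp
    qed
    then have "palindrome r'"
      using palindromic_returnsD[OF L(1) \<open>r' \<in> L\<close> q'(1,2) _ \<open>suffix q r'\<close>] r'_def by auto
    then have "P r'" using \<open>suffix r' r\<close> s1 q' r'_def unfolding P_def by auto
    from mx[OF this] s1 show False unfolding r'_def by simp
  qed
  then show "j \<in> first_end u ` pal_factors u" using \<open>sublist q u\<close> q' by blast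
qed

section \<open>Coding by return words\<close>

datatype letter = N0 | N1 | N2

lemma UNIV_letter: "UNIV = {N0, N1, N2}"
  using letter.exhaust by auto

instance letter :: finite
  by standard (simp add: UNIV_letter)

definition subst :: "(letter \<Rightarrow> letter list) \<Rightarrow> letter list \<Rightarrow> letter list" where
  "subst p v = concat (map (\<lambda>a. N0 # p a) v)"

text \<open>The added marker closes the last block; with it, the reversed image is the image of the
  reversed word.\<close>

definition desubst :: "(letter \<Rightarrow> letter list) \<Rightarrow> letter list set \<Rightarrow> letter list set" where
  "desubst p L = {v. subst p v @ [N0] \<in> L}"

definition extendable :: "'a list set \<Rightarrow> bool" where
  "extendable L \<longleftrightarrow> (\<forall>u\<in>L. u \<noteq> [] \<longrightarrow> (\<exists>a b. a # u @ [b] \<in> L))"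

lemma subst_simps [simp]:
  "subst p [] = []" "subst p (a # v) = N0 # p a @ subst p v" "subst p (u @ v) = subst p u @ subst p v"
  by (auto simp: subst_def)

lemma factorialD: "factorial_lang L \<Longrightarrow> s @ u @ t \<in> L \<Longrightarrow> u \<in> L"
  unfolding factorial_lang_def by (metis sublist_appendI)

lemma factorialD1: "factorial_lang L \<Longrightarrow> s @ u \<in> L \<Longrightarrow> u \<in> L"
  using factorialD[of L s u "[]"] by simp

lemma factorialD2: "factorial_lang L \<Longrightarrow> u @ t \<in> L \<Longrightarrow> u \<in> L"
  using factorialD[of L "[]" u t] by simp

lemma factorialI:
  assumes "\<And>s u t. s @ u @ t \<in> L \<Longrightarrow> u \<in> L"
  shows "factorial_lang L"
  unfolding factorial_lang_def sublist_def using assms by blast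

lemma subst_snoc_hd: "\<exists>w. subst p v @ [N0] = N0 # w"
  by (cases v) auto

lemma extend_right:
  assumes "factorial_lang L" "extendable L" "u \<in> L" "u \<noteq> []"
  shows "\<exists>t. length t = n \<and> u @ t \<in> L"
proof (induction n)
  case (Suc n)
  then obtain t where t: "length t = n" "u @ t \<in> L" by blast
  then obtain a b where "a # (u @ t) @ [b] \<in> L" using assms unfolding extendable_def by blast
  then have "u @ (t @ [b]) \<in> L" using factorialD1[OF assms(1), of "[a]"] by simp
  then show ?case using t by (intro exI[of _ "t @ [b]"]) auto
qed (use assms in auto)

lemma extend_left:
  assumes "factorial_lang L" "extendable L" "u \<in> L" "u \<noteq> []"
  shows "\<exists>t. length t = n \<and> t @ u \<in> L"
proof (induction n)
  case (Suc n)
  then obtain t where t: "length t = n" "t @ u \<in> L" by blast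
  then obtain a b where "a # (t @ u) @ [b] \<in> L" using assms unfolding extendable_def by blast
  then have "(a # t) @ u \<in> L" using factorialD2[OF assms(1), of "(a # t) @ u" "[b]"] by simp
  then show ?case using t by (intro exI[of _ "a # t"]) auto
qed (use assms in auto)

locale block_code =
  fixes p :: "letter \<Rightarrow> letter list"
  assumes marker_free: "N0 \<notin> set (p a)"
    and block_palindrome: "rev (p a) = p a"
    and inj_block: "inj p"
begin

abbreviation "\<phi> \<equiv> subst p"

lemma rev_subst: "rev (\<phi> v @ [N0]) = \<phi> (rev v) @ [N0]"
proof (induction v)
  case (Cons a v)
  have "rev (\<phi> (a # v) @ [N0]) = rev (\<phi> v @ [N0]) @ p a @ [N0]" by (simp add: block_palindrome)
  then show ?case using Cons by simp
qed simp

text \<open>Blocks contain no marker, so each marker of the image starts a block or is the final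
  one; cutting there cuts the preimage.\<close>

lemma split_subst:
  assumes "\<phi> v @ [N0] = S @ N0 # T"
  shows "\<exists>s t. v = s @ t \<and> S = \<phi> s \<and> \<phi> t @ [N0] = N0 # T"
  using assms
proof (induction v arbitrary: S)
  case Nil
  then show ?case by (cases S) auto
next
  case (Cons a v)
  show ?case
  proof (cases S)
    case Nil
    then show ?thesis using Cons.prems by (intro exI[of _ "[]"] exI[of _ "a # v"]) auto
  next
    case (Cons c S')
    have eq: "p a @ (\<phi> v @ [N0]) = S' @ N0 # T" and c: "c = N0" using Cons.prems Cons by auto
    obtain w where w: "\<phi> v @ [N0] = N0 # w" using subst_snoc_hd by blast
    from eq obtain us where us: "p a @ us = S' \<and> \<phi> v @ [N0] = us @ N0 # T \<or> p a = S' @ us \<and> us @ (\<phi> v @ [N0]) = N0 # T"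
      by (auto simp: append_eq_append_conv2)
    have "\<exists>us. S' = p a @ us \<and> \<phi> v @ [N0] = us @ N0 # T"
      using us
    proof
      assume h: "p a = S' @ us \<and> us @ (\<phi> v @ [N0]) = N0 # T"
      have "us = []" using h marker_free[of a] by (cases us) auto
      then show ?thesis using h by auto
    qed auto
    then obtain us where us: "S' = p a @ us" "\<phi> v @ [N0] = us @ N0 # T" by blast
    from Cons.IH[OF us(2)] obtain s t where "v = s @ t" "us = \<phi> s" "\<phi> t @ [N0] = N0 # T" by blast
    then show ?thesis using us c Cons by (intro exI[of _ "a # s"] exI[of _ t]) auto
  qed
qed

lemma marker_free_prefix_eq:
  assumes "u @ N0 # x = v @ N0 # y" "N0 \<notin> set u" "N0 \<notin> set v"
  shows "u = v \<and> x = y"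
  using assms
proof (induction u arbitrary: v)
  case Nil then show ?case by (cases v) auto
next
  case (Cons a u) then show ?case by (cases v) auto
qed

lemma subst_eq_iff [simp]: "\<phi> u = \<phi> v \<longleftrightarrow> u = v"
proof
  have gen: "\<phi> u @ [N0] = \<phi> v @ [N0] \<Longrightarrow> u = v" for u v
  proof (induction u arbitrary: v)
    case Nil then show ?case by (cases v) auto
  next
    case (Cons a u)
    then obtain b v' where v: "v = b # v'" by (cases v) auto
    obtain x where x: "\<phi> u @ [N0] = N0 # x" using subst_snoc_hd by blast
    obtain y where y: "\<phi> v' @ [N0] = N0 # y" using subst_snoc_hd by blast
    have "p a @ N0 # x = p b @ N0 # y" using Cons.prems v x y by simp
    then have "p a = p b \<and> x = y" using marker_free_prefix_eq marker_free by blast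
    then show ?case using v x y Cons.IH[of v'] inj_block by (auto dest: injD)
  qed
  then show "\<phi> u = \<phi> v \<Longrightarrow> u = v" by simp
qed simp

lemma prefix_subst:
  assumes "\<phi> t @ [N0] = \<phi> q @ N0 # T"
  shows "\<exists>t'. t = q @ t' \<and> \<phi> t' @ [N0] = N0 # T"
  using split_subst[OF assms] by auto

text \<open>The second hypothesis says, without a case split, that \<open>Z\<close> is empty or
  starts with the marker.\<close>

lemma split_word:
  assumes "\<phi> v0 @ [N0] = U @ Z @ N0 # X" "\<And>Y. \<exists>w. Z @ N0 # Y = N0 # w"
  shows "\<exists>v1 z r. v0 = v1 @ z @ r \<and> U = \<phi> v1 \<and> Z = \<phi> z \<and> \<phi> r @ [N0] = N0 # X"
proof -
  obtain w where w: "Z @ N0 # X = N0 # w" using assms(2) by blast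
  have "\<phi> v0 @ [N0] = U @ N0 # w" unfolding w[symmetric] by (rule assms(1))
  from split_subst[OF this] obtain v1 r1 where v1: "v0 = v1 @ r1" "U = \<phi> v1" "\<phi> r1 @ [N0] = N0 # w"
    by blast
  then have "\<phi> r1 @ [N0] = Z @ N0 # X" using w by simp
  from split_subst[OF this] v1 show ?thesis by auto
qed

lemma split_subst_mid:
  assumes "\<phi> v @ [N0] = S @ \<phi> q @ N0 # T"
  shows "\<exists>s t. v = s @ q @ t \<and> S = \<phi> s \<and> \<phi> t @ [N0] = N0 # T"
proof -
  obtain w where w: "\<phi> q @ N0 # T = N0 # w" by (cases q) auto
  then have "\<phi> v @ [N0] = S @ N0 # w" using assms by simp
  from split_subst[OF this] obtain s t where st: "v = s @ t" "S = \<phi> s" "\<phi> t @ [N0] = N0 # w" by blast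
  then have "\<phi> t @ [N0] = \<phi> q @ N0 # T" using w by simp
  from prefix_subst[OF this] st show ?thesis by auto
qed

lemma palindrome_subst_iff: "palindrome (\<phi> v @ [N0]) \<longleftrightarrow> palindrome v"
proof -
  have "palindrome (\<phi> v @ [N0]) \<longleftrightarrow> \<phi> (rev v) @ [N0] = \<phi> v @ [N0]"
    unfolding palindrome_def rev_subst ..
  then show ?thesis unfolding palindrome_def by simp
qed

lemma factorial_desubst:
  assumes "factorial_lang L" shows "factorial_lang (desubst p L)"
proof (rule factorialI)
  fix s u t assume "s @ u @ t \<in> desubst p L"
  then have "\<phi> s @ \<phi> u @ (\<phi> t @ [N0]) \<in> L" by (simp add: desubst_def)
  moreover obtain w where "\<phi> t @ [N0] = N0 # w" using subst_snoc_hd by blast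
  ultimately have "\<phi> s @ (\<phi> u @ [N0]) @ w \<in> L" by simp
  from factorialD[OF assms this] show "u \<in> desubst p L" by (simp add: desubst_def)
qed

text \<open>Occurrences of \<open>\<phi> q @ [N0]\<close> in \<open>\<phi> r @ [N0]\<close> come
  from occurrences of \<open>q\<close> in \<open>r\<close>, so complete returns map to complete
  returns.\<close>

lemma returns_desubst:
  assumes "palindromic_returns L"
  shows "palindromic_returns (desubst p L)"
  unfolding palindromic_returns_def
proof (intro ballI allI impI)
  fix r q assume r: "r \<in> desubst p L" and q: "palindrome q" "q \<noteq> []" "prefix q r" "suffix q r"
    and two: "\<forall>s t. r = s @ q @ t \<longrightarrow> s = [] \<or> t = []"
  have rL: "\<phi> r @ [N0] \<in> L" using r by (simp add: desubst_def)
  have "palindrome (\<phi> r @ [N0])"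
  proof (rule palindromic_returnsD[OF assms rL, of "\<phi> q @ [N0]"])
    show "palindrome (\<phi> q @ [N0])" using q palindrome_subst_iff by simp
    obtain t where t: "r = q @ t" using q by (auto simp: Sublist.prefix_def)
    obtain w where "\<phi> t @ [N0] = N0 # w" using subst_snoc_hd by blast
    then show "prefix (\<phi> q @ [N0]) (\<phi> r @ [N0])" using t by (auto simp: Sublist.prefix_def)
    show "suffix (\<phi> q @ [N0]) (\<phi> r @ [N0])" using q by (auto simp: Sublist.suffix_def)
  next
    fix S T assume "\<phi> r @ [N0] = S @ (\<phi> q @ [N0]) @ T"
    then have "\<phi> r @ [N0] = S @ \<phi> q @ N0 # T" by simp
    from split_subst_mid[OF this] obtain s t where st: "r = s @ q @ t" "S = \<phi> s" "\<phi> t @ [N0] = N0 # T"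
      by blast
    then show "S = [] \<or> T = []" using two by (cases "s = []"; cases "t = []") auto
  qed simp
  then show "palindrome r" using palindrome_subst_iff by simp
qed

text \<open>Bounded gaps force another marker into any long extension. The word before it has to be
  a block only when it stands next to a block: later two codes share a language, and only their
  mixture is excluded.\<close>

lemma extendable_desubst:
  assumes L: "factorial_lang L" "extendable L"
    and gap: "\<And>q. q \<in> L \<Longrightarrow> N0 \<notin> set q \<Longrightarrow> length q < n"
    and ret_r: "\<And>a q. N0 \<notin> set q \<Longrightarrow> N0 # p a @ N0 # q @ [N0] \<in> L \<Longrightarrow> q \<in> range p"
    and ret_l: "\<And>a q. N0 \<notin> set q \<Longrightarrow> N0 # q @ N0 # p a @ [N0] \<in> L \<Longrightarrow> q \<in> range p"
  shows "extendable (desubst p L)"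
  unfolding extendable_def
proof (intro ballI impI)
  have extr: "\<exists>a. v @ [a] \<in> desubst p L" if v: "v \<in> desubst p L" "v \<noteq> []" for v
  proof -
    have vL: "\<phi> v @ [N0] \<in> L" using v by (simp add: desubst_def)
    from extend_right[OF L vL] obtain t where t: "length t = n" "(\<phi> v @ [N0]) @ t \<in> L" by blast
    then have "t \<in> L" using factorialD1[OF L(1)] by blast
    then have "N0 \<in> set t" using gap t by fastforce
    then obtain q t' where q: "t = q @ N0 # t'" "N0 \<notin> set q" by (meson split_list_first)
    have m: "\<phi> v @ N0 # q @ [N0] \<in> L" using t q factorialD2[OF L(1), of "\<phi> v @ N0 # q @ [N0]" t'] by simp
    obtain v' a where v': "v = v' @ [a]" using v by (metis rev_exhaust)
    have "N0 # p a @ N0 # q @ [N0] \<in> L" using m v' factorialD1[OF L(1), of "\<phi> v'"] by simp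
    then obtain b where "q = p b" using ret_r q by blast
    then have "v @ [b] \<in> desubst p L" using m by (simp add: desubst_def)
    then show ?thesis by blast
  qed
  have extl: "\<exists>a. a # v \<in> desubst p L" if v: "v \<in> desubst p L" "v \<noteq> []" for v
  proof -
    have vL: "\<phi> v @ [N0] \<in> L" using v by (simp add: desubst_def)
    from extend_left[OF L vL] obtain t where t: "length t = n" "t @ \<phi> v @ [N0] \<in> L" by blast
    then have "t \<in> L" using factorialD2[OF L(1)] by blast
    then have "N0 \<in> set t" using gap t by fastforce
    then obtain q t' where q: "t = t' @ N0 # q" "N0 \<notin> set q" by (meson split_list_last)
    have m: "N0 # q @ \<phi> v @ [N0] \<in> L" using t q factorialD1[OF L(1), of t'] by simp
    obtain v' a where v': "v = a # v'" using v by (cases v) auto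
    obtain w where w: "\<phi> v' @ [N0] = N0 # w" using subst_snoc_hd by blast
    have "(N0 # q @ N0 # p a @ [N0]) @ w \<in> L" using m v' w by simp
    then have "N0 # q @ N0 # p a @ [N0] \<in> L" using factorialD2[OF L(1)] by blast
    then obtain b where "q = p b" using ret_l q by blast
    then have "b # v \<in> desubst p L" using m by (simp add: desubst_def)
    then show ?thesis by blast
  qed
  fix v assume v: "v \<in> desubst p L" "v \<noteq> []"
  then obtain b where "v @ [b] \<in> desubst p L" using extr by blast
  then show "\<exists>a b. a # v @ [b] \<in> desubst p L" using extl[of "v @ [b]"] by auto
qed

end

section \<open>Weighted repetitions\<close>

text \<open>
  A repetition \<open>x @ z = z @ t\<close> has period \<open>x\<close> and excess \<open>z\<close>; the letters \<open>a\<close>, \<open>b\<close>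
  around it are compared with the letters \<open>last x\<close>, \<open>hd t\<close> that would prolong it. The numbers
  \<open>k\<close>, \<open>e\<close> record by how much the repetition grows at its two ends when it is mapped down to
  the binary word, and \<open>W\<close> records the lengths of the images of letters.
\<close>

definition weight :: "('a \<Rightarrow> real) \<Rightarrow> 'a list \<Rightarrow> real" where
  "weight W u = sum_list (map W u)"

lemma weight_simps [simp]:
  "weight W [] = 0" "weight W (a # u) = W a + weight W u" "weight W (u @ v) = weight W u + weight W v"
  "weight W (rev u) = weight W u"
  by (auto simp: weight_def) (induction u; simp)

text \<open>\<open>\<beta>\<close> bounds excess over period, so it stands for the exponent minus
  one.\<close>

definition bounded_powers :: "real \<Rightarrow> 'a list set \<Rightarrow> ('a \<Rightarrow> real) \<Rightarrow> real \<Rightarrow> ('a \<Rightarrow> 'a \<Rightarrow> real) \<Rightarrow> bool" where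
  "bounded_powers \<beta> L W k e \<longleftrightarrow> (\<forall>a x z t b. a # x @ z @ [b] \<in> L \<longrightarrow> x @ z = z @ t \<longrightarrow> x \<noteq> [] \<longrightarrow>
     weight W z + k + e a (last x) + e b (hd t) < \<beta> * weight W x)"

lemma bounded_powersD:
  assumes "bounded_powers \<beta> L W k e" "a # x @ z @ [b] \<in> L" "x @ z = z @ t" "x \<noteq> []"
  shows "weight W z + k + e a (last x) + e b (hd t) < \<beta> * weight W x"
  using assms unfolding bounded_powers_def by blast

text \<open>The blocks of distinct letters \<open>a\<close>, \<open>c\<close>, followed by the marker, agree exactly on \<open>ext a c\<close>,
  after which they show the letters \<open>nxt a c\<close> and \<open>nxt c a\<close>.\<close>

locale extension_code = block_code +
  fixes ext :: "letter \<Rightarrow> letter \<Rightarrow> letter list" and nxt :: "letter \<Rightarrow> letter \<Rightarrow> letter"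
  assumes ext_prefix: "\<exists>r. p a @ [N0] = ext a c @ nxt a c # r"
    and ext_sym: "ext a c = ext c a"
begin

lemma ext_suffix: "\<exists>r. N0 # p a = r @ nxt a c # rev (ext a c)"
proof -
  obtain r where "p a @ [N0] = ext a c @ nxt a c # r" using ext_prefix by blast
  then have "rev (p a @ [N0]) = rev (ext a c @ nxt a c # r)" by simp
  then have "N0 # p a = rev r @ nxt a c # rev (ext a c)" by (simp add: block_palindrome)
  then show ?thesis by blast
qed

lemma weight_subst: "weight W (\<phi> v) = weight (\<lambda>a. W N0 + weight W (p a)) v"
  by (induction v) auto

text \<open>The image repetition grows by the marker after \<open>\<phi> z\<close> and by the common
  parts of the blocks at both ends. Beyond these the letters \<open>nxt\<close> are compared, which
  is why \<open>e\<close> reappears inside the new gain.\<close>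

lemma bounded_powers_desubst:
  assumes "bounded_powers \<beta> L W k e" "factorial_lang L"
  shows "bounded_powers \<beta> (desubst p L) (\<lambda>a. W N0 + weight W (p a)) (k + W N0)
    (\<lambda>a c. weight W (ext a c) + e (nxt a c) (nxt c a))"
  unfolding bounded_powers_def
proof (intro allI impI)
  fix a x z t b
  assume L': "a # x @ z @ [b] \<in> desubst p L" and xz: "x @ z = z @ t" and x: "x \<noteq> []"
  have lenxt: "length x = length t" using xz by (metis add_left_cancel length_append add.commute)
  define c d where "c = last x" and "d = hd t"
  obtain x0 where x0: "x = x0 @ [c]" using x c_def by (metis append_butlast_last_id)
  obtain t0 where t0: "t = d # t0" using lenxt x d_def by (cases t) auto
  obtain ra where ra: "N0 # p a = ra @ nxt a c # rev (ext a c)" using ext_suffix by blast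
  obtain rc where rc: "N0 # p c = rc @ nxt c a # rev (ext a c)" using ext_suffix[of c a] ext_sym by metis
  obtain rb where rb: "p b @ [N0] = ext b d @ nxt b d # rb" using ext_prefix by blast
  obtain rd where rd: "p d @ [N0] = ext b d @ nxt d b # rd" using ext_prefix[of d b] ext_sym by metis
  \<comment> \<open>\<open>X\<close> is \<open>\<phi> x\<close> rotated by the common part
    \<open>rev (ext a c)\<close>, so it has the same weight.\<close>
  define X where "X = rev (ext a c) @ \<phi> x0 @ rc @ [nxt c a]"
  define Z where "Z = rev (ext a c) @ \<phi> z @ N0 # ext b d"
  obtain w where w: "\<phi> t0 @ [N0] = N0 # w" using subst_snoc_hd by blast
  have "(N0 # p a) @ \<phi> x @ \<phi> z @ N0 # (p b @ [N0]) \<in> L"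
    using L' by (simp add: desubst_def)
  then have "ra @ (nxt a c # X @ Z @ [nxt b d]) @ rb \<in> L"
    using rc unfolding ra rb x0 X_def Z_def by simp
  then have mem: "nxt a c # X @ Z @ [nxt b d] \<in> L" using factorialD[OF assms(2)] by blast
  obtain r' where r': "\<phi> t @ N0 # ext b d = N0 # ext b d @ nxt d b # r'"
  proof -
    have "\<phi> t @ N0 # ext b d = N0 # p d @ (\<phi> t0 @ [N0]) @ ext b d" using t0 by simp
    also have "\<dots> = N0 # (p d @ [N0]) @ w @ ext b d" unfolding w by simp
    also have "\<dots> = N0 # ext b d @ nxt d b # (rd @ w @ ext b d)" unfolding rd by simp
    finally show ?thesis using that by blast
  qed
  have "X @ Z = rev (ext a c) @ \<phi> (x @ z) @ N0 # ext b d"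
    using rc unfolding X_def Z_def x0 by simp
  also have "\<dots> = Z @ nxt d b # r'" unfolding xz Z_def using r' by simp
  finally have per: "X @ Z = Z @ (nxt d b # r')" .
  have wx: "weight W X = weight W (\<phi> x)"
  proof -
    have "weight W (N0 # p c) = weight W (rc @ nxt c a # rev (ext a c))" using rc by simp
    then show ?thesis unfolding X_def x0 by simp
  qed
  have "weight W Z + k + e (nxt a c) (last X) + e (nxt b d) (hd (nxt d b # r')) < \<beta> * weight W X"
    by (rule bounded_powersD[OF assms(1) mem per]) (simp add: X_def)
  moreover have "last X = nxt c a" "weight W Z = weight W (ext a c) + weight W (\<phi> z) + W N0 + weight W (ext b d)"
    by (auto simp: X_def Z_def)
  ultimately show "weight (\<lambda>a. W N0 + weight W (p a)) z + (k + W N0) +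
      (weight W (ext a (last x)) + e (nxt a (last x)) (nxt (last x) a)) +
      (weight W (ext b (hd t)) + e (nxt b (hd t)) (nxt (hd t) b)) < \<beta> * weight (\<lambda>a. W N0 + weight W (p a)) x"
    unfolding weight_subst[symmetric] c_def[symmetric] d_def[symmetric] using wx by simp
qed

end

section \<open>The three morphisms and the closed form of their weights\<close>

fun f_block g_block h_block :: "letter \<Rightarrow> letter list" where
  "f_block N0 = []" | "f_block N1 = [N1]" | "f_block N2 = [N1, N1]"
| "g_block N0 = [N1, N1]" | "g_block N1 = [N1, N2, N1]" | "g_block N2 = [N1, N2, N1, N2, N1]"
| "h_block N0 = [N1]" | "h_block N1 = [N2]" | "h_block N2 = [N2, N2]"

text \<open>On equal letters \<open>[]\<close> understates the common part. Such an end can be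
  prolonged, which \<open>absorbed\<close> takes into account in the upper bound.\<close>

fun f_ext g_ext h_ext :: "letter \<Rightarrow> letter \<Rightarrow> letter list" where
  "f_ext N1 N2 = [N1]" | "f_ext N2 N1 = [N1]" | "f_ext _ _ = []"
| "h_ext N1 N2 = [N2]" | "h_ext N2 N1 = [N2]" | "h_ext _ _ = []"
| "g_ext N1 N2 = [N1, N2, N1]" | "g_ext N2 N1 = [N1, N2, N1]"
| "g_ext N0 N1 = [N1]" | "g_ext N1 N0 = [N1]" | "g_ext N0 N2 = [N1]" | "g_ext N2 N0 = [N1]"
| "g_ext _ _ = []"

text \<open>The marker after the block is included because one block may be a prefix of the other,
  as for \<open>N1\<close> and \<open>N2\<close> under \<open>f_block\<close>.\<close>

definition nxt_of :: "(letter \<Rightarrow> letter list) \<Rightarrow> (letter \<Rightarrow> letter \<Rightarrow> letter list) \<Rightarrow> letter \<Rightarrow> letter \<Rightarrow> letter" where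
  "nxt_of p ext a c = (p a @ [N0]) ! length (ext a c)"

lemma letter_all: "(\<forall>a. P a) \<longleftrightarrow> P N0 \<and> P N1 \<and> P N2"
  by (metis letter.exhaust)

lemma extension_codeI:
  assumes "\<forall>a. N0 \<notin> set (p a) \<and> rev (p a) = p a" "\<forall>a b. p a = p b \<longrightarrow> a = b"
    "\<forall>a c. ext a c = ext c a" "\<forall>a c. take (length (ext a c)) (p a @ [N0]) = ext a c"
    "\<forall>a c. length (ext a c) \<le> length (p a)"
  shows "extension_code p ext (nxt_of p ext)"
proof
  fix a c
  have "p a @ [N0] = take (length (ext a c)) (p a @ [N0]) @ (p a @ [N0]) ! length (ext a c) # drop (Suc (length (ext a c))) (p a @ [N0])"
    using assms(5) by (intro id_take_nth_drop) (simp add: le_imp_less_Suc)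
  then show "\<exists>r. p a @ [N0] = ext a c @ nxt_of p ext a c # r" using assms(4) unfolding nxt_of_def by metis
qed (use assms in \<open>auto simp: inj_def\<close>)

interpretation f: extension_code f_block f_ext "nxt_of f_block f_ext"
  by (rule extension_codeI; simp add: letter_all)

interpretation g: extension_code g_block g_ext "nxt_of g_block g_ext"
  by (rule extension_codeI; simp add: letter_all)

interpretation h: extension_code h_block h_ext "nxt_of h_block h_ext"
  by (rule extension_codeI; simp add: letter_all)

text \<open>The weights reached by repeated desubstitution depend on two lengths only; \<open>\<delta>\<close> is \<open>1\<close> or \<open>-1\<close>
  according to whether \<open>g\<close> has not or has been used.\<close>

fun wt :: "real \<Rightarrow> real \<Rightarrow> letter \<Rightarrow> real" where
  "wt A C N0 = A" | "wt A C N1 = C - A" | "wt A C N2 = C"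

text \<open>The excess contributed by markers: a step by \<open>h\<close> adds \<open>A\<close>, and
  so does passing to \<open>(C, A + 2 * C)\<close> in \<open>(C - A) / 2\<close>. The last term
  corrects the value after \<open>g\<close>, which is 2 and not 4.\<close>

definition excess :: "real \<Rightarrow> real \<Rightarrow> real \<Rightarrow> real" where
  "excess A C \<delta> = (C - A) / 2 - (1 - \<delta>)"

text \<open>Closed form of the recursion for end gains. Under \<open>h\<close> the other distinct
  pairs reduce at once to \<open>N1\<close>, \<open>N2\<close>, while that pair first shares a
  letter of weight \<open>C\<close> and then reduces to \<open>N0\<close>,
  \<open>N2\<close>.\<close>

fun gain :: "real \<Rightarrow> real \<Rightarrow> real \<Rightarrow> letter \<Rightarrow> letter \<Rightarrow> real" where
  "gain A C \<delta> N1 N2 = (C - \<delta>) / 2" | "gain A C \<delta> N2 N1 = (C - \<delta>) / 2"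
| "gain A C \<delta> a b = (if a = b then 0 else (A - \<delta>) / 2)"

abbreviation "level_powers \<beta> L A C \<delta> \<equiv> bounded_powers \<beta> L (wt A C) (excess A C \<delta>) (gain A C \<delta>)"

lemma level_powers_f:
  assumes "bounded_powers \<beta> L (\<lambda>_. 1) 0 (\<lambda>_ _. 0)" "factorial_lang L"
  shows "level_powers \<beta> (desubst f_block L) 1 3 1"
proof -
  have "(\<lambda>a. 1 + weight (\<lambda>_. 1) (f_block a)) = wt 1 3"
    by (rule ext, case_tac a) auto
  moreover have "(\<lambda>a c. weight (\<lambda>_. 1) (f_ext a c) + 0) = gain 1 3 1"
    by (intro ext, case_tac a; case_tac c) auto
  ultimately show ?thesis using f.bounded_powers_desubst[OF assms] by (simp add: excess_def)
qed

text \<open>The image weights \<open>C\<close>, \<open>A + C\<close>, \<open>A + 2 * C\<close> again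
  have the form \<open>wt\<close>, so only the pair of lengths changes.\<close>

lemma level_powers_h:
  assumes "level_powers \<beta> L A C \<delta>" "factorial_lang L"
  shows "level_powers \<beta> (desubst h_block L) C (A + 2 * C) \<delta>"
proof -
  have "(\<lambda>a. wt A C N0 + weight (wt A C) (h_block a)) = wt C (A + 2 * C)"
    by (rule ext, case_tac a) auto
  moreover have "(\<lambda>a c. weight (wt A C) (h_ext a c) + gain A C \<delta> (nxt_of h_block h_ext a c) (nxt_of h_block h_ext c a)) = gain C (A + 2 * C) \<delta>"
    by (intro ext, case_tac a; case_tac c) (auto simp: nxt_of_def field_simps)
  moreover have "excess A C \<delta> + wt A C N0 = excess C (A + 2 * C) \<delta>"
    by (simp add: excess_def field_simps)
  ultimately show ?thesis using h.bounded_powers_desubst[OF assms] by simp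
qed

lemma level_powers_g:
  assumes "level_powers \<beta> L 1 3 1" "factorial_lang L"
  shows "level_powers \<beta> (desubst g_block L) 5 13 (-1)"
proof -
  have "(\<lambda>a. wt 1 3 N0 + weight (wt 1 3) (g_block a)) = wt 5 13"
    by (rule ext, case_tac a) auto
  moreover have "(\<lambda>a c. weight (wt 1 3) (g_ext a c) + gain 1 3 1 (nxt_of g_block g_ext a c) (nxt_of g_block g_ext c a)) = gain 5 13 (-1)"
    by (intro ext, case_tac a; case_tac c) (auto simp: nxt_of_def)
  moreover have "excess 1 3 1 + wt 1 3 N0 = excess 5 13 (-1)"
    by (simp add: excess_def)
  ultimately show ?thesis using g.bounded_powers_desubst[OF assms] by simp
qed

section \<open>Refutation trees\<close>

definition rich_language :: "'a list set \<Rightarrow> bool" where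
  "rich_language L \<longleftrightarrow> factorial_lang L \<and> extendable L \<and> palindromic_returns L"

text \<open>\<open>Ret i m l\<close> and \<open>Bad i m q\<close> point at the window of length
  \<open>m\<close> at offset \<open>i\<close> of the word as extended so far; \<open>l\<close> is
  the length of the palindrome, \<open>q\<close> a label of the bad factor. \<open>Rgt\<close> and
  \<open>Lft\<close> branch over the letter added on that side.\<close>

datatype refutation = Ret nat nat nat | Bad nat nat nat | Out
  | Rgt refutation refutation refutation | Lft refutation refutation refutation

text \<open>Evaluated on the tail of a candidate return, it says that the palindrome recurs only at
  the very end. The recursion lets the simplifier decide it.\<close>

fun occurs_last_only :: "'a list \<Rightarrow> 'a list \<Rightarrow> bool" where
  "occurs_last_only p [] = False"
| "occurs_last_only p (x # xs) = (if prefix p (x # xs) then p = x # xs else occurs_last_only p xs)"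

text \<open>\<open>refutes bad \<tau> w\<close> checks that every sufficiently long extension of \<open>w\<close>, to the side chosen by the
  inner nodes of \<open>\<tau>\<close>, contains a complete return to a palindrome that is no palindrome (\<open>Ret\<close>)
  or a bad factor.\<close>

fun refutes :: "(nat \<Rightarrow> letter list \<Rightarrow> bool) \<Rightarrow> refutation \<Rightarrow> letter list \<Rightarrow> bool" where
  "refutes bad (Ret i m l) w = (let r = take m (drop i w); p = take l r in
     p \<noteq> [] \<and> rev p = p \<and> occurs_last_only p (tl r) \<and> rev r \<noteq> r)"
| "refutes bad (Bad i m q) w = bad q (take m (drop i w))"
| "refutes bad Out w = (bad 0 [last w] \<or> bad 0 [hd w])"
| "refutes bad (Rgt t0 t1 t2) w \<longleftrightarrow> refutes bad t0 (w @ [N0]) \<and> refutes bad t1 (w @ [N1]) \<and> refutes bad t2 (w @ [N2])"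
| "refutes bad (Lft t0 t1 t2) w \<longleftrightarrow> refutes bad t0 (N0 # w) \<and> refutes bad t1 (N1 # w) \<and> refutes bad t2 (N2 # w)"

lemma occurs_last_only:
  assumes "occurs_last_only p xs" "p \<noteq> []"
  shows "suffix p xs" "xs = s @ p @ t \<Longrightarrow> t = []"
  using assms
proof (induction xs arbitrary: s t)
  case (Cons x xs)
  { case 1 then show ?case using Cons.IH(1) by (auto split: if_splits simp: suffix_Cons)
  next
    case 2
    show ?case
    proof (cases s)
      case Nil
      then have "prefix p (x # xs)" using 2 by simp
      then have "p = x # xs" using 2(2) unfolding occurs_last_only.simps by (simp only: if_True)
      then show ?thesis using 2 Nil by simp
    next
      case (Cons y s')
      then have xs: "xs = s' @ p @ t" using 2 by simp
      show ?thesis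
      proof (cases "prefix p (x # xs)")
        case True
        then have "p = x # xs" using 2(2) unfolding occurs_last_only.simps by (simp only: if_True)
        then have "length p = Suc (length xs)" by simp
        then show ?thesis using xs by simp
      next
        case False
        then have "occurs_last_only p xs" using 2(2) unfolding occurs_last_only.simps by (simp only: if_False)
        then show ?thesis using Cons.IH(2)[OF xs] 2(3) by blast
      qed
    qed
  }
qed auto

lemma factorial_take_drop: "factorial_lang L \<Longrightarrow> w \<in> L \<Longrightarrow> take m (drop i w) \<in> L"
  unfolding factorial_lang_def by (meson sublist_drop sublist_order.order.trans sublist_take)

text \<open>If \<open>w\<close> were in the language, extendability would put one of its three
  one-letter extensions there too, and so on down to a leaf, where a factor is bad or is a
  non-palindromic return.\<close>

lemma refutes_sound:
  assumes L: "rich_language L" and bad: "\<And>q r. bad q r \<Longrightarrow> r \<notin> L"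
  shows "refutes bad \<tau> w \<Longrightarrow> w \<noteq> [] \<Longrightarrow> w \<notin> L"
proof (induction \<tau> arbitrary: w)
  case (Ret i m l)
  define r where "r = take m (drop i w)"
  define p where "p = take l r"
  have h: "p \<noteq> []" "rev p = p" "occurs_last_only p (tl r)" "rev r \<noteq> r"
    using Ret unfolding r_def p_def by (auto simp: Let_def)
  show ?case
  proof
    assume "w \<in> L"
    then have "r \<in> L" using L factorial_take_drop unfolding r_def rich_language_def by blast
    have "palindrome r"
    proof (rule palindromic_returnsD)
      show "palindromic_returns L" using L rich_language_def by blast
      show "palindrome p" using h by (simp add: palindrome_def)
      show "prefix p r" unfolding p_def by (rule take_is_prefix)
      have "suffix p (tl r)" using occurs_last_only(1)[OF h(3,1)] .
      then show "suffix p r" by (cases r) (auto simp: suffix_Cons)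
      fix s t assume r: "r = s @ p @ t"
      show "s = [] \<or> t = []"
      proof (cases s)
        case (Cons y s')
        then have "tl r = s' @ p @ t" using r by simp
        then show ?thesis using occurs_last_only(2)[OF h(3,1)] by blast
      qed simp
    qed (use h \<open>r \<in> L\<close> in auto)
    then show False using h by (simp add: palindrome_def)
  qed
next
  case (Bad i m q)
  then show ?case using bad L factorial_take_drop unfolding rich_language_def by fastforce
next
  case Out
  have "[last w] \<in> L" "[hd w] \<in> L" if "w \<in> L"
    using that L Out(2) unfolding rich_language_def
    by (metis append_butlast_last_id factorialD1, metis append_Cons append_Nil factorialD2 list.collapse)
  then show ?case using bad Out by auto
next
  case (Rgt t0 t1 t2)
  show ?case
  proof
    assume w: "w \<in> L"
    then obtain a b where ab: "a # w @ [b] \<in> L" using L Rgt.prems unfolding rich_language_def extendable_def by blast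
    then have "w @ [b] \<in> L" using factorialD1[of L "[a]" "w @ [b]"] L unfolding rich_language_def by simp
    then show False using Rgt by (cases b) auto
  qed
next
  case (Lft t0 t1 t2)
  show ?case
  proof
    assume w: "w \<in> L"
    then obtain a b where ab: "a # w @ [b] \<in> L" using L Lft.prems unfolding rich_language_def extendable_def by blast
    then have "a # w \<in> L" using factorialD2[of L "a # w" "[b]"] L unfolding rich_language_def by simp
    then show False using Lft by (cases a) auto
  qed
qed

text \<open>For \<open>q > 0\<close>, \<open>binary_bad q\<close> recognises the words of period \<open>q\<close> and exponent at least \<open>11 / 4\<close>,
  a rational above \<open>2 + sqrt 2 / 2\<close>; the case \<open>q = 0\<close> excludes the letter \<open>N2\<close> from binary words.\<close>

definition binary_bad :: "nat \<Rightarrow> letter list \<Rightarrow> bool" where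
  "binary_bad q r \<longleftrightarrow> (if q = 0 then r = [N2] else q < length r \<and> drop q r = take (length r - q) r \<and> 7 * q \<le> 4 * (length r - q))"

section \<open>Certificates for words forbidden below f\<close>

lemma refuted_00: "\<exists>\<tau>. refutes binary_bad \<tau> (subst f_block [N0, N0] @ [N0])"
  by (rule exI[of _ "Bad 0 3 1"])
    (simp add: binary_bad_def Let_def)

lemma refuted_111: "\<exists>\<tau>. refutes binary_bad \<tau> (subst f_block [N1, N1, N1] @ [N0])"
  by (rule exI[of _ "Bad 0 6 2"])
    (simp add: binary_bad_def Let_def)

lemma refuted_222: "\<exists>\<tau>. refutes binary_bad \<tau> (subst f_block [N2, N2, N2] @ [N0])"
  by (rule exI[of _ "Bad 0 9 3"])
    (simp add: binary_bad_def Let_def)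

lemma refuted_112: "\<exists>\<tau>. refutes binary_bad \<tau> (subst f_block [N1, N1, N2] @ [N0])"
  by (rule exI[of _ "Bad 0 6 2"])
    (simp add: binary_bad_def Let_def)

lemma refuted_121212: "\<exists>\<tau>. refutes binary_bad \<tau> (subst f_block [N1, N2, N1, N2, N1, N2] @ [N0])"
  by (rule exI[of _ "Bad 0 14 5"])
    (simp add: binary_bad_def Let_def)

lemma refuted_021212: "\<exists>\<tau>. refutes binary_bad \<tau> (subst f_block [N0, N2, N1, N2, N1, N2] @ [N0])"
  by (rule exI[of _ "Bad 1 14 5"])
    (simp add: binary_bad_def Let_def)

text \<open>The image 011011010 is itself harmless, its highest exponent being 8 / 3, so the
  certificate has to follow extensions to both sides.\<close>

lemma refuted_221: "\<exists>\<tau>. refutes binary_bad \<tau> (subst f_block [N2, N2, N1] @ [N0])"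
  by (rule exI[of _ "Lft (Lft (Bad 0 3 1) (Lft (Ret 0 12 3) (Lft (Rgt (Ret 3 11 2) (Rgt (Bad 9 6 2) (Rgt (Rgt (Ret 3 14 2)
    (Lft (Lft (Bad 0 3 1) (Lft (Ret 0 16 3) (Bad 0 11 4) Out) Out) (Lft (Ret 0 15 3) (Lft (Lft (Lft (Bad 0 3
    1) (Lft (Ret 0 19 3) (Lft (Lft (Lft (Bad 0 3 1) (Lft (Ret 0 23 3) (Bad 0 11 4) Out) Out) (Lft (Ret 0 22
    3) (Bad 0 20 7) Out) Out) (Bad 0 3 1) Out) Out) Out) (Lft (Lft (Ret 0 11 2) (Lft (Bad 0 6 2) (Lft (Lft
    (Ret 0 14 2) (Rgt (Rgt (Ret 12 16 2) (Rgt (Bad 23 6 2) (Bad 15 14 5) Out) Out) (Rgt (Rgt (Rgt (Bad 27 3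
    1) (Rgt (Ret 19 12 3) (Rgt (Lft (Lft (Ret 0 16 2) (Lft (Bad 0 6 2) (Bad 0 14 5) Out) Out) (Lft (Lft (Lft
    (Bad 0 3 1) (Lft (Ret 0 12 3) (Lft (Rgt (Rgt (Bad 37 3 1) (Rgt (Ret 25 16 3) (Bad 30 11 4) Out) Out)
    (Rgt (Ret 25 15 3) (Rgt (Lft (Lft (Bad 0 3 1) (Lft (Ret 0 16 3) (Bad 0 11 4) Out) Out) (Bad 0 42 15)
    Out) (Bad 38 3 1) Out) Out) Out) (Bad 0 3 1) Out) Out) Out) (Bad 0 9 3) Out) (Bad 0 3 1) Out) Out) (Bad
    29 3 1) Out) Out) Out) (Bad 20 9 3) Out) (Bad 25 3 1) Out) Out) Out) (Bad 0 3 1) Out) Out) Out) (Bad 0 9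
    3) Out) Out) (Bad 0 3 1) Out) Out) Out) Out) (Bad 13 3 1) Out) Out) Out) (Bad 0 3 1) Out) Out) Out) (Bad
    0 9 3) Out"])
    (simp add: binary_bad_def Let_def)

lemma refuted_02120: "\<exists>\<tau>. refutes binary_bad \<tau> (subst f_block [N0, N2, N1, N2, N0] @ [N0])"
  by (rule exI[of _ "Rgt (Bad 9 3 1) (Rgt (Ret 4 9 3) (Rgt (Lft (Bad 0 3 1) (Lft (Ret 0 9 3) (Lft (Rgt (Rgt (Bad 16 3 1) (Rgt
    (Ret 7 13 3) (Bad 9 11 4) Out) Out) (Rgt (Rgt (Ret 12 8 2) (Rgt (Bad 15 6 2) (Rgt (Rgt (Rgt (Bad 21 3 1)
    (Rgt (Ret 16 9 3) (Bad 0 25 9) Out) Out) (Rgt (Rgt (Ret 12 13 2) (Rgt (Bad 20 6 2) (Rgt (Bad 13 14 5)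
    (Bad 24 3 1) Out) Out) Out) (Rgt (Rgt (Ret 12 14 2) (Bad 17 9 3) Out) (Bad 22 3 1) Out) Out) Out) (Bad
    19 3 1) Out) Out) Out) (Rgt (Rgt (Rgt (Bad 19 3 1) (Rgt (Ret 7 16 3) (Rgt (Rgt (Rgt (Bad 23 3 1) (Rgt
    (Ret 7 20 3) (Bad 16 11 4) Out) Out) (Rgt (Rgt (Ret 19 8 2) (Rgt (Bad 22 6 2) (Rgt (Rgt (Rgt (Bad 28 3
    1) (Rgt (Ret 23 9 3) (Rgt (Rgt (Rgt (Bad 32 3 1) (Rgt (Ret 23 13 3) (Bad 25 11 4) Out) Out) (Rgt (Rgt
    (Ret 28 8 2) (Rgt (Bad 31 6 2) (Rgt (Rgt (Rgt (Bad 37 3 1) (Bad 15 25 9) Out) (Rgt (Rgt (Ret 28 13 2)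
    (Rgt (Bad 36 6 2) (Rgt (Bad 29 14 5) (Bad 40 3 1) Out) Out) Out) (Ret 14 26 5) Out) Out) (Bad 35 3 1)
    Out) Out) Out) (Rgt (Rgt (Rgt (Bad 35 3 1) (Rgt (Ret 23 16 3) (Rgt (Rgt (Rgt (Bad 39 3 1) (Rgt (Ret 23
    20 3) (Bad 32 11 4) Out) Out) (Rgt (Rgt (Ret 35 8 2) (Rgt (Bad 38 6 2) (Bad 0 44 16) Out) Out) (Rgt (Rgt
    (Bad 24 20 7) (Rgt (Ret 23 22 3) (Bad 36 9 3) Out) Out) (Bad 40 3 1) Out) Out) Out) (Bad 37 3 1) Out)
    Out) Out) (Rgt (Ret 23 15 3) (Bad 29 9 3) Out) Out) (Bad 33 3 1) Out) Out) Out) (Bad 30 3 1) Out) Out)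
    Out) (Rgt (Rgt (Ret 19 13 2) (Rgt (Bad 27 6 2) (Rgt (Bad 20 14 5) (Bad 31 3 1) Out) Out) Out) (Ret 14 17
    5) Out) Out) (Bad 26 3 1) Out) Out) Out) (Rgt (Rgt (Bad 8 20 7) (Rgt (Ret 7 22 3) (Bad 20 9 3) Out) Out)
    (Bad 24 3 1) Out) Out) Out) (Bad 21 3 1) Out) Out) Out) (Rgt (Ret 7 15 3) (Bad 13 9 3) Out) Out) (Bad 17
    3 1) Out) Out) Out) (Bad 0 3 1) Out) Out) Out) (Bad 11 3 1) Out) Out) Out"])
    (simp add: binary_bad_def Let_def)

lemma refuted_010110: "\<exists>\<tau>. refutes binary_bad \<tau> (subst f_block [N0, N1, N0, N1, N1, N0] @ [N0])"
  by (rule exI[of _ "Lft (Bad 0 3 1) (Lft (Bad 0 9 3) (Lft (Lft (Lft (Bad 0 3 1) (Rgt (Bad 13 3 1) (Rgt (Lft (Lft (Lft (Bad 0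
    3 1) (Lft (Lft (Bad 0 9 3) (Lft (Lft (Lft (Bad 0 3 1) (Lft (Rgt (Rgt (Bad 25 3 1) (Rgt (Bad 20 9 3) (Rgt
    (Rgt (Rgt (Bad 29 3 1) (Lft (Lft (Bad 0 3 1) (Lft (Bad 0 9 3) (Lft (Lft (Lft (Bad 0 3 1) (Rgt (Rgt (Rgt
    (Bad 38 3 1) (Lft (Bad 0 42 15) (Lft (Lft (Bad 0 11 4) (Ret 0 16 3) Out) (Bad 0 3 1) Out) Out) Out) (Ret
    25 15 3) Out) (Rgt (Rgt (Bad 30 11 4) (Ret 25 16 3) Out) (Bad 37 3 1) Out) Out) Out) (Ret 0 12 3) Out)
    (Bad 0 3 1) Out) Out) Out) (Lft (Lft (Bad 0 14 5) (Bad 0 6 2) Out) (Ret 0 16 2) Out) Out) Out) (Ret 19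
    12 3) Out) (Bad 27 3 1) Out) Out) Out) (Rgt (Rgt (Bad 15 14 5) (Bad 23 6 2) Out) (Ret 12 16 2) Out) Out)
    (Ret 0 14 2) Out) Out) (Bad 0 6 2) Out) (Ret 0 11 2) Out) Out) (Lft (Lft (Lft (Bad 0 3 1) (Lft (Lft (Bad
    0 20 7) (Ret 0 22 3) Out) (Lft (Lft (Bad 0 11 4) (Ret 0 23 3) Out) (Bad 0 3 1) Out) Out) Out) (Ret 0 19
    3) Out) (Bad 0 3 1) Out) Out) Out) (Ret 0 15 3) Out) (Lft (Lft (Bad 0 11 4) (Ret 0 16 3) Out) (Bad 0 3
    1) Out) Out) (Ret 3 14 2) Out) Out) Out) (Ret 0 12 3) Out) (Bad 0 3 1) Out) Out) Out"])
    (simp add: binary_bad_def Let_def)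

lemma refuted_2011: "\<exists>\<tau>. refutes binary_bad \<tau> (subst f_block [N2, N0, N1, N1] @ [N0])"
  by (rule exI[of _ "Rgt (Rgt (Bad 8 3 1) (Lft (Lft (Bad 0 3 1) (Rgt (Rgt (Rgt (Bad 13 3 1) (Rgt (Bad 8 9 3) (Ret 3 14 2)
    Out) Out) (Rgt (Rgt (Rgt (Bad 15 3 1) (Bad 4 14 5) Out) (Bad 11 6 2) Out) (Ret 3 13 2) Out) Out) (Rgt
    (Rgt (Rgt (Bad 14 3 1) (Rgt (Rgt (Rgt (Bad 17 3 1) (Lft (Rgt (Rgt (Bad 14 9 3) (Ret 8 15 3) Out) (Rgt
    (Rgt (Rgt (Bad 22 3 1) (Lft (Lft (Bad 0 3 1) (Lft (Lft (Bad 0 9 3) (Ret 0 15 3) Out) (Lft (Lft (Lft (Bad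
    0 3 1) (Rgt (Rgt (Rgt (Bad 31 3 1) (Rgt (Rgt (Bad 27 9 3) (Ret 14 22 3) Out) (Bad 15 20 7) Out) Out)
    (Rgt (Rgt (Rgt (Bad 33 3 1) (Lft (Lft (Lft (Bad 0 3 1) (Lft (Lft (Bad 0 9 3) (Ret 0 22 3) Out) (Bad 0 20
    7) Out) Out) (Lft (Lft (Lft (Bad 0 3 1) (Rgt (Rgt (Ret 26 17 5) (Rgt (Rgt (Rgt (Bad 43 3 1) (Bad 32 14
    5) Out) (Bad 39 6 2) Out) (Ret 31 13 2) Out) Out) (Rgt (Rgt (Bad 0 44 16) (Ret 35 9 3) Out) (Bad 40 3 1)
    Out) Out) Out) (Bad 0 6 2) Out) (Ret 0 8 2) Out) Out) (Lft (Lft (Bad 0 11 4) (Ret 0 20 3) Out) (Bad 0 3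
    1) Out) Out) Out) (Bad 29 6 2) Out) (Ret 26 8 2) Out) Out) (Rgt (Rgt (Bad 23 11 4) (Ret 14 20 3) Out)
    (Bad 30 3 1) Out) Out) Out) (Ret 0 16 3) Out) (Bad 0 3 1) Out) Out) Out) (Lft (Lft (Lft (Bad 0 3 1) (Rgt
    (Lft (Lft (Ret 0 26 5) (Lft (Lft (Lft (Bad 0 3 1) (Bad 0 14 5) Out) (Bad 0 6 2) Out) (Ret 0 13 2) Out)
    Out) (Lft (Bad 0 25 9) (Bad 0 3 1) Out) Out) (Rgt (Rgt (Bad 21 11 4) (Ret 12 20 3) Out) (Bad 28 3 1)
    Out) Out) Out) (Bad 0 6 2) Out) (Ret 0 8 2) Out) Out) Out) (Ret 8 16 3) Out) (Bad 20 3 1) Out) Out) (Lft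
    (Lft (Bad 0 11 4) (Ret 0 13 3) Out) (Bad 0 3 1) Out) Out) Out) (Rgt (Rgt (Rgt (Bad 19 3 1) (Lft (Lft
    (Lft (Bad 0 3 1) (Rgt (Lft (Ret 0 27 6) (Rgt (Ret 2 26 5) (Lft (Rgt (Lft (Rgt (Rgt (Bad 30 3 1) (Bad 19
    14 5) Out) (Bad 26 6 2) Out) (Ret 0 16 3) Out) (Ret 17 13 2) Out) (Bad 0 3 1) Out) Out) Out) (Rgt (Bad 2
    25 9) (Bad 24 3 1) Out) Out) Out) (Lft (Bad 0 25 9) (Ret 0 8 2) Out) Out) (Lft (Lft (Bad 0 11 4) (Ret 0
    13 3) Out) (Bad 0 3 1) Out) Out) Out) (Bad 15 6 2) Out) (Ret 12 8 2) Out) Out) (Rgt (Rgt (Bad 9 11 4)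
    (Ret 7 13 3) Out) (Bad 16 3 1) Out) Out) Out) (Ret 7 9 3) Out) (Bad 12 3 1) Out) Out) Out) (Ret 0 9 3)
    Out) Out) (Bad 4 6 2) Out"])
    (simp add: binary_bad_def Let_def)

lemma refuted_010121: "\<exists>\<tau>. refutes binary_bad \<tau> (subst f_block [N0, N1, N0, N1, N2, N1] @ [N0])"
  by (rule exI[of _ "Lft (Bad 0 3 1) (Lft (Bad 0 9 3) (Ret 0 11 2) Out) Out"])
    (simp add: binary_bad_def Let_def)

lemma refuted_20121: "\<exists>\<tau>. refutes binary_bad \<tau> (subst f_block [N2, N0, N1, N2, N1] @ [N0])"
  by (rule exI[of _ "Ret 1 8 2"])
    (simp add: binary_bad_def Let_def)

section \<open>The first two desubstitutions\<close>

text \<open>Together with their reversals these words leave only blocks of \<open>h\<close> and of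
  \<open>g\<close> as palindromic returns to \<open>N0\<close>, and they keep the two kinds
  apart.\<close>

definition refuted_words :: "letter list list" where
  "refuted_words = [[N0,N0], [N1,N1,N1], [N2,N2,N2], [N1,N1,N2], [N1,N2,N1,N2,N1,N2], [N0,N2,N1,N2,N1,N2],
     [N2,N2,N1], [N0,N2,N1,N2,N0], [N0,N1,N0,N1,N1,N0], [N2,N0,N1,N1], [N0,N1,N0,N1,N2,N1], [N2,N0,N1,N2,N1]]"

lemma refuted_word:
  assumes "u \<in> set refuted_words"
  shows "\<exists>\<tau>. refutes binary_bad \<tau> (subst f_block u @ [N0])"
  using assms refuted_00 refuted_111 refuted_222 refuted_112 refuted_121212 refuted_021212 refuted_221
    refuted_02120 refuted_010110 refuted_2011 refuted_010121 refuted_20121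
  by (auto simp only: refuted_words_def list.set insert_iff empty_iff)

text \<open>The rational exponent 11 / 4 replaces the irrational bound, so that the search needs
  natural numbers only: the excess stays below 7 / 4 of the period.\<close>

definition binary_language :: "letter list set \<Rightarrow> bool" where
  "binary_language L \<longleftrightarrow> rich_language L \<and> [N2] \<notin> L \<and>
     (\<forall>x z t. x @ z \<in> L \<longrightarrow> x @ z = z @ t \<longrightarrow> x \<noteq> [] \<longrightarrow> 4 * length z < 7 * length x)"

lemma rev_image_iff: "u \<in> rev ` L \<longleftrightarrow> rev u \<in> L"
  by (metis image_iff rev_rev_ident)

lemma binary_bad_notin:
  assumes "binary_language L" "binary_bad q r"
  shows "r \<notin> L"
proof (cases "q = 0")
  case True then show ?thesis using assms by (auto simp: binary_language_def binary_bad_def)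
next
  case False
  then have q: "q < length r" "drop q r = take (length r - q) r" "7 * q \<le> 4 * (length r - q)"
    using assms by (auto simp: binary_bad_def)
  show ?thesis
  proof
    assume r: "r \<in> L"
    have "4 * length (drop q r) < 7 * length (take q r)"
    proof -
      have "take q r @ drop q r = drop q r @ drop (length r - q) r" using q by (metis append_take_drop_id)
      moreover have "take q r \<noteq> []" using q False by auto
      ultimately show ?thesis using assms(1) r unfolding binary_language_def by (metis append_take_drop_id)
    qed
    then show False using q by simp
  qed
qed

lemma rich_language_rev:
  assumes "rich_language L" shows "rich_language (rev ` L)"
  unfolding rich_language_def
proof (intro conjI)
  have L: "factorial_lang L" "extendable L" "palindromic_returns L" using assms by (auto simp: rich_language_def)
  show "factorial_lang (rev ` L)"
  proof (rule factorialI)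
    fix s u t assume "s @ u @ t \<in> rev ` L"
    then have "rev t @ rev u @ rev s \<in> L" by (simp add: rev_image_iff)
    from factorialD[OF L(1) this] show "u \<in> rev ` L" by (simp add: rev_image_iff)
  qed
  show "extendable (rev ` L)"
    unfolding extendable_def
  proof (intro ballI impI)
    fix u assume "u \<in> rev ` L" "u \<noteq> []"
    then obtain a b where "a # rev u @ [b] \<in> L" using L(2) unfolding extendable_def rev_image_iff by (metis rev_is_Nil_conv)
    then have "b # u @ [a] \<in> rev ` L" by (simp add: rev_image_iff)
    then show "\<exists>a b. a # u @ [b] \<in> rev ` L" by blast
  qed
  show "palindromic_returns (rev ` L)"
    unfolding palindromic_returns_def
  proof (intro ballI allI impI)
    fix r p assume h: "r \<in> rev ` L" "palindrome p" "p \<noteq> []" "prefix p r" "suffix p r"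
      "\<forall>s t. r = s @ p @ t \<longrightarrow> s = [] \<or> t = []"
    have "palindrome (rev r)"
    proof (rule palindromic_returnsD[OF L(3) _ h(2,3)])
      show "rev r \<in> L" using h by (simp add: rev_image_iff)
      have p: "rev p = p" using h by (simp add: palindrome_def)
      show "prefix p (rev r)" using h(5) p by (metis suffix_to_prefix)
      show "suffix p (rev r)" using h(4) p by (metis suffix_to_prefix rev_rev_ident)
      fix s t assume "rev r = s @ p @ t"
      then have "r = rev t @ p @ rev s" using p by (metis append.assoc rev_append rev_rev_ident)
      then show "s = [] \<or> t = []" using h(6) by auto
    qed
    then show "palindrome r" by (auto simp: palindrome_def)
  qed
qed

lemma binary_language_rev:
  assumes "binary_language L" shows "binary_language (rev ` L)"
proof -
  have "4 * length z < 7 * length x" if "x @ z \<in> rev ` L" and xz: "x @ z = z @ t" and x: "x \<noteq> []" for x z t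
  proof -
    have l: "length x = length t" using xz by (metis add_left_cancel length_append add.commute)
    have "rev t @ rev z \<in> L" using that unfolding rev_image_iff xz by simp
    moreover have "rev t @ rev z = rev z @ rev x" using xz by (metis rev_append)
    moreover have "rev t \<noteq> []" using l x by auto
    ultimately have "4 * length (rev z) < 7 * length (rev t)" using assms unfolding binary_language_def by blast
    then show ?thesis using l by simp
  qed
  moreover have "[N2] \<notin> rev ` L" using assms by (simp add: binary_language_def rev_image_iff)
  ultimately show ?thesis using assms rich_language_rev unfolding binary_language_def by blast
qed

text \<open>A reversed entry is refuted in the reversed language, which has the same properties;
  thus one certificate serves a word and its mirror image.\<close>

lemma refuted_words_notin:
  assumes "binary_language L" "u \<in> set refuted_words \<or> rev u \<in> set refuted_words"
  shows "u \<notin> desubst f_block L"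
proof -
  have *: "u \<notin> desubst f_block L" if b: "binary_language L" and u: "u \<in> set refuted_words" for L u
  proof -
    obtain \<tau> where "refutes binary_bad \<tau> (subst f_block u @ [N0])" using refuted_word[OF u] by blast
    then have "subst f_block u @ [N0] \<notin> L"
      using refutes_sound[of L binary_bad] b binary_bad_notin unfolding binary_language_def by blast
    then show ?thesis by (simp add: desubst_def)
  qed
  show ?thesis using assms(2)
  proof
    assume "rev u \<in> set refuted_words"
    then have "rev u \<notin> desubst f_block (rev ` L)" using * binary_language_rev[OF assms(1)] by blast
    then show ?thesis using f.rev_subst[of "rev u"] by (simp add: desubst_def rev_image_iff)
  qed (use * assms in auto)
qed

fun words :: "nat \<Rightarrow> letter list list" where
  "words 0 = [[]]"
| "words (Suc n) = map ((#) N1) (words n) @ map ((#) N2) (words n)"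

lemma words_iff: "q \<in> set (words n) \<longleftrightarrow> length q = n \<and> N0 \<notin> set q"
proof (induction n arbitrary: q)
  case (Suc n)
  show ?case
  proof (cases q)
    case (Cons a q')
    then show ?thesis using Suc[of q'] by (cases a) auto
  qed auto
qed auto

definition forbidden :: "letter list \<Rightarrow> bool" where
  "forbidden u \<longleftrightarrow> (\<exists>v \<in> set refuted_words. sublist v u \<or> sublist (rev v) u)"

lemma forbidden_notin:
  assumes "binary_language L" "forbidden u"
  shows "u \<notin> desubst f_block L"
proof
  assume u: "u \<in> desubst f_block L"
  have "factorial_lang (desubst f_block L)"
    using assms f.factorial_desubst unfolding binary_language_def rich_language_def by blast
  then show False using u assms(2) refuted_words_notin[OF assms(1)]
    unfolding forbidden_def factorial_lang_def by (metis rev_rev_ident)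
qed

lemma sublist_simps:
  "sublist (x # xs) [] = False" "sublist xs (y # ys) = (prefix xs (y # ys) \<or> sublist xs ys)"
  by (auto simp: sublist_Cons_right)

text \<open>This bounds the distance between markers below \<open>f\<close>.\<close>

lemma forbidden_long: "\<forall>q \<in> set (words 6). forbidden q"
  by (simp add: eval_nat_numeral forbidden_def refuted_words_def sublist_simps)

text \<open>Only palindromes have to be examined, since a return to the marker in a rich language is
  a palindrome.\<close>

lemma forbidden_return:
  assumes "n < 6" "q \<in> set (words n)" "rev q = q" "q \<notin> range h_block" "q \<notin> range g_block"
  shows "forbidden (N0 # q @ [N0])"
proof -
  have "\<forall>n\<in>{0,1,2,3,4,5}. \<forall>q \<in> set (words n). rev q \<noteq> q \<or> q \<in> range h_block \<or> q \<in> range g_block \<or> forbidden (N0 # q @ [N0])"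
    by (simp add: eval_nat_numeral forbidden_def refuted_words_def sublist_simps UNIV_letter)
  moreover have "n \<in> {0,1,2,3,4,5}" using assms(1) by auto
  ultimately show ?thesis using assms by blast
qed

text \<open>This supplies the condition of \<open>extendable_desubst\<close> on neighbouring blocks,
  for either code.\<close>

lemma forbidden_mixed:
  "forbidden (N0 # h_block a @ N0 # g_block b @ [N0])"
  "forbidden (N0 # g_block b @ N0 # h_block a @ [N0])"
  by (cases a; cases b; simp add: forbidden_def refuted_words_def sublist_simps)+

section \<open>The renormalization step\<close>

lemma (in block_code) rich_language_desubst:
  assumes "rich_language L"
    and "\<And>q. q \<in> L \<Longrightarrow> N0 \<notin> set q \<Longrightarrow> length q < n"
    and "\<And>a q. N0 \<notin> set q \<Longrightarrow> N0 # p a @ N0 # q @ [N0] \<in> L \<Longrightarrow> q \<in> range p"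
    and "\<And>a q. N0 \<notin> set q \<Longrightarrow> N0 # q @ N0 # p a @ [N0] \<in> L \<Longrightarrow> q \<in> range p"
  shows "rich_language (desubst p L)"
  using assms factorial_desubst extendable_desubst[where n = n] returns_desubst
  unfolding rich_language_def by blast

text \<open>Two consecutive stretches of length \<open>n\<close> each contain a marker; the last one
  of the first stretch and the first one of the second enclose a return.\<close>

lemma marker_return_exists:
  assumes L: "rich_language L" and z: "z \<in> L" "z \<noteq> []"
    and gap: "\<And>q. q \<in> L \<Longrightarrow> N0 \<notin> set q \<Longrightarrow> length q < n"
  shows "\<exists>q. N0 \<notin> set q \<and> N0 # q @ [N0] \<in> L"
proof -
  have fe: "factorial_lang L" "extendable L" using L by (auto simp: rich_language_def)
  from extend_right[OF fe z] obtain t where t: "length t = n + n" "z @ t \<in> L" by blast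
  then have "t \<in> L" using factorialD1[OF fe(1)] by blast
  define t1 t2 where "t1 = take n t" and "t2 = drop n t"
  have tt: "t = t1 @ t2" "length t1 = n" "length t2 = n" using t by (auto simp: t1_def t2_def)
  then have "t1 \<in> L" "t2 \<in> L"
    using factorialD1[OF fe(1), of t1 t2] factorialD2[OF fe(1), of t1 t2] \<open>t \<in> L\<close> by auto
  then have "N0 \<in> set t1" "N0 \<in> set t2" using gap tt by fastforce+
  obtain a b where ab: "t1 = a @ N0 # b" "N0 \<notin> set b" using \<open>N0 \<in> set t1\<close> by (meson split_list_last)
  obtain c d where cd: "t2 = c @ N0 # d" "N0 \<notin> set c" using \<open>N0 \<in> set t2\<close> by (meson split_list_first)
  have "a @ (N0 # (b @ c) @ [N0]) @ d \<in> L" using \<open>t \<in> L\<close> tt ab cd by simp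
  then have "N0 # (b @ c) @ [N0] \<in> L" using factorialD[OF fe(1)] by blast
  then show ?thesis using ab cd by (intro exI[of _ "b @ c"]) auto
qed

lemma marker_return_palindrome:
  assumes "rich_language L" "N0 # q @ [N0] \<in> L" "N0 \<notin> set q"
  shows "rev q = q"
proof -
  have "palindrome (N0 # q @ [N0])"
  proof (rule palindromic_returnsD[of L _ "[N0]"])
    fix s t assume h: "N0 # q @ [N0] = s @ [N0] @ t"
    show "s = [] \<or> t = []"
    proof (rule ccontr)
      assume c: "\<not> (s = [] \<or> t = [])"
      then obtain s' t' where "s = N0 # s'" "t = t' @ [N0]" using h
        by (metis append_Cons append_butlast_last_id last.simps last_appendR list.distinct(1) neq_Nil_conv list.inject)
      then have "q = s' @ N0 # t'" using h by simp
      then show False using assms(3) by auto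
    qed
  qed (use assms in \<open>auto simp: rich_language_def palindrome_def Sublist.suffix_def\<close>)
  then show ?thesis by (simp add: palindrome_def)
qed

text \<open>The cone \<open>7 / 3 \<le> C / A \<le> 13 / 5\<close> contains the two starting pairs \<open>(3, 7)\<close> and \<open>(5, 13)\<close> and is
  mapped into itself by \<open>(A, C) \<mapsto> (C, A + 2 * C)\<close>, so that one refutation serves all levels.\<close>

definition level_language :: "real \<Rightarrow> letter list set \<Rightarrow> real \<Rightarrow> real \<Rightarrow> real \<Rightarrow> bool" where
  "level_language \<beta> L A C \<delta> \<longleftrightarrow> rich_language L \<and> (\<exists>a. [a] \<in> L) \<and> level_powers \<beta> L A C \<delta> \<and>
     (\<delta> = 1 \<or> \<delta> = -1) \<and> A \<ge> 4 - \<delta> \<and> 7 * A \<le> 3 * C \<and> 5 * C \<le> 13 * A"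

context
  fixes \<beta> L A C \<delta>
  assumes lvl: "level_language \<beta> L A C \<delta>" and beta: "\<beta> \<le> 17072 / 10000"
begin

text \<open>The bound \<open>4 - \<delta>\<close> is the value of \<open>A\<close> at the two
  starts: 3 for \<open>\<delta> = 1\<close> and 5 for \<open>\<delta> = -1\<close>.\<close>

lemma level_facts:
  "factorial_lang L" "extendable L" "palindromic_returns L" "rich_language L"
  "\<delta> = 1 \<or> \<delta> = -1" "A \<ge> 4 - \<delta>" "7 * A \<le> 3 * C" "5 * C \<le> 13 * A"
  using lvl unfolding level_language_def rich_language_def by auto

lemma wt_pos: "wt A C a > 0"
  using level_facts(5-8) by (cases a) auto

lemma gain_nonneg: "gain A C \<delta> a b \<ge> 0"
  using level_facts(5-8) by (cases a; cases b) auto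

lemma gain_ge:
  assumes "a \<noteq> b" shows "(A - \<delta>) / 2 \<le> gain A C \<delta> a b"
  using assms level_facts(5-8) by (cases a; cases b) auto

lemma excess_nonneg: "excess A C \<delta> \<ge> 0"
  using level_facts(5-8) unfolding excess_def by argo

text \<open>\<open>17072 / 10000\<close> lies just above \<open>1 + sqrt 2 / 2\<close>. With a
  rational constant the exclusions below become linear inequalities in \<open>A\<close>,
  \<open>C\<close> and \<open>\<delta>\<close>.\<close>

lemma level_bound:
  assumes "w \<in> L" "w = a # x @ z @ [b]" "x @ z = z @ t" "x \<noteq> []"
  shows "weight (wt A C) z + excess A C \<delta> + gain A C \<delta> a (last x) + gain A C \<delta> b (hd t)
    < 17072 / 10000 * weight (wt A C) x"
proof -
  have "weight (wt A C) x \<ge> 0" by (induction x) (auto intro: add_nonneg_nonneg less_imp_le wt_pos)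
  then have "\<beta> * weight (wt A C) x \<le> 17072 / 10000 * weight (wt A C) x" using beta by (rule mult_right_mono[rotated])
  moreover have "level_powers \<beta> L A C \<delta>" using lvl level_language_def by blast
  ultimately show ?thesis using bounded_powersD[of \<beta> L "wt A C"] assms by fastforce
qed

lemma level_ext: "u \<in> L \<Longrightarrow> u \<noteq> [] \<Longrightarrow> \<exists>a b. a # u @ [b] \<in> L"
  using level_facts(2) unfolding extendable_def by blast

lemma level_no_cube: "[a, a, a] \<notin> L"
proof
  assume "[a, a, a] \<in> L"
  then obtain c d where "c # [a, a, a] @ [d] \<in> L" using level_ext by blast
  from level_bound[OF this, of c "[a]" "[a, a]" d "[a]"]
  have "2 * wt A C a + excess A C \<delta> + gain A C \<delta> c a + gain A C \<delta> d a < 17072 / 10000 * wt A C a" by simp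
  then show False using wt_pos[of a] gain_nonneg[of c a] gain_nonneg[of d a] excess_nonneg by simp
qed

text \<open>Without cubes both neighbours differ from \<open>a\<close>, so both ends gain. The
  estimate does not exclude the square of \<open>N2\<close>, which occurs in a block of
  \<open>h\<close>.\<close>

lemma level_no_square:
  assumes "a = N0 \<or> a = N1"
  shows "[a, a] \<notin> L"
proof
  assume "[a, a] \<in> L"
  then obtain c d where cd: "c # [a, a] @ [d] \<in> L" using level_ext by blast
  have "c \<noteq> a" using level_no_cube[of a] factorialD2[OF level_facts(1), of "[a, a, a]" "[d]"] cd by auto
  moreover have "d \<noteq> a" using level_no_cube[of a] factorialD1[OF level_facts(1), of "[c]" "[a, a, a]"] cd by auto
  moreover from level_bound[OF cd, of c "[a]" "[a]" d "[a]"]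
  have "wt A C a + excess A C \<delta> + gain A C \<delta> c a + gain A C \<delta> d a < 17072 / 10000 * wt A C a" by simp
  moreover have "wt A C a = A \<or> wt A C a = C - A" using assms by auto
  ultimately show False using gain_ge[of c a] gain_ge[of d a] level_facts(5-8) unfolding excess_def by argo
qed

text \<open>The neighbour \<open>N1\<close> of the square is compared with \<open>N2\<close>, and
  this pair has the larger gain \<open>(C - \<delta>) / 2\<close>.\<close>

lemma level_no_221: "[N2, N2, N1] \<notin> L"
proof
  assume "[N2, N2, N1] \<in> L"
  then obtain c d where "c # [N2, N2, N1] @ [d] \<in> L" using level_ext by blast
  then have c: "[c, N2, N2, N1] \<in> L" using factorialD2[OF level_facts(1), of "[c, N2, N2, N1]" "[d]"] by simp
  then have "c \<noteq> N2" using level_no_cube[of N2] factorialD2[OF level_facts(1), of "[N2, N2, N2]" "[N1]"] by auto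
  moreover from level_bound[OF c, of c "[N2]" "[N2]" N1 "[N2]"]
  have "C + excess A C \<delta> + gain A C \<delta> c N2 + gain A C \<delta> N1 N2 < 17072 / 10000 * C" by simp
  ultimately show False using gain_ge[of c N2] level_facts(5-8) unfolding excess_def gain.simps by argo
qed

lemma level_no_122: "[N1, N2, N2] \<notin> L"
proof
  assume "[N1, N2, N2] \<in> L"
  then obtain c d where "c # [N1, N2, N2] @ [d] \<in> L" using level_ext by blast
  then have d: "[N1, N2, N2, d] \<in> L" using factorialD1[OF level_facts(1), of "[c]"] by simp
  then have "d \<noteq> N2" using level_no_cube[of N2] factorialD1[OF level_facts(1), of "[N1]" "[N2, N2, N2]"] by auto
  moreover from level_bound[OF d, of N1 "[N2]" "[N2]" d "[N2]"]
  have "C + excess A C \<delta> + gain A C \<delta> N1 N2 + gain A C \<delta> d N2 < 17072 / 10000 * C" by simp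
  ultimately show False using gain_ge[of d N2] level_facts(5-8) unfolding excess_def gain.simps by argo
qed

text \<open>The period is the single letter \<open>N1\<close> with empty excess; both ends have the
  larger gain.\<close>

lemma level_no_212: "[N2, N1, N2] \<notin> L"
proof
  assume "[N2, N1, N2] \<in> L"
  then have "weight (wt A C) [] + excess A C \<delta> + gain A C \<delta> N2 (last [N1]) + gain A C \<delta> N2 (hd [N1])
      < 17072 / 10000 * weight (wt A C) [N1]"
    by (rule level_bound) simp_all
  then have "excess A C \<delta> + (C - \<delta>) / 2 + (C - \<delta>) / 2 < 17072 / 10000 * (C - A)" by simp
  then show False using level_facts(5-8) unfolding excess_def by argo
qed

text \<open>The gain of \<open>N2\<close> against \<open>N0\<close> at the left end already
  suffices, so the letter \<open>b\<close> is free.\<close>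

lemma level_no_period2: "[N2, N1, N0, N1, N0, N1, b] \<notin> L"
proof
  assume "[N2, N1, N0, N1, N0, N1, b] \<in> L"
  then have "weight (wt A C) [N1, N0, N1] + excess A C \<delta> + gain A C \<delta> N2 (last [N1, N0]) + gain A C \<delta> b (hd [N0, N1])
      < 17072 / 10000 * weight (wt A C) [N1, N0]"
    by (rule level_bound) simp_all
  then have "2 * C - A + excess A C \<delta> + (A - \<delta>) / 2 + gain A C \<delta> b N0 < 17072 / 10000 * C" by simp
  then show False using level_facts(5-8) gain_nonneg[of b N0] unfolding excess_def by argo
qed

lemma level_no_period4:
  "[N0, N1, N0, N1, N2, N1, N0, N1, N2, N1, N0, N1, N0] \<notin> L"
  "[N2, N1, N0, N1, N2, N1, N0, N1, N2, N1, N0, N1, N0] \<notin> L"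
  "[N1, N0, N1, N2, N1, N0, N1, N2, N1, N0, N1, N2, N1] \<notin> L"
proof -
  show "[N0, N1, N0, N1, N2, N1, N0, N1, N2, N1, N0, N1, N0] \<notin> L"
  proof
    assume "[N0, N1, N0, N1, N2, N1, N0, N1, N2, N1, N0, N1, N0] \<in> L"
    then have "weight (wt A C) [N1, N0, N1, N2, N1, N0, N1] + excess A C \<delta> + gain A C \<delta> N0 (last [N1, N0, N1, N2]) + gain A C \<delta> N0 (hd [N2, N1, N0, N1])
      < 17072 / 10000 * weight (wt A C) [N1, N0, N1, N2]"
    by (rule level_bound) simp_all
  then have "5 * C - 2 * A + excess A C \<delta> + (A - \<delta>) / 2 + (A - \<delta>) / 2 < 17072 / 10000 * (3 * C - A)" by simp
    then show False using level_facts(5-8) unfolding excess_def by argo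
  qed
  show "[N2, N1, N0, N1, N2, N1, N0, N1, N2, N1, N0, N1, N0] \<notin> L"
  proof
    assume "[N2, N1, N0, N1, N2, N1, N0, N1, N2, N1, N0, N1, N0] \<in> L"
    then have "weight (wt A C) [N1, N0, N1, N2, N1, N0, N1] + excess A C \<delta> + gain A C \<delta> N2 (last [N1, N0, N1, N2]) + gain A C \<delta> N0 (hd [N2, N1, N0, N1])
      < 17072 / 10000 * weight (wt A C) [N1, N0, N1, N2]"
    by (rule level_bound) simp_all
  then have "5 * C - 2 * A + excess A C \<delta> + (A - \<delta>) / 2 < 17072 / 10000 * (3 * C - A)" by simp
    then show False using level_facts(5-8) unfolding excess_def by argo
  qed
  show "[N1, N0, N1, N2, N1, N0, N1, N2, N1, N0, N1, N2, N1] \<notin> L"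
  proof
    assume "[N1, N0, N1, N2, N1, N0, N1, N2, N1, N0, N1, N2, N1] \<in> L"
    then have "weight (wt A C) [N0, N1, N2, N1, N0, N1, N2] + excess A C \<delta> + gain A C \<delta> N1 (last [N0, N1, N2, N1]) + gain A C \<delta> N1 (hd [N1, N0, N1, N2])
      < 17072 / 10000 * weight (wt A C) [N0, N1, N2, N1]"
    by (rule level_bound) simp_all
  then have "5 * C - A + excess A C \<delta> < 17072 / 10000 * (3 * C - A)" by simp
    then show False using level_facts(5-8) unfolding excess_def by argo
  qed
qed

definition level_bad :: "letter list list" where
  "level_bad = [[N0, N0], [N1, N1], [N2, N2, N2], [N2, N2, N1], [N1, N2, N2], [N2, N1, N2],
    [N2, N1, N0, N1, N0, N1, N0], [N2, N1, N0, N1, N0, N1, N2],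
    [N0, N1, N0, N1, N2, N1, N0, N1, N2, N1, N0, N1, N0],
    [N2, N1, N0, N1, N2, N1, N0, N1, N2, N1, N0, N1, N0],
    [N1, N0, N1, N2, N1, N0, N1, N2, N1, N0, N1, N2, N1]]"

lemma level_bad_notin: "r \<in> set level_bad \<Longrightarrow> r \<notin> L"
  unfolding level_bad_def
  using level_no_square level_no_cube level_no_221 level_no_122 level_no_212 level_no_period2 level_no_period4
  by auto

text \<open>The leaves use only patterns excluded for every admissible pair \<open>(A, C)\<close>
  and non-palindromic returns, so this one tree works at every level.\<close>

lemma level_no_12: "[N1, N2] \<notin> L"
proof (rule refutes_sound[of L "\<lambda>_ r. r \<in> set level_bad"])
  show "refutes (\<lambda>_ r. r \<in> set level_bad)
    (Lft (Rgt (Ret 0 4 1) (Rgt (Rgt (Bad 4 2 0) (Rgt (Rgt (Bad 6 2 0) (Rgt (Bad 2 7 0) (Bad 7 2 0) (Bad 2 7 0))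
      (Ret 2 6 1)) (Bad 5 2 0) (Rgt (Ret 4 4 1) (Rgt (Rgt (Bad 8 2 0) (Lft (Bad 0 2 0) (Rgt (Lft (Bad 0 13 0)
      (Bad 0 2 0) (Bad 0 13 0)) (Bad 10 2 0) (Rgt (Ret 9 4 1) (Bad 0 13 0) (Bad 10 3 0))) (Ret 0 4 1))
      (Ret 6 4 1)) (Bad 7 2 0) (Bad 6 3 0)) (Bad 5 3 0))) (Ret 2 4 1)) (Bad 3 2 0) (Bad 2 3 0)) (Bad 1 3 0))
      (Bad 0 2 0) (Bad 0 3 0)) [N1, N2]"
    by (simp add: level_bad_def Let_def)
qed (use level_facts level_bad_notin in auto)

text \<open>The letters around 21 are forced to be \<open>N0\<close>, and then a return to the
  marker fails to be a palindrome.\<close>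

lemma level_no_21: "[N2, N1] \<notin> L"
proof
  assume "[N2, N1] \<in> L"
  then obtain c d where "c # [N2, N1] @ [d] \<in> L" using level_ext by blast
  then have m: "[c, N2, N1, d] \<in> L" by simp
  have l: "u \<notin> L \<Longrightarrow> [c, N2, N1, d] \<noteq> s @ u @ t" for s u t
    using m factorialD[OF level_facts(1)] by metis
  have "c = N0" using l[OF level_no_12, of "[]" "[]"] l[OF level_no_221, of "[]" "[d]"] l[OF level_no_12, of "[]" "[N1, d]"]
    by (cases c) auto
  moreover have "d = N0"
    using l[OF level_no_12, of "[c, N2]" "[]"] l[OF level_no_square[of N1], of "[c, N2]" "[]"] by (cases d) auto
  ultimately have "N0 # [N2, N1] @ [N0] \<in> L" using m by simp
  from marker_return_palindrome[OF level_facts(4) this] show False by simp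
qed

lemma level_gap: "q \<in> L \<Longrightarrow> N0 \<notin> set q \<Longrightarrow> length q < 3"
proof (rule ccontr)
  assume q: "q \<in> L" "N0 \<notin> set q" "\<not> length q < 3"
  then obtain a b c r where r: "q = a # b # c # r"
    by (metis One_nat_def Suc_1 length_Cons less_Suc_eq list.exhaust list.size(3) numeral_3_eq_3 zero_less_Suc)
  have l: "u \<notin> L \<Longrightarrow> q \<noteq> s @ u @ t" for s u t
    using q(1) factorialD[OF level_facts(1)] by metis
  show False
    using q(2) l[OF level_no_cube[of N2], of "[]" r] l[OF level_no_12, of "[]" "c # r"] l[OF level_no_12, of "[a]" r]
      l[OF level_no_21, of "[]" "c # r"] l[OF level_no_21, of "[a]" r] l[OF level_no_square[of N1], of "[]" "c # r"]
    unfolding r by (cases a; cases b; cases c) auto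
qed

text \<open>Between markers only 1, 2 and 22 survive, and these are the blocks of
  \<open>h\<close>.\<close>

lemma level_return:
  assumes "N0 # q @ [N0] \<in> L" "N0 \<notin> set q"
  shows "q \<in> range h_block"
proof -
  have l: "u \<notin> L \<Longrightarrow> N0 # q @ [N0] \<noteq> s @ u @ t" for s u t
    using assms(1) factorialD[OF level_facts(1)] by metis
  have "q \<in> L" using assms(1) factorialD[OF level_facts(1), of "[N0]" q "[N0]"] by simp
  then have "length q < 3" using level_gap assms by blast
  then consider "q = []" | a where "q = [a]" | a b where "q = [a, b]"
    by (cases q rule: remdups_adj.cases) (auto simp: less_Suc_eq)
  then show ?thesis
  proof cases
    case 1 then show ?thesis using l[OF level_no_square[of N0], of "[]" "[]"] by simp
  next
    case 2 then show ?thesis using assms(2) by (cases a) (auto simp: UNIV_letter)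
  next
    case 3 then show ?thesis
      using assms(2) l[OF level_no_12, of "[N0]" "[N0]"] l[OF level_no_21, of "[N0]" "[N0]"] l[OF level_no_square[of N1], of "[N0]" "[N0]"]
      by (cases a; cases b) (auto simp: UNIV_letter)
  qed
qed

lemma level_step: "level_language \<beta> (desubst h_block L) C (A + 2 * C) \<delta>"
  unfolding level_language_def
proof (intro conjI)
  show "rich_language (desubst h_block L)"
  proof (rule h.rich_language_desubst[OF level_facts(4) level_gap])
    fix a q assume q: "N0 \<notin> set q"
    { assume "N0 # h_block a @ N0 # q @ [N0] \<in> L"
      then have "N0 # q @ [N0] \<in> L" using factorialD1[OF level_facts(1), of "N0 # h_block a"] by simp
      then show "q \<in> range h_block" using level_return q by blast }
    { assume "N0 # q @ N0 # h_block a @ [N0] \<in> L"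
      then have "N0 # q @ [N0] \<in> L" using factorialD2[OF level_facts(1), of _ "h_block a @ [N0]"] by simp
      then show "q \<in> range h_block" using level_return q by blast }
  qed
  obtain a where "[a] \<in> L" using lvl level_language_def by blast
  then obtain q where q: "N0 \<notin> set q" "N0 # q @ [N0] \<in> L"
    using marker_return_exists[OF level_facts(4) _ _ level_gap] by blast
  then obtain c where "q = h_block c" using level_return by blast
  then have "[c] \<in> desubst h_block L" using q by (simp add: desubst_def)
  then show "\<exists>a. [a] \<in> desubst h_block L" by blast
  show "level_powers \<beta> (desubst h_block L) C (A + 2 * C) \<delta>"
    using lvl level_powers_h level_facts(1) unfolding level_language_def by blast
\<comment> \<open>For the new pair the cone conditions say \<open>C \<le> 3 * A\<close> and
  \<open>5 * A \<le> 3 * C\<close>.\<close>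
qed (use level_facts in auto)

text \<open>The letter \<open>N0\<close> alone is a period with empty excess, and its neighbours
  differ from it; in the sum the two gains cancel \<open>\<delta>\<close>.\<close>

lemma level_letter: "(C + A) / 2 - 1 < \<beta> * A"
proof -
  obtain a where "[a] \<in> L" using lvl level_language_def by blast
  then obtain q where q: "N0 # q @ [N0] \<in> L"
    using marker_return_exists[OF level_facts(4) _ _ level_gap] by blast
  have "[N0] \<in> L" using factorialD2[OF level_facts(1), of "[N0]" "q @ [N0]"] q by simp
  then obtain c d where cd: "c # [N0] @ [d] \<in> L" using level_ext by blast
  have "c \<noteq> N0" using level_no_square[of N0] factorialD2[OF level_facts(1), of "[N0, N0]" "[d]"] cd by auto
  moreover have "d \<noteq> N0" using level_no_square[of N0] factorialD1[OF level_facts(1), of "[c]" "[N0, N0]"] cd by auto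
  moreover have "weight (wt A C) [] + excess A C \<delta> + gain A C \<delta> c (last [N0]) + gain A C \<delta> d (hd [N0]) < \<beta> * weight (wt A C) [N0]"
    using lvl cd unfolding level_language_def by (intro bounded_powersD[of \<beta> L]) auto
  ultimately show ?thesis by (cases c; cases d) (auto simp: excess_def field_simps)
qed

end

section \<open>The lower bound\<close>

text \<open>Without \<open>N2\<close> and without the cube of \<open>N1\<close>, only
  \<open>[]\<close>, \<open>[N1]\<close> and \<open>[N1, N1]\<close> remain between markers: the
  blocks of \<open>f\<close>.\<close>

lemma desubst_language:
  assumes L: "binary_language L" "[a] \<in> L"
  shows "rich_language (desubst f_block L)" "\<exists>a. [a] \<in> desubst f_block L"
proof -
  have rl: "rich_language L" and fl: "factorial_lang L" and n2: "[N2] \<notin> L"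
    using L by (auto simp: binary_language_def rich_language_def)
  have mem: "b = N1" if "q \<in> L" "N0 \<notin> set q" "b \<in> set q" for q b
  proof -
    obtain s t where "q = s @ [b] @ t" using \<open>b \<in> set q\<close> by (metis append_Cons append_Nil split_list)
    then have "[b] \<in> L" using factorialD[OF fl] that by blast
    then show ?thesis using n2 that by (cases b) auto
  qed
  have rep: "q = replicate (length q) N1" if "q \<in> L" "N0 \<notin> set q" for q
    using mem[OF that] by (metis replicate_eqI)
  have gap: "length q < 3" if q: "q \<in> L" "N0 \<notin> set q" for q
  proof (rule ccontr)
    assume "\<not> length q < 3"
    then obtain m where "length q = 3 + m" using le_Suc_ex[of 3 "length q"] by auto
    then have "q = [N1, N1, N1] @ replicate m N1" using rep[OF q] by (simp add: numeral_3_eq_3)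
    then have "[N1] @ [N1, N1] \<in> L" using factorialD2[OF fl] q(1) by auto
    moreover have "[N1] @ [N1, N1] = [N1, N1] @ [N1]" by simp
    ultimately have "4 * length [N1, N1] < 7 * length [N1]"
      using L unfolding binary_language_def by blast
    then show False by simp
  qed
  have ret: "q \<in> range f_block" if q: "q \<in> L" "N0 \<notin> set q" for q
  proof -
    have "length q = 0 \<or> length q = 1 \<or> length q = 2" using gap[OF q] by linarith
    then have "q = [] \<or> q = [N1] \<or> q = [N1, N1]" using rep[OF q] by (auto simp: numeral_2_eq_2)
    then show ?thesis by (auto simp: UNIV_letter)
  qed
  show "rich_language (desubst f_block L)"
  proof (rule f.rich_language_desubst[OF rl gap])
    fix a q assume q: "N0 \<notin> set q"
    { assume "N0 # f_block a @ N0 # q @ [N0] \<in> L"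
      then show "q \<in> range f_block" using factorialD[OF fl, of "N0 # f_block a @ [N0]" q "[N0]"] ret q by simp }
    { assume "N0 # q @ N0 # f_block a @ [N0] \<in> L"
      then show "q \<in> range f_block" using factorialD[OF fl, of "[N0]" q "N0 # f_block a @ [N0]"] ret q by simp }
  qed
  obtain q where q: "N0 \<notin> set q" "N0 # q @ [N0] \<in> L"
    using marker_return_exists[OF rl L(2) _ gap] by blast
  then obtain c where "q = f_block c" using ret factorialD[OF fl, of "[N0]" q "[N0]"] by auto
  then have "[c] \<in> desubst f_block L" using q by (simp add: desubst_def)
  then show "\<exists>a. [a] \<in> desubst f_block L" by blast
qed

lemma level_language_exists:
  assumes L: "binary_language L" "[a] \<in> L" and pow: "bounded_powers \<beta> L (\<lambda>_. 1) 0 (\<lambda>_ _. 0)"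
  shows "\<exists>L A C \<delta>. level_language \<beta> L A C \<delta>"
proof -
  define K where "K = desubst f_block L"
  have rl: "rich_language K" and "\<exists>a. [a] \<in> K" using desubst_language[OF L] K_def by auto
  then obtain a0 where a0: "[a0] \<in> K" by blast
  have fl: "factorial_lang K" using rl rich_language_def by blast
  have forb: "u \<notin> K" if "forbidden u" for u using forbidden_notin[OF L(1) that] K_def by simp
  have lp: "level_powers \<beta> K 1 3 1"
    unfolding K_def using level_powers_f[OF pow] L by (auto simp: binary_language_def rich_language_def)
  have gap: "length q < 6" if q: "q \<in> K" "N0 \<notin> set q" for q
  proof (rule ccontr)
    assume "\<not> length q < 6"
    then have "take 6 q \<in> set (words 6)" using q(2) by (auto simp: words_iff dest: in_set_takeD)
    moreover have "take 6 q \<in> K" using q(1) factorialD2[OF fl, of "take 6 q" "drop 6 q"] by simp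
    ultimately show False using forbidden_long forb by blast
  qed
  have ret: "q \<in> range h_block \<or> q \<in> range g_block" if q: "N0 # q @ [N0] \<in> K" "N0 \<notin> set q" for q
  proof -
    have "rev q = q" using marker_return_palindrome[OF rl q] .
    moreover have "length q < 6" using gap factorialD[OF fl, of "[N0]" q "[N0]"] q by simp
    ultimately show ?thesis using forbidden_return[of "length q" q] q forb words_iff by blast
  qed
  have right: "N0 # q @ [N0] \<in> K" if "N0 # r @ N0 # q @ [N0] \<in> K" for r q
    using factorialD1[OF fl, of "N0 # r" "N0 # q @ [N0]"] that by simp
  have left: "N0 # q @ [N0] \<in> K" if "N0 # q @ N0 # r @ [N0] \<in> K" for r q
    using factorialD2[OF fl, of "N0 # q @ [N0]" "r @ [N0]"] that by simp
  obtain q where q: "N0 \<notin> set q" "N0 # q @ [N0] \<in> K"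
    using marker_return_exists[OF rl a0 _ gap] by blast
  show ?thesis
  \<comment> \<open>Blocks of both kinds might occur in unrelated words of \<open>K\<close>. The
    return \<open>q\<close> only ensures that the chosen desubstitution contains a letter;
    extendability comes from \<open>forbidden_mixed\<close>.\<close>
  proof (cases "q \<in> range h_block")
    case True
    have "rich_language (desubst h_block K)"
    proof (rule h.rich_language_desubst[OF rl gap])
      fix a q assume q: "N0 \<notin> set q"
      { assume m: "N0 # h_block a @ N0 # q @ [N0] \<in> K"
        then show "q \<in> range h_block" using ret[OF right[OF m] q] forbidden_mixed(1) forb by blast }
      { assume m: "N0 # q @ N0 # h_block a @ [N0] \<in> K"
        then show "q \<in> range h_block" using ret[OF left[OF m] q] forbidden_mixed(2) forb by blast }
    qed
    moreover have "\<exists>c. [c] \<in> desubst h_block K" using True q by (auto simp: desubst_def)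
    moreover have "level_powers \<beta> (desubst h_block K) 3 7 1" using level_powers_h[OF lp fl] by simp
    ultimately have "level_language \<beta> (desubst h_block K) 3 7 1" by (simp add: level_language_def)
    then show ?thesis by blast
  next
    case False
    then have qg: "q \<in> range g_block" using ret q by blast
    have "rich_language (desubst g_block K)"
    proof (rule g.rich_language_desubst[OF rl gap])
      fix a q assume q: "N0 \<notin> set q"
      { assume m: "N0 # g_block a @ N0 # q @ [N0] \<in> K"
        then show "q \<in> range g_block" using ret[OF right[OF m] q] forbidden_mixed(2) forb by blast }
      { assume m: "N0 # q @ N0 # g_block a @ [N0] \<in> K"
        then show "q \<in> range g_block" using ret[OF left[OF m] q] forbidden_mixed(1) forb by blast }
    qed
    moreover have "\<exists>c. [c] \<in> desubst g_block K" using qg q by (auto simp: desubst_def)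
    moreover have "level_powers \<beta> (desubst g_block K) 5 13 (-1)" using level_powers_g[OF lp fl] .
    ultimately have "level_language \<beta> (desubst g_block K) 5 13 (-1)" by (simp add: level_language_def)
    then show ?thesis by blast
  qed
qed

lemma sqrt2_bounds: "sqrt 2 < 14143 / 10000" "14142 / 10000 < sqrt 2"
proof -
  show "sqrt 2 < 14143 / 10000" by (rule real_less_lsqrt) (auto simp: power2_eq_square)
  show "14142 / 10000 < sqrt 2" by (rule real_less_rsqrt) (simp add: power2_eq_square)
qed

text \<open>The quantity \<open>C - (1 + sqrt 2) * A\<close> is multiplied by \<open>1 - sqrt 2\<close> in each step, so \<open>C / A\<close>
  tends to \<open>1 + sqrt 2\<close>, and the bound on the repetition of period \<open>N0\<close> tends to \<open>1 + sqrt 2 / 2\<close>.\<close>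

lemma level_language_impossible:
  assumes lvl: "level_language \<beta> L A C \<delta>" and beta: "\<beta> < 1 + sqrt 2 / 2"
  shows False
proof -
  have b': "\<beta> \<le> 17072 / 10000" using beta sqrt2_bounds by linarith
  define K where "K = \<bar>C - (1 + sqrt 2) * A\<bar>"
  \<comment> \<open>The deviation never exceeds its initial value \<open>K\<close>, while
    \<open>A\<close> increases by at least 1 in each step.\<close>
  have ex: "\<exists>L A C. level_language \<beta> L A C \<delta> \<and> A \<ge> real n \<and> \<bar>C - (1 + sqrt 2) * A\<bar> \<le> K" for n
  proof (induction n)
    case 0
    have "A \<ge> 0" using lvl unfolding level_language_def by auto
    then show ?case using lvl K_def by (intro exI[of _ L] exI[of _ A] exI[of _ C]) auto
  next
    case (Suc n)
    then obtain L A C where h: "level_language \<beta> L A C \<delta>" "A \<ge> real n" "\<bar>C - (1 + sqrt 2) * A\<bar> \<le> K" by blast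
    have "C \<ge> A + 1" using level_facts(5-8)[OF h(1) b'] by argo
    have "sqrt 2 * sqrt 2 = (2::real)" by simp
    then have "A + 2 * C - (1 + sqrt 2) * C = (1 - sqrt 2) * (C - (1 + sqrt 2) * A)"
      by (simp add: algebra_simps)
    then have "\<bar>A + 2 * C - (1 + sqrt 2) * C\<bar> = \<bar>1 - sqrt 2\<bar> * \<bar>C - (1 + sqrt 2) * A\<bar>"
      by (simp add: abs_mult)
    also have "\<dots> \<le> 1 * \<bar>C - (1 + sqrt 2) * A\<bar>"
      using sqrt2_bounds by (intro mult_right_mono) auto
    finally have "\<bar>A + 2 * C - (1 + sqrt 2) * C\<bar> \<le> K" using h(3) by simp
    moreover have "C \<ge> real (Suc n)" using h(2) \<open>C \<ge> A + 1\<close> by simp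
    ultimately show ?case using level_step[OF h(1) b'] by blast
  qed
  define \<epsilon> where "\<epsilon> = 1 + sqrt 2 / 2 - \<beta>"
  have "\<epsilon> > 0" using beta \<epsilon>_def by simp
  obtain n where n: "(K / 2 + 1) / \<epsilon> < real n" using reals_Archimedean2 by blast
  obtain L A C where h: "level_language \<beta> L A C \<delta>" "A \<ge> real n" "\<bar>C - (1 + sqrt 2) * A\<bar> \<le> K"
    using ex by blast
  have "(C + A) / 2 - 1 < \<beta> * A" using level_letter[OF h(1) b'] .
  \<comment> \<open>\<open>C\<close> is at least \<open>(1 + sqrt 2) * A - K\<close>, which is
    inserted into the bound from the letter \<open>N0\<close>.\<close>
  then have "\<epsilon> * A < K / 2 + 1" using h(3) unfolding \<epsilon>_def by (simp add: algebra_simps abs_le_iff)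
  moreover have "K / 2 + 1 < \<epsilon> * real n" using n \<open>\<epsilon> > 0\<close> by (simp add: field_simps)
  moreover have "\<epsilon> * real n \<le> \<epsilon> * A" using h(2) \<open>\<epsilon> > 0\<close> by (intro mult_left_mono) auto
  ultimately show False by linarith
qed

section \<open>Recurrent factors of an infinite binary word\<close>

fun enc :: "letter \<Rightarrow> nat" where
  "enc N0 = 0" | "enc N1 = 1" | "enc N2 = 2"

lemma inj_enc: "inj enc"
  unfolding inj_def by (simp add: letter_all)

definition occurrences :: "nat word \<Rightarrow> letter list \<Rightarrow> nat set" where
  "occurrences w u = {i. map enc u = w [i \<rightarrow> i + length u]}"

text \<open>Infinitely many occurrences are required because a factor seen only near the beginning
  of a one-sided word need not extend to the left.\<close>

definition recurrent_factors :: "nat word \<Rightarrow> letter list set" where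
  "recurrent_factors w = {u. infinite (occurrences w u)}"

lemma occurrences_iff: "i \<in> occurrences w u \<longleftrightarrow> (\<forall>j < length u. enc (u ! j) = w (i + j))"
proof -
  have "map enc u = w [i \<rightarrow> i + length u] \<longleftrightarrow> (\<forall>j < length u. map enc u ! j = map w [i..<i + length u] ! j)"
    unfolding subsequence_def by (subst list_eq_iff_nth_eq) simp
  then show ?thesis unfolding occurrences_def by simp
qed

lemma recurrent_in_factors:
  assumes "u \<in> recurrent_factors w" shows "map enc u \<in> factors w"
proof -
  obtain i where "i \<in> occurrences w u" using assms unfolding recurrent_factors_def
    by (metis (no_types) equals0I finite.emptyI mem_Collect_eq)
  then have "map enc u = w [i \<rightarrow> i + length u]" by (simp add: occurrences_def)
  then show ?thesis unfolding factors_def using le_add1 by blast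
qed

lemma factorial_recurrent: "factorial_lang (recurrent_factors w)"
proof (rule factorialI)
  fix s u t assume "s @ u @ t \<in> recurrent_factors w"
  then have inf: "infinite (occurrences w (s @ u @ t))" by (simp add: recurrent_factors_def)
  have "(\<lambda>i. i + length s) ` occurrences w (s @ u @ t) \<subseteq> occurrences w u"
  proof
    fix k assume "k \<in> (\<lambda>i. i + length s) ` occurrences w (s @ u @ t)"
    then obtain i where i: "i \<in> occurrences w (s @ u @ t)" "k = i + length s" by blast
    have "enc (u ! j) = w (k + j)" if "j < length u" for j
    proof -
      have "length s + j < length (s @ u @ t)" using that by simp
      then have "enc ((s @ u @ t) ! (length s + j)) = w (i + (length s + j))"
        using i(1) unfolding occurrences_iff by blast
      then show ?thesis using that i(2) by (simp add: nth_append add.assoc)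
    qed
    then show "k \<in> occurrences w u" unfolding occurrences_iff by blast
  qed
  moreover have "infinite ((\<lambda>i. i + length s) ` occurrences w (s @ u @ t))"
    using inf by (simp add: finite_image_iff)
  ultimately have "infinite (occurrences w u)" using infinite_super by blast
  then show "u \<in> recurrent_factors w" by (simp add: recurrent_factors_def)
qed

context
  fixes w :: "nat word" and \<alpha> :: real
  assumes binary: "range w \<subseteq> {0, 1}" and rich: "rich_word w" and free: "\<not> contains_power w \<alpha>"
begin

lemma letter_at: "\<exists>a. enc a = w i"
proof -
  have "w i = 0 \<or> w i = 1" using binary by auto
  then show ?thesis using enc.simps by metis
qed

text \<open>There are finitely many pairs of neighbouring letters, so infinitely many occurrences
  share the same pair.\<close>

lemma extendable_recurrent: "extendable (recurrent_factors w)"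
  unfolding extendable_def
proof (intro ballI impI)
  fix u assume "u \<in> recurrent_factors w"
  \<comment> \<open>Position 0 is dropped: it has no left neighbour, and \<open>i - 1\<close> would
    not be injective.\<close>
  define I where "I = occurrences w u - {0}"
  have "infinite I" using \<open>u \<in> recurrent_factors w\<close> unfolding I_def recurrent_factors_def by simp
  define c where "c i = (SOME a. enc a = w i)" for i
  have c: "enc (c i) = w i" for i unfolding c_def using letter_at by (rule someI_ex)
  have "finite ((\<lambda>i. (c (i - 1), c (i + length u))) ` I)" by (rule finite)
  from pigeonhole_infinite[OF \<open>infinite I\<close> this] obtain i0 where
    inf: "infinite {i \<in> I. (c (i - 1), c (i + length u)) = (c (i0 - 1), c (i0 + length u))}" by blast
  define a b where "a = c (i0 - 1)" and "b = c (i0 + length u)"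
  define J where "J = {i \<in> I. c (i - 1) = a \<and> c (i + length u) = b}"
  have "infinite J" using inf unfolding J_def a_def b_def by simp
  have "inj_on (\<lambda>i. i - 1) J"
  proof (rule inj_onI)
    fix i j assume "i \<in> J" "j \<in> J" "i - 1 = j - 1"
    moreover have "i \<noteq> 0" "j \<noteq> 0" using calculation(1,2) by (simp_all add: J_def I_def)
    ultimately show "i = j" by linarith
  qed
  then have "infinite ((\<lambda>i. i - 1) ` J)" using \<open>infinite J\<close> by (simp add: finite_image_iff)
  moreover have "(\<lambda>i. i - 1) ` J \<subseteq> occurrences w (a # u @ [b])"
  proof
    fix k assume "k \<in> (\<lambda>i. i - 1) ` J"
    then obtain i where i: "k = i - 1" "i \<in> J" by blast
    then have "i \<noteq> 0" "c (i - 1) = a" and i': "c (i + length u) = b" "i \<in> occurrences w u"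
      by (simp_all add: J_def I_def)
    then have ik: "i = Suc k" "c k = a" using i(1) by simp_all
    have "enc ((a # u @ [b]) ! j) = w (k + j)" if "j < length (a # u @ [b])" for j
    proof (cases j)
      case 0 then show ?thesis using ik c[of k] by simp
    next
      case (Suc j')
      show ?thesis
      proof (cases "j' < length u")
        case True
        then have "enc (u ! j') = w (i + j')" using i'(2) unfolding occurrences_iff by blast
        then show ?thesis using True Suc ik by (simp add: nth_append)
      next
        case False
        then have "j' = length u" using that Suc by simp
        then show ?thesis using Suc ik i'(1) c[of "i + length u"] by simp
      qed
    qed
    then show "k \<in> occurrences w (a # u @ [b])" unfolding occurrences_iff by blast
  qed
  ultimately have "infinite (occurrences w (a # u @ [b]))" using infinite_super by blast
  then show "\<exists>a b. a # u @ [b] \<in> recurrent_factors w" unfolding recurrent_factors_def by blast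
qed

lemma returns_recurrent: "palindromic_returns (recurrent_factors w)"
  unfolding palindromic_returns_def
proof (intro ballI allI impI)
  fix r p assume r: "r \<in> recurrent_factors w" and p: "palindrome p" "p \<noteq> []" "prefix p r" "suffix p r"
    and two: "\<forall>s t. r = s @ p @ t \<longrightarrow> s = [] \<or> t = []"
  have "palindromic_returns (factors w)"
    using rich rich_returns unfolding rich_word_def by blast
  then have "palindrome (map enc r)"
  proof (rule palindromic_returnsD)
    show "map enc r \<in> factors w" using recurrent_in_factors r by blast
    show "palindrome (map enc p)" using p(1) unfolding palindrome_def by (simp add: rev_map)
    show "prefix (map enc p) (map enc r)" using p(3) by (rule map_mono_prefix)
    show "suffix (map enc p) (map enc r)" using p(4) by (rule map_mono_suffix)
    fix S T assume "map enc r = S @ map enc p @ T"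
    then obtain s p' t where st: "r = s @ p' @ t" "S = map enc s" "map enc p = map enc p'" "T = map enc t"
      by (metis map_eq_append_conv)
    then have "p' = p" using inj_enc by (metis map_injective)
    then show "S = [] \<or> T = []" using two st by auto
  qed (use p in auto)
  then show "palindrome r" unfolding palindrome_def rev_map inj_map_eq_map[OF inj_enc] .
qed

lemma recurrent_power:
  assumes "x @ z \<in> recurrent_factors w" "x @ z = z @ t" "x \<noteq> []"
  shows "real (length z) < (\<alpha> - 1) * real (length x)"
proof -
  define u where "u = map enc (x @ z)"
  have "has_period u (length x)"
    unfolding has_period_def
  proof (intro conjI allI impI)
    show "1 \<le> length x" using assms(3) by (simp add: Suc_le_eq)
    fix i assume i: "i + length x < length u"
    then have iz: "i < length z" unfolding u_def by simp
    have "(x @ z) ! (i + length x) = z ! i" by (simp add: nth_append)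
    moreover have "(x @ z) ! i = z ! i" unfolding assms(2) using iz by (simp add: nth_append)
    ultimately show "u ! i = u ! (i + length x)" using i iz unfolding u_def by (simp del: map_append add: nth_map)
  qed
  then have "real (length u) / real (length x) \<in> exponents u" unfolding exponents_def by blast
  moreover have "u \<in> factors w" using recurrent_in_factors assms(1) u_def by blast
  moreover have "u \<noteq> []" using assms(3) u_def by simp
  ultimately have "\<not> real (length u) / real (length x) \<ge> \<alpha>" using free unfolding contains_power_def by blast
  then have "real (length u) < \<alpha> * real (length x)" using assms(3) by (simp add: field_simps not_le)
  then show ?thesis unfolding u_def by (simp add: algebra_simps)
qed

lemma recurrent_letter: "\<exists>a. [a] \<in> recurrent_factors w"
proof -
  define c where "c i = (SOME a. enc a = w i)" for i
  have c: "enc (c i) = w i" for i unfolding c_def using letter_at by (rule someI_ex)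
  have "finite (c ` UNIV)" by (rule finite)
  from pigeonhole_infinite[OF infinite_UNIV_nat this] obtain i0 where "infinite {i. c i = c i0}" by auto
  moreover have "{i. c i = c i0} \<subseteq> occurrences w [c i0]" using c by (auto simp: occurrences_iff) metis
  ultimately have "infinite (occurrences w [c i0])" using infinite_super by blast
  then show ?thesis unfolding recurrent_factors_def by blast
qed

lemma power_free_bound: "\<alpha> \<ge> 2 + sqrt 2 / 2"
proof (rule ccontr)
  assume "\<not> \<alpha> \<ge> 2 + sqrt 2 / 2"
  then have a: "\<alpha> - 1 < 1 + sqrt 2 / 2" by simp
  let ?L = "recurrent_factors w"
  have "[N2] \<notin> ?L"
  proof
    assume "[N2] \<in> ?L"
    then have "map enc [N2] \<in> factors w" by (rule recurrent_in_factors)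
    then obtain i j where "[2] = w [i \<rightarrow> j]" unfolding factors_def by auto
    then have "2 \<in> set (w [i \<rightarrow> j])" by (metis list.set_intros(1))
    then have "2 \<in> range w" unfolding subsequence_def by auto
    then show False using binary by auto
  qed
  moreover have "rich_language ?L"
    unfolding rich_language_def using factorial_recurrent extendable_recurrent returns_recurrent by blast
  moreover have "4 * length z < 7 * length x" if "x @ z \<in> ?L" "x @ z = z @ t" "x \<noteq> []" for x z t
  proof -
    have "(\<alpha> - 1) * real (length x) \<le> 7 / 4 * real (length x)"
      using a sqrt2_bounds by (intro mult_right_mono) auto
    then have "4 * real (length z) < 7 * real (length x)" using recurrent_power[OF that] by simp
    then show ?thesis by linarith
  qed
  ultimately have "binary_language ?L" unfolding binary_language_def by blast
  moreover have "bounded_powers (\<alpha> - 1) ?L (\<lambda>_. 1) 0 (\<lambda>_ _. 0)"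
    unfolding bounded_powers_def
  proof (intro allI impI)
    fix a x z t b assume h: "a # x @ z @ [b] \<in> ?L" "x @ z = z @ t" "x \<noteq> []"
    have "x @ z \<in> ?L" using factorialD[OF factorial_recurrent, of "[a]" "x @ z" "[b]"] h(1) by simp
    moreover have "weight (\<lambda>_. 1) v = real (length v)" for v :: "letter list" by (induction v) auto
    ultimately show "weight (\<lambda>_. 1) z + 0 + 0 + 0 < (\<alpha> - 1) * weight (\<lambda>_. 1) x"
      using recurrent_power h by simp
  qed
  ultimately obtain L A C \<delta> where "level_language (\<alpha> - 1) L A C \<delta>"
    using level_language_exists recurrent_letter by blast
  then show False using level_language_impossible a by blast
qed

end

section \<open>The fixed point of h\<close>

definition image_lang :: "(letter \<Rightarrow> letter list) \<Rightarrow> letter list set \<Rightarrow> letter list set" where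
  "image_lang p M = {u. \<exists>v\<in>M. sublist u (subst p v @ [N0])}"

definition h_iterate :: "nat \<Rightarrow> letter list" where
  "h_iterate n = (subst h_block ^^ n) [N0]"

text \<open>The factors of the fixed point of \<open>h\<close> starting with \<open>N0\<close>; by
  \<open>h_iterate_prefix\<close> the iterates are its prefixes.\<close>

definition h_lang :: "letter list set" where
  "h_lang = {u. \<exists>n. sublist u (h_iterate n)}"

lemma factorial_h_lang: "factorial_lang h_lang"
  unfolding factorial_lang_def h_lang_def by (auto intro: sublist_order.order.trans)

lemma factorial_image_lang: "factorial_lang (image_lang p M)"
  unfolding factorial_lang_def image_lang_def by (auto intro: sublist_order.order.trans)

lemma h_iterate_Suc: "h_iterate (Suc n) = subst h_block (h_iterate n)"
  by (simp add: h_iterate_def)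

lemma subst_power_append: "(subst p ^^ n) (u @ v) = (subst p ^^ n) u @ (subst p ^^ n) v"
  by (induction n) auto

lemma subst_power_nonempty: "u \<noteq> [] \<Longrightarrow> (subst p ^^ n) u \<noteq> []"
proof (induction n)
  case (Suc n)
  then show ?case by (cases "(subst p ^^ n) u") auto
qed simp

lemma h_iterate_prefix: "\<exists>u. h_iterate (Suc n) = h_iterate n @ u \<and> u \<noteq> []"
proof -
  have "h_iterate (Suc n) = (subst h_block ^^ n) (subst h_block [N0])"
    unfolding h_iterate_def by (simp only: funpow_Suc_right o_apply)
  also have "\<dots> = h_iterate n @ (subst h_block ^^ n) [N1]"
    using subst_power_append[of n h_block "[N0]" "[N1]"] by (simp add: h_iterate_def)
  finally show ?thesis using subst_power_nonempty[of "[N1]"] by blast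
qed

lemma sublist_subst: "sublist u v \<Longrightarrow> sublist (subst p u @ [N0]) (subst p v @ [N0])"
proof -
  assume "sublist u v"
  then obtain s t where v: "v = s @ u @ t" by (auto simp: sublist_def)
  obtain w where "subst p t @ [N0] = N0 # w" using subst_snoc_hd by blast
  then have "subst p v @ [N0] = subst p s @ (subst p u @ [N0]) @ w" unfolding v by simp
  then show ?thesis by (metis sublist_appendI)
qed

text \<open>Each iterate is a factor of its own image with closing marker, so every factor of the
  fixed point can be desubstituted.\<close>

lemma h_lang_image: "h_lang \<subseteq> image_lang h_block h_lang"
proof
  fix u assume "u \<in> h_lang"
  then obtain n where n: "sublist u (h_iterate n)" by (auto simp: h_lang_def)
  have "sublist (h_iterate n) (subst h_block (h_iterate n) @ [N0])"
  proof (cases n)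
    case 0
    then show ?thesis by (simp add: h_iterate_def sublist_Cons_right)
  next
    case (Suc m)
    have "sublist (h_iterate m) (h_iterate n)"
      using h_iterate_prefix[of m] unfolding Suc by (metis sublist_append_rightI)
    then have "sublist (subst h_block (h_iterate m) @ [N0]) (subst h_block (h_iterate n) @ [N0])"
      by (rule sublist_subst)
    then show ?thesis unfolding Suc h_iterate_Suc by (meson sublist_append_rightI sublist_order.order.trans)
  qed
  then have "sublist u (subst h_block (h_iterate n) @ [N0])" using n by (meson sublist_order.order.trans)
  moreover have "h_iterate n \<in> h_lang" by (auto simp: h_lang_def)
  ultimately show "u \<in> image_lang h_block h_lang" unfolding image_lang_def by blast
qed

lemma extendable_sublist:
  assumes "\<And>u. u \<in> L \<Longrightarrow> \<exists>s t. s \<noteq> [] \<and> t \<noteq> [] \<and> s @ u @ t \<in> L" "factorial_lang L"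
  shows "extendable L"
  unfolding extendable_def
proof (intro ballI impI)
  fix u assume "u \<in> L"
  then obtain s t where st: "s \<noteq> []" "t \<noteq> []" "s @ u @ t \<in> L" using assms(1) by blast
  then obtain s' a b t' where "s = s' @ [a]" "t = b # t'" by (metis neq_Nil_conv rev_exhaust)
  then have "s' @ (a # u @ [b]) @ t' \<in> L" using st by simp
  then show "\<exists>a b. a # u @ [b] \<in> L" using factorialD[OF assms(2)] by blast
qed

text \<open>The third iterate 010201022 contains 0 away from both ends; applying \<open>h\<close> n
  times puts the n-th iterate strictly inside a later one.\<close>

lemma extendable_h_lang: "extendable h_lang"
proof (rule extendable_sublist[OF _ factorial_h_lang])
  fix u assume "u \<in> h_lang"
  then obtain n s t where n: "h_iterate n = s @ u @ t" by (auto simp: h_lang_def sublist_def)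
  let ?P = "subst h_block ^^ n"
  have "h_iterate (n + 3) = ?P ((subst h_block ^^ 3) [N0])"
    unfolding h_iterate_def by (simp only: funpow_add o_apply)
  also have "(subst h_block ^^ 3) [N0] = [N0, N1] @ [N0] @ [N2, N0, N1, N0, N2, N2]"
    by (simp add: numeral_3_eq_3)
  also have "?P \<dots> = ?P [N0, N1] @ h_iterate n @ ?P [N2, N0, N1, N0, N2, N2]"
    by (simp only: subst_power_append h_iterate_def)
  finally have "h_iterate (n + 3) = (?P [N0, N1] @ s) @ u @ (t @ ?P [N2, N0, N1, N0, N2, N2])"
    unfolding n by simp
  then have "sublist ((?P [N0, N1] @ s) @ u @ (t @ ?P [N2, N0, N1, N0, N2, N2])) (h_iterate (n + 3))" by simp
  then have "(?P [N0, N1] @ s) @ u @ (t @ ?P [N2, N0, N1, N0, N2, N2]) \<in> h_lang"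
    unfolding h_lang_def by blast
  moreover have "?P [N0, N1] @ s \<noteq> []" "t @ ?P [N2, N0, N1, N0, N2, N2] \<noteq> []"
    by (simp_all add: subst_power_nonempty)
  ultimately show "\<exists>s t. s \<noteq> [] \<and> t \<noteq> [] \<and> s @ u @ t \<in> h_lang" by blast
qed

lemma extendable_image_lang:
  assumes "extendable M" "factorial_lang M" "\<exists>a. [a] \<in> M"
  shows "extendable (image_lang p M)"
proof (rule extendable_sublist[OF _ factorial_image_lang])
  fix u assume "u \<in> image_lang p M"
  then obtain v where v: "v \<in> M" "sublist u (subst p v @ [N0])" by (auto simp: image_lang_def)
  have "\<exists>v'\<in>M. v' \<noteq> [] \<and> sublist u (subst p v' @ [N0])"
  proof (cases "v = []")
    case True
    obtain a where "[a] \<in> M" using assms by blast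
    moreover have "sublist (subst p v @ [N0]) (subst p [a] @ [N0])"
      unfolding True by (rule sublist_subst) simp
    ultimately show ?thesis using v(2) sublist_order.order.trans by blast
  qed (use v in blast)
  then obtain v' where v': "v' \<in> M" "v' \<noteq> []" "sublist u (subst p v' @ [N0])" by blast
  then obtain a b where "a # v' @ [b] \<in> M" using assms(1) unfolding extendable_def by blast
  then obtain c d where cd: "c # (a # v' @ [b]) @ [d] \<in> M" using assms(1) unfolding extendable_def by blast
  obtain s t where st: "subst p v' @ [N0] = s @ u @ t" using v' by (auto simp: sublist_def)
  have "subst p (c # (a # v' @ [b]) @ [d]) @ [N0] =
    (N0 # p c @ N0 # p a @ s) @ u @ (t @ p b @ N0 # p d @ [N0])"
  proof -
    have "subst p (c # (a # v' @ [b]) @ [d]) @ [N0] =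
      (N0 # p c @ N0 # p a) @ (subst p v' @ [N0]) @ (p b @ N0 # p d @ [N0])" by simp
    then show ?thesis unfolding st by simp
  qed
  then have "sublist ((N0 # p c @ N0 # p a @ s) @ u @ (t @ p b @ N0 # p d @ [N0]))
    (subst p (c # (a # v' @ [b]) @ [d]) @ [N0])" by (simp only: sublist_order.order.refl)
  then have "(N0 # p c @ N0 # p a @ s) @ u @ (t @ p b @ N0 # p d @ [N0]) \<in> image_lang p M"
    using cd unfolding image_lang_def by blast
  then show "\<exists>s t. s \<noteq> [] \<and> t \<noteq> [] \<and> s @ u @ t \<in> image_lang p M" by blast
qed

lemma sublist_pair_h:
  "sublist [a, b] (subst h_block v @ [N0]) \<Longrightarrow> (a, b) \<in> {(N0, N1), (N0, N2), (N1, N0), (N2, N0), (N2, N2)}"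
proof (induction v)
  case (Cons c v)
  obtain w where "subst h_block v @ [N0] = N0 # w" using subst_snoc_hd by blast
  then show ?case using Cons by (cases c) (auto simp: sublist_Cons_right)
qed (auto simp: sublist_Cons_right)

lemma sublist_cube_h: "\<not> sublist [N2, N2, N2] (subst h_block v @ [N0])"
proof (induction v)
  case (Cons c v)
  obtain w where "subst h_block v @ [N0] = N0 # w" using subst_snoc_hd by blast
  then show ?case using Cons by (cases c) (auto simp: sublist_Cons_right)
qed (auto simp: sublist_Cons_right)

lemma h_lang_pair:
  assumes "s @ a # b # t \<in> h_lang"
  shows "(a, b) \<in> {(N0, N1), (N0, N2), (N1, N0), (N2, N0), (N2, N2)}"
proof -
  have "s @ [a, b] @ t \<in> h_lang" using assms by simp
  then have "[a, b] \<in> h_lang" by (rule factorialD[OF factorial_h_lang])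
  then show ?thesis using h_lang_image sublist_pair_h unfolding image_lang_def by blast
qed

lemma h_lang_no_222: "s @ N2 # N2 # N2 # t \<notin> h_lang"
proof
  assume "s @ N2 # N2 # N2 # t \<in> h_lang"
  then have "s @ [N2, N2, N2] @ t \<in> h_lang" by simp
  then have "[N2, N2, N2] \<in> h_lang" by (rule factorialD[OF factorial_h_lang])
  then show False using h_lang_image sublist_cube_h unfolding image_lang_def by blast
qed

section \<open>Repetitions in the fixed point\<close>

lemma weight_nonneg: "(\<And>a. W a \<ge> 0) \<Longrightarrow> weight W u \<ge> 0"
  by (induction u) auto

lemma weight_suffix: "(\<And>a. W a \<ge> 0) \<Longrightarrow> suffix s u \<Longrightarrow> weight W s \<le> weight W u"
  using weight_nonneg[of W] by (auto simp: Sublist.suffix_def)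

text \<open>A letter that prolongs a repetition can be absorbed into its excess.\<close>

definition absorbed :: "('a \<Rightarrow> real) \<Rightarrow> ('a \<Rightarrow> 'a \<Rightarrow> real) \<Rightarrow> 'a \<Rightarrow> 'a \<Rightarrow> real" where
  "absorbed W e a c = (if a = c then W a else e a c)"

text \<open>One prolongation is enough: the absorbed letter supplies exactly \<open>W b\<close>, and
  the new end contributes a nonnegative gain.\<close>

lemma absorb_right:
  assumes M: "factorial_lang M" "extendable M" and e: "\<And>a c. e a c \<ge> 0"
    and run: "a # x @ z @ [b] \<in> M" "x @ z = z @ t" "x \<noteq> []"
  shows "\<exists>z' t' b'. a # x @ z' @ [b'] \<in> M \<and> x @ z' = z' @ t' \<and>
    weight W z + absorbed W e b (hd t) \<le> weight W z' + e b' (hd t')"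
proof (cases "b = hd t")
  case True
  have "length t = length x" using run(2) by (metis add_left_cancel length_append add.commute)
  then obtain t0 where t0: "t = b # t0" using run(3) True by (cases t) auto
  obtain c d where "c # (a # x @ z @ [b]) @ [d] \<in> M" using M(2) run(1) unfolding extendable_def by blast
  then have "a # x @ (z @ [b]) @ [d] \<in> M" using factorialD1[OF M(1), of "[c]"] by simp
  moreover have "x @ (z @ [b]) = (z @ [b]) @ (t0 @ [b])" using run(2) t0 by (metis append.assoc append_Cons append_Nil)
  moreover have "weight W z + absorbed W e b (hd t) \<le> weight W (z @ [b]) + e d (hd (t0 @ [b]))"
    using True e[of d "hd (t0 @ [b])"] by (simp add: absorbed_def)
  ultimately show ?thesis by blast
next
  case False
  then have "weight W z + absorbed W e b (hd t) \<le> weight W z + e b (hd t)" by (simp add: absorbed_def)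
  then show ?thesis using run by blast
qed

text \<open>Prolonging to the left replaces the period word by a conjugate.\<close>

lemma absorb_left:
  assumes M: "factorial_lang M" "extendable M" and e: "\<And>a c. e a c \<ge> 0"
    and run: "a # x @ z @ [b] \<in> M" "x @ z = z @ t" "x \<noteq> []"
  shows "\<exists>x' z' a'. a' # x' @ z' @ [b] \<in> M \<and> x' @ z' = z' @ t \<and> length x' = length x \<and> weight W x' = weight W x \<and>
    weight W z + absorbed W e a (last x) \<le> weight W z' + e a' (last x')"
proof (cases "a = last x")
  case True
  then obtain x0 where x0: "x = x0 @ [a]" using run(3) by (metis append_butlast_last_id)
  obtain c d where "c # (a # x @ z @ [b]) @ [d] \<in> M" using M(2) run(1) unfolding extendable_def by blast
  then have "(c # a # x @ z @ [b]) @ [d] \<in> M" by simp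
  then have "c # a # x @ z @ [b] \<in> M" by (rule factorialD2[OF M(1)])
  then have "c # (a # x0) @ (a # z) @ [b] \<in> M" using x0 by simp
  moreover have "(a # x0) @ (a # z) = (a # z) @ t" using run(2) x0 by simp
  moreover have "weight W z + absorbed W e a (last x) \<le> weight W (a # z) + e c (last (a # x0))"
    using True e[of c "last (a # x0)"] by (simp add: absorbed_def)
  moreover have "length (a # x0) = length x" "weight W (a # x0) = weight W x" using x0 by simp_all
  ultimately show ?thesis by blast
next
  case False
  then have "weight W z + absorbed W e a (last x) \<le> weight W z + e a (last x)" by (simp add: absorbed_def)
  then show ?thesis using run by blast
qed

context block_code
begin

lemma marker_suffix:
  assumes "\<phi> v @ N0 # p a' = S @ a # s" "N0 \<notin> set s"
  shows "suffix (a # s) (N0 # p a')"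
proof -
  have "suffix (a # s) (\<phi> v @ N0 # p a')" "suffix (N0 # p a') (\<phi> v @ N0 # p a')"
    unfolding assms(1) by (auto simp: Sublist.suffix_def) (metis assms(1))
  then consider "suffix (a # s) (N0 # p a')" | "suffix (N0 # p a') (a # s)"
    using suffix_same_cases by blast
  then show ?thesis
  proof cases
    case 2
    then have "N0 # p a' = a # s \<or> suffix (N0 # p a') s" by (simp add: suffix_Cons)
    then show ?thesis using assms(2) by (auto simp: Sublist.suffix_def)
  qed
qed

lemma marker_prefix:
  assumes "p b' @ N0 # w = s @ b # T" "N0 \<notin> set s"
  shows "prefix (s @ [b]) (p b' @ [N0])"
proof -
  have "prefix (s @ [b]) (p b' @ N0 # w)" unfolding assms(1) by (auto simp: Sublist.prefix_def)
  moreover have "prefix (p b' @ [N0]) (p b' @ N0 # w)" by (auto simp: Sublist.prefix_def)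
  ultimately consider "prefix (s @ [b]) (p b' @ [N0])" | "prefix (p b' @ [N0]) (s @ [b])"
    using prefix_same_cases by blast
  then show ?thesis
  proof cases
    case 2
    then have "p b' @ [N0] = s @ [b] \<or> prefix (p b' @ [N0]) s" by (simp only: prefix_snoc)
    then show ?thesis using assms(2) by (auto simp: Sublist.prefix_def)
  qed
qed

text \<open>Cutting \<open>z\<close> at its first and last marker leaves a core that is an image.
  Its two occurrences, one period apart, are parsed separately, and the stretch between them is the
  image of the new period, a conjugate of \<open>x\<close>.\<close>

lemma desubst_run:
  assumes v0: "\<phi> v0 @ [N0] = S @ (a # x @ z @ [b]) @ T" and xz: "x @ z = z @ t" and x: "x \<noteq> []" and z: "N0 \<in> set z"
  shows "\<exists>v1 a' x' z' t' b' r s0 s1. v0 = v1 @ (a' # x' @ z' @ [b']) @ r \<and> x' @ z' = z' @ t' \<and> x' \<noteq> [] \<and>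
    (\<forall>W. weight W (\<phi> x') = weight W x) \<and> length (\<phi> x') = length x \<and> z = s0 @ \<phi> z' @ N0 # s1 \<and> N0 \<notin> set s0 \<and> N0 \<notin> set s1 \<and>
    suffix (a # s0) (N0 # p a') \<and> suffix (last x # s0) (N0 # p (last x')) \<and>
    prefix (s1 @ [b]) (p b' @ [N0]) \<and> prefix (s1 @ [hd t]) (p (hd t') @ [N0])"
proof -
  have lt: "length t = length x" using xz by (metis add_left_cancel length_append add.commute)
  obtain s0 z1 where s0: "z = s0 @ N0 # z1" "N0 \<notin> set s0" using z by (meson split_list_first)
  have "N0 \<in> set (N0 # z1)" by simp
  then obtain Z' s1 where Z': "N0 # z1 = Z' @ N0 # s1" "N0 \<notin> set s1" by (meson split_list_last)
  have zd: "z = s0 @ Z' @ N0 # s1" using s0 Z' by simp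
  have Zhd: "\<exists>w. Z' @ N0 # Y = N0 # w" for Y using Z'(1) by (cases Z') auto
  obtain x0 where x0: "x = x0 @ [last x]" using x by (metis append_butlast_last_id)
  obtain t0 where t0: "t = hd t # t0" using lt x by (cases t) auto
  \<comment> \<open>The copy of the core at the start of the repetition; \<open>o2\<close> shows the
    copy one period later.\<close>
  have o1: "\<phi> v0 @ [N0] = (S @ a # s0) @ Z' @ N0 # (s1 @ t @ b # T)"
    using v0 xz zd by (metis append.assoc append_Cons append_Nil)
  have o2: "\<phi> v0 @ [N0] = (S @ a # x @ s0) @ Z' @ N0 # (s1 @ b # T)"
    using v0 zd by simp
  obtain v1 z' r2 where v1: "v0 = v1 @ z' @ r2" "S @ a # s0 = \<phi> v1" "Z' = \<phi> z'" "\<phi> r2 @ [N0] = N0 # s1 @ t @ b # T"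
    using split_word[OF o1 Zhd] by blast
  obtain v3 z'' r4 where v3': "v0 = v3 @ z'' @ r4" "S @ a # x @ s0 = \<phi> v3" "Z' = \<phi> z''" "\<phi> r4 @ [N0] = N0 # s1 @ b # T"
    using split_word[OF o2 Zhd] by blast
  have "z'' = z'" using v3'(3) v1(3) by simp
  note v3 = v3'[unfolded this]
  have len: "length (\<phi> v1) < length (\<phi> v3)" using v1(2) v3(2) x by (simp flip: v1(2) v3(2))
  have "prefix v1 v0" "prefix v3 v0" using v1(1) v3(1) by (metis prefixI)+
  then consider "prefix v1 v3" | "prefix v3 v1" using prefix_same_cases by blast
  then obtain x' where x': "v3 = v1 @ x'"
  proof cases
    case 2
    then show ?thesis using len by (auto simp: Sublist.prefix_def)
  qed (auto simp: Sublist.prefix_def)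
  have "x' \<noteq> []" using len x' by auto
  have xs0: "x @ s0 = s0 @ \<phi> x'"
  proof -
    have "S @ a # x @ s0 = (S @ a # s0) @ \<phi> x'" using v3(2) v1(2) x' by simp
    then show ?thesis by simp
  qed
  have "weight W (\<phi> x') = weight W x" for W
    using arg_cong[OF xs0, of "weight W"] by simp
  moreover have "length (\<phi> x') = length x" using arg_cong[OF xs0, of length] by simp
  ultimately have ms: "(\<forall>W. weight W (\<phi> x') = weight W x) \<and> length (\<phi> x') = length x" by blast
  have "(x' @ z') @ r4 = z' @ r2" using v1(1) v3(1) x' by simp
  moreover have "length z' \<le> length (x' @ z')" by simp
  ultimately obtain t' where t': "x' @ z' = z' @ t'" "r2 = t' @ r4"
    by (metis append_eq_append_conv_if append_eq_conv_conj append_take_drop_id)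
  have lt': "length t' = length x'" using t'(1) by (metis add_left_cancel length_append add.commute)
  obtain t0' where t0': "t' = hd t' # t0'" using lt' \<open>x' \<noteq> []\<close> by (cases t') auto
  obtain x0' where x0': "x' = x0' @ [last x']" using \<open>x' \<noteq> []\<close> by (metis append_butlast_last_id)
  have "v1 \<noteq> []" using v1(2) by auto
  then obtain v1' a' where a': "v1 = v1' @ [a']" by (metis rev_exhaust)
  have "r4 \<noteq> []" using v3(4) by auto
  then obtain b' r5 where b': "r4 = b' # r5" by (cases r4) auto
  have "suffix (a # s0) (N0 # p a')"
    using v1(2) a' s0(2) by (intro marker_suffix[of v1' a' S]) auto
  moreover have "suffix (last x # s0) (N0 # p (last x'))"
  proof (rule marker_suffix)
    have "v3 = (v1 @ x0') @ [last x']" using x' x0' by simp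
    then have "\<phi> v3 = \<phi> (v1 @ x0') @ N0 # p (last x')" by (metis subst_simps append_Nil2)
    moreover have "S @ a # x @ s0 = (S @ a # x0) @ last x # s0" by (subst x0) simp
    ultimately show "\<phi> (v1 @ x0') @ N0 # p (last x') = (S @ a # x0) @ last x # s0" using v3(2) by simp
  qed fact
  moreover have "prefix (s1 @ [b]) (p b' @ [N0])"
  proof -
    obtain w where w: "\<phi> r5 @ [N0] = N0 # w" using subst_snoc_hd by blast
    have "p b' @ N0 # w = s1 @ b # T" using v3(4) unfolding b' by (simp add: w)
    then show ?thesis using marker_prefix Z'(2) by blast
  qed
  moreover have "prefix (s1 @ [hd t]) (p (hd t') @ [N0])"
  proof -
    obtain w where w: "\<phi> (t0' @ r4) @ [N0] = N0 # w" using subst_snoc_hd by blast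
    have "r2 = hd t' # (t0' @ r4)" using t'(2) t0' by (metis append_Cons)
    then have "\<phi> r2 @ [N0] = N0 # p (hd t') @ (\<phi> (t0' @ r4) @ [N0])" by simp
    then have "p (hd t') @ N0 # w = s1 @ t @ b # T" using v1(4) w by simp
    also have "\<dots> = s1 @ hd t # (t0 @ b # T)" by (subst t0) simp
    finally show ?thesis using marker_prefix Z'(2) by blast
  qed
  moreover have "v0 = v1' @ (a' # x' @ z' @ [b']) @ r5" using v3(1) x' a' b' by simp
  ultimately show ?thesis using t'(1) \<open>x' \<noteq> []\<close> ms zd v1(3) s0(2) Z'(2) by blast
qed

end

lemma length_subst_less:
  assumes "v \<noteq> []" "\<forall>a. p a \<noteq> []" shows "length v < length (subst p v)"
proof -
  have "2 * length v \<le> length (subst p v)"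
  proof (induction v)
    case (Cons a v)
    have "length (p a) \<ge> 1" using assms(2) by (simp add: Suc_le_eq)
    then show ?case using Cons by simp
  qed simp
  then show ?thesis using assms(1) by (cases v) auto
qed

context extension_code
begin

text \<open>For equal letters the overlap lies in one block. For distinct ones it is compared with
  the exact common part: if shorter, the next letters agree and belong to that part; if of equal
  length, they are the letters \<open>nxt\<close>; longer is impossible because those
  differ.\<close>

lemma common_suffix_bound:
  assumes W: "\<And>a. W a \<ge> 0" and e: "\<And>a b. e a b \<ge> 0" "\<And>a. e a a = 0"
    and nxt: "a' \<noteq> c' \<Longrightarrow> nxt a' c' \<noteq> nxt c' a'"
    and s: "suffix (a # s) (N0 # p a')" "suffix (c # s) (N0 # p c')"
  shows "weight W s + e a c \<le> absorbed (\<lambda>a. W N0 + weight W (p a)) (\<lambda>a c. weight W (ext a c) + e (nxt a c) (nxt c a)) a' c'"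
proof (cases "a' = c'")
  case True
  then have "suffix (a # s) (c # s) \<or> suffix (c # s) (a # s)" using s suffix_same_cases by blast
  then have "a = c" by (auto dest: suffix_length_le simp: suffix_Cons)
  moreover have "weight W s \<le> weight W (N0 # p a')"
    using weight_suffix[of W, OF W s(1)] W[of a] by simp
  ultimately show ?thesis using True e(2) by (simp add: absorbed_def)
next
  case False
  define \<sigma> where "\<sigma> = rev (ext a' c')"
  obtain r where r: "N0 # p a' = r @ nxt a' c' # \<sigma>" using ext_suffix \<sigma>_def by blast
  obtain r' where r': "N0 # p c' = r' @ nxt c' a' # \<sigma>" using ext_suffix[of c' a'] ext_sym \<sigma>_def by metis
  have sa: "suffix (nxt a' c' # \<sigma>) (N0 # p a')" "suffix (nxt c' a' # \<sigma>) (N0 # p c')"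
    unfolding r r' by (auto simp: Sublist.suffix_def)
  consider "length s < length \<sigma>" | "length s = length \<sigma>" | "length s > length \<sigma>" by linarith
  then have "weight W s + e a c \<le> weight W \<sigma> + e (nxt a' c') (nxt c' a')"
  proof cases
    case 1
    then have "suffix (a # s) (nxt a' c' # \<sigma>)" "suffix (c # s) (nxt c' a' # \<sigma>)"
      using s sa by (auto intro: suffix_length_suffix)
    then have *: "suffix (a # s) \<sigma>" "suffix (c # s) \<sigma>" using 1 by (auto simp: suffix_Cons)
    then have "suffix (a # s) (c # s) \<or> suffix (c # s) (a # s)" using suffix_same_cases by blast
    then have "a = c" by (auto dest: suffix_length_le simp: suffix_Cons)
    moreover have "weight W (a # s) \<le> weight W \<sigma>" using weight_suffix[of W, OF W *(1)] .
    ultimately show ?thesis using e W[of a] by (simp add: add_increasing2)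
  next
    case 2
    then have "suffix (a # s) (nxt a' c' # \<sigma>)" "suffix (c # s) (nxt c' a' # \<sigma>)"
      using s sa by (auto intro: suffix_length_suffix)
    then have "a # s = nxt a' c' # \<sigma>" "c # s = nxt c' a' # \<sigma>" using 2 by (auto simp: suffix_Cons dest: suffix_length_le)
    then show ?thesis by simp
  next
    case 3
    then have "suffix (nxt a' c' # \<sigma>) (a # s)" "suffix (nxt c' a' # \<sigma>) (c # s)"
      using s sa by (auto intro: suffix_length_suffix)
    then have "suffix (nxt a' c' # \<sigma>) s" "suffix (nxt c' a' # \<sigma>) s" using 3 by (auto simp: suffix_Cons)
    then have "suffix (nxt a' c' # \<sigma>) (nxt c' a' # \<sigma>) \<or> suffix (nxt c' a' # \<sigma>) (nxt a' c' # \<sigma>)"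
      using suffix_same_cases by blast
    then have "nxt a' c' = nxt c' a'" by (auto dest: suffix_length_le simp: suffix_Cons)
    then show ?thesis using nxt False by blast
  qed
  then show ?thesis using False unfolding \<sigma>_def by (simp add: absorbed_def)
qed

text \<open>Converse to \<open>bounded_powers_desubst\<close>: an image repetition has no more
  excess than a preimage accounts for, once that has absorbed a letter at each end where it can. The
  guarded decrease of length serves the induction for \<open>h\<close>; \<open>f\<close> has an
  empty block.\<close>

lemma desubst_power:
  fixes W k e
  defines "W' \<equiv> \<lambda>a. W N0 + weight W (p a)"
    and "e' \<equiv> \<lambda>a c. weight W (ext a c) + e (nxt a c) (nxt c a)"
  assumes M: "factorial_lang M" "extendable M"
    and W: "\<And>a. W a \<ge> 0" and e: "\<And>a b. e a b \<ge> 0" "\<And>a. e a a = 0"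
    and nxt: "\<And>a c. a \<noteq> c \<Longrightarrow> nxt a c \<noteq> nxt c a"
    and run: "a # x @ z @ [b] \<in> image_lang p M" "x @ z = z @ t" "x \<noteq> []" "N0 \<in> set z"
  shows "\<exists>a' x' z' t' b'. a' # x' @ z' @ [b'] \<in> M \<and> x' @ z' = z' @ t' \<and> x' \<noteq> [] \<and>
    ((\<forall>a. p a \<noteq> []) \<longrightarrow> length x' < length x) \<and> weight W' x' = weight W x \<and>
    weight W z + k + e a (last x) + e b (hd t) \<le> weight W' z' + (k + W N0) + e' a' (last x') + e' b' (hd t')"
proof -
  obtain v0 S T where v0: "v0 \<in> M" "\<phi> v0 @ [N0] = S @ (a # x @ z @ [b]) @ T"
    using run(1) unfolding image_lang_def sublist_def by blast
  from desubst_run[OF v0(2) run(2-4)] obtain v1 a' x' z' t' b' r s0 s1 where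
    d: "v0 = v1 @ (a' # x' @ z' @ [b']) @ r" "x' @ z' = z' @ t'" "x' \<noteq> []"
      "\<forall>W. weight W (\<phi> x') = weight W x" "z = s0 @ \<phi> z' @ N0 # s1"
      "suffix (a # s0) (N0 # p a')" "suffix (last x # s0) (N0 # p (last x'))"
      "prefix (s1 @ [b]) (p b' @ [N0])" "prefix (s1 @ [hd t]) (p (hd t') @ [N0])" "length (\<phi> x') = length x"
    by blast
  have e': "e' u v \<ge> 0" for u v unfolding e'_def using weight_nonneg[of W, OF W] e(1) by (simp add: add_nonneg_nonneg)
  have wx: "weight W' x' = weight W x"
  proof -
    have "weight W (\<phi> x') = weight W x" using d(4) by blast
    then show ?thesis unfolding W'_def weight_subst .
  qed
  have m: "a' # x' @ z' @ [b'] \<in> M" using factorialD[OF M(1)] v0(1) d(1) by blast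
  have l: "weight W s0 + e a (last x) \<le> absorbed W' e' a' (last x')"
    unfolding W'_def e'_def by (rule common_suffix_bound[of W e, OF W e nxt d(6,7)])
  \<comment> \<open>Blocks being palindromes, the right end is mirrored to reuse the bound for
    suffixes.\<close>
  have sf: "suffix (b # rev s1) (N0 # p b')" "suffix (hd t # rev s1) (N0 # p (hd t'))"
    using d(8,9) block_palindrome by (auto simp: suffix_to_prefix)
  have "weight W (rev s1) + e b (hd t) \<le> absorbed W' e' b' (hd t')"
    unfolding W'_def e'_def by (rule common_suffix_bound[of W e, OF W e nxt sf])
  then have r: "weight W s1 + e b (hd t) \<le> absorbed W' e' b' (hd t')" by simp
  from absorb_right[of M e', OF M e' m d(2,3), of W'] obtain z2 t2 b2 where
    2: "a' # x' @ z2 @ [b2] \<in> M" "x' @ z2 = z2 @ t2"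
      "weight W' z' + absorbed W' e' b' (hd t') \<le> weight W' z2 + e' b2 (hd t2)" by blast
  from absorb_left[of M e', OF M e' 2(1,2) d(3), of W'] obtain x3 z3 a3 where
    3: "a3 # x3 @ z3 @ [b2] \<in> M" "x3 @ z3 = z3 @ t2" "length x3 = length x'" "weight W' x3 = weight W' x'"
      "weight W' z2 + absorbed W' e' a' (last x') \<le> weight W' z3 + e' a3 (last x3)" by blast
  have "weight W z = weight W s0 + weight W' z' + W N0 + weight W s1"
    unfolding d(5) W'_def by (simp add: weight_subst)
  then have "weight W z + k + e a (last x) + e b (hd t) \<le> weight W' z3 + (k + W N0) + e' a3 (last x3) + e' b2 (hd t2)"
    using l r 2(3) 3(5) by linarith
  moreover have "x3 \<noteq> []" using 3(3) d(3) by auto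
  moreover have "(\<forall>a. p a \<noteq> []) \<longrightarrow> length x3 < length x" using length_subst_less[OF d(3)] d(10) 3(3) by metis
  moreover have "weight W' x3 = weight W x" using 3(4) wx by simp
  ultimately show ?thesis using 3(1,2) by blast
qed

end

text \<open>The deviation is measured from the eigendirection; it is \<open>2 - sqrt 2\<close> at
  the start \<open>(1, 3)\<close> and shrinks by the factor \<open>sqrt 2 - 1\<close> in each
  step.\<close>

definition on_track :: "real \<Rightarrow> real \<Rightarrow> bool" where
  "on_track A C \<longleftrightarrow> A \<ge> 1 \<and> C \<ge> 2 * A + 1 \<and> \<bar>C - (1 + sqrt 2) * A\<bar> \<le> 1"

lemma on_track_step:
  assumes "on_track A C" shows "on_track C (A + 2 * C)"
proof -
  have "sqrt 2 * sqrt 2 = (2::real)" by simp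
  then have "A + 2 * C - (1 + sqrt 2) * C = (1 - sqrt 2) * (C - (1 + sqrt 2) * A)"
    by (simp add: algebra_simps)
  then have "\<bar>A + 2 * C - (1 + sqrt 2) * C\<bar> = \<bar>1 - sqrt 2\<bar> * \<bar>C - (1 + sqrt 2) * A\<bar>"
    by (simp add: abs_mult)
  also have "\<dots> \<le> 1 * 1"
    using sqrt2_bounds assms unfolding on_track_def by (intro mult_mono) auto
  finally show ?thesis using assms unfolding on_track_def by simp
qed

text \<open>Desubstituting the letter \<open>N0\<close> and the square \<open>N2 N2\<close> gives the two extremal families of
  repetitions; for both of them \<open>on_track A C\<close> is exactly what is needed.\<close>

lemma on_track_bounds:
  assumes "on_track A C"
  defines "\<beta> \<equiv> 1 + sqrt 2 / 2"
  shows "(C + A) / 2 - 1 \<le> \<beta> * A"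
    and "C + (C + A) / 2 - 1 \<le> \<beta> * C"
    and "\<And>x. x \<ge> 0 \<Longrightarrow> 17 / 10 * x \<le> \<beta> * x"
proof -
  have c: "C - (1 + sqrt 2) * A \<le> 1" "(1 + sqrt 2) * A - C \<le> 1"
    using assms(1) unfolding on_track_def by (auto simp: abs_le_iff)
  show "(C + A) / 2 - 1 \<le> \<beta> * A" using c(1) unfolding \<beta>_def by (simp add: field_simps)
  \<comment> \<open>\<open>sqrt 2 - 1\<close> is the inverse of \<open>1 + sqrt 2\<close>; the
    multiplication solves the second bound for \<open>A\<close>.\<close>
  have "(sqrt 2 - 1) * ((1 + sqrt 2) * A - C) \<le> (sqrt 2 - 1) * 1"
    using c(2) sqrt2_bounds by (intro mult_left_mono) auto
  moreover have "(sqrt 2 - 1) * ((1 + sqrt 2) * A - C) = A - (sqrt 2 - 1) * C"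
  proof -
    have "sqrt 2 * sqrt 2 = (2::real)" by simp
    then have "sqrt 2 * (sqrt 2 * A) = 2 * A" by (metis mult.assoc)
    then show ?thesis by (simp add: algebra_simps)
  qed
  ultimately have "A \<le> (sqrt 2 - 1) * C + (sqrt 2 - 1)" by simp
  then show "C + (C + A) / 2 - 1 \<le> \<beta> * C" using sqrt2_bounds unfolding \<beta>_def by (simp add: field_simps)
  show "17 / 10 * x \<le> \<beta> * x" if "x \<ge> 0" for x
    using that sqrt2_bounds unfolding \<beta>_def by (intro mult_right_mono) auto
qed

lemma gain_self: "gain A C \<delta> a a = 0"
  by (cases a) auto

lemma h_lang_letters_zero_free:
  assumes "z \<in> h_lang" "N0 \<notin> set z"
  shows "z \<in> {[], [N1], [N2], [N2, N2]}"
proof -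
  have p2: "a = N2 \<and> b = N2" if "s @ a # b # t = z" for s a b t
    using h_lang_pair[of s a b t] that assms by auto
  show ?thesis
  proof (cases z rule: remdups_adj.cases)
    case (2 a) then show ?thesis using assms(2) by (cases a) auto
  next
    case (3 a b t)
    then have ab: "a = N2" "b = N2" using p2[of "[]" a b t] by auto
    have "t = []"
    proof (cases t)
      case (Cons c t')
      then have "c = N2" using p2[of "[a]" b c t'] 3 by auto
      then show ?thesis using h_lang_no_222[of "[]" t'] assms(1) 3 ab Cons by simp
    qed
    then show ?thesis using 3 ab by simp
  qed simp
qed

lemma h_lang_N2_neighbours:
  "s @ a # N2 # t \<in> h_lang \<Longrightarrow> a \<noteq> N1" "s @ N2 # b # t \<in> h_lang \<Longrightarrow> b \<noteq> N1"
  using h_lang_pair[of s a N2 t] h_lang_pair[of s N2 b t] by auto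

lemma wt_two:
  assumes "on_track A C" "s @ a # b # t \<in> h_lang" shows "C \<le> wt A C a + wt A C b"
  using h_lang_pair[OF assms(2)] assms(1) unfolding on_track_def by auto

lemma weight_wt_nonneg: "on_track A C \<Longrightarrow> 0 \<le> weight (wt A C) u"
proof (rule weight_nonneg)
  fix a assume "on_track A C"
  then show "0 \<le> wt A C a" unfolding on_track_def by (cases a) auto
qed

lemma gain_le: "on_track A C \<Longrightarrow> gain A C 1 a b \<le> (C - 1) / 2"
  unfolding on_track_def by (cases a; cases b) auto

lemma gain_nonneg_on_track: "on_track A C \<Longrightarrow> 0 \<le> gain A C 1 a b"
  unfolding on_track_def by (cases a; cases b) auto

lemma gain_le_small:
  "on_track A C \<Longrightarrow> a \<noteq> N1 \<Longrightarrow> b \<noteq> N1 \<Longrightarrow> gain A C 1 a b \<le> (A - 1) / 2"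
  unfolding on_track_def by (cases a; cases b; auto)

text \<open>The excess is one of \<open>[]\<close>, 1, 2, 22. The sharp constant is used only for
  the one-letter periods \<open>N0\<close> and \<open>N2\<close>; longer periods weigh at least
  \<open>C\<close>, and \<open>17 / 10\<close> suffices for them.\<close>

lemma base_power:
  assumes tr: "on_track A C" and run: "a # x @ z @ [b] \<in> h_lang" "x @ z = z @ t" "x \<noteq> []" "N0 \<notin> set z"
  shows "weight (wt A C) z + excess A C 1 + gain A C 1 a (last x) + gain A C 1 b (hd t) \<le> (1 + sqrt 2 / 2) * weight (wt A C) x"
proof -
  let ?W = "weight (wt A C)"
  note B = on_track_bounds[OF tr]
  have ineq: "A \<ge> 1" "C \<ge> 2 * A + 1" using tr by (auto simp: on_track_def)
  have lt: "length t = length x" using run(2) by (metis add_left_cancel length_append add.commute)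
  obtain x0 where x0: "x = x0 @ [last x]" using run(3) by (metis append_butlast_last_id)
  obtain t0 where t0: "t = hd t # t0" using lt run(3) by (cases t) auto
  have run1: "a # z @ t @ [b] \<in> h_lang" using run(1,2) by (metis append.assoc)
  have zL: "z \<in> h_lang" using run(1) factorialD[OF factorial_h_lang, of "a # x" z "[b]"] by simp
  have ea: "excess A C 1 = (C - A) / 2" by (simp add: excess_def)
  have Wx0: "?W x \<ge> 0" using weight_wt_nonneg[OF tr] .
  have two: "C \<le> wt A C c + wt A C d \<and> ?W x = wt A C c + wt A C d + ?W r" if "x = c # d # r" for c d r
    using wt_two[OF tr, of "[a]" c d "r @ z @ [b]"] run(1) that by simp
  have xc: "(\<exists>c. x = [c]) \<or> (\<exists>c d r. x = c # d # r)" using run(3) by (cases x rule: remdups_adj.cases) auto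
  consider "z = []" | "z = [N1]" | "z = [N2]" | "z = [N2, N2]"
    using h_lang_letters_zero_free[OF zL run(4)] by blast
  then show ?thesis
  proof cases
    case 1
    show ?thesis
      using xc
    proof
      assume "\<exists>c. x = [c]"
      then obtain c where c: "x = [c]" by blast
      then have t: "t = [c]" using run(2) 1 by simp
      have "[] @ a # c # [b] \<in> h_lang" "[a] @ c # b # [] \<in> h_lang" using run(1) c 1 by simp_all
      then have nb: "(a, c) \<in> {(N0, N1), (N0, N2), (N1, N0), (N2, N0), (N2, N2)}"
        "(c, b) \<in> {(N0, N1), (N0, N2), (N1, N0), (N2, N0), (N2, N2)}"
        using h_lang_pair by blast+
      \<comment> \<open>Adjacent letters are never \<open>N1\<close> and \<open>N2\<close> in either
        order, so only the smaller gain occurs.\<close>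
      have "gain A C 1 a c \<le> (A - 1) / 2" "gain A C 1 b c \<le> (A - 1) / 2"
        using nb ineq by (cases a; cases b; cases c; auto)+
      moreover have "(C + A) / 2 - 1 \<le> (1 + sqrt 2 / 2) * wt A C c"
      proof (cases c)
        case N0 then show ?thesis using B(1) by simp
      next
        case N1
        then show ?thesis using B(3)[of "C - A"] ineq by (simp only: wt.simps) argo
      next
        case N2 then show ?thesis using B(2) ineq by simp
      qed
      ultimately show ?thesis using 1 c t ea by (simp add: field_simps)
    next
      assume "\<exists>c d r. x = c # d # r"
      then obtain c d r where x: "x = c # d # r" by blast
      have "C \<le> ?W x" using two[OF x] weight_wt_nonneg[OF tr, of r] by simp
      moreover have "3 / 2 * C - A / 2 - 1 \<le> 17 / 10 * C" using ineq by argo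
      ultimately show ?thesis
        using B(3)[OF Wx0] gain_le[OF tr, of a "last x"] gain_le[OF tr, of b "hd t"] 1 ea by (simp add: field_simps)
    qed
  next
    case 2
    \<comment> \<open>All neighbours of \<open>N1\<close> are \<open>N0\<close>, so both ends
      compare equal letters and gain nothing.\<close>
    have "(a # x0) @ last x # N1 # [b] \<in> h_lang" using run(1) unfolding 2 by (subst (asm) x0) simp
    then have lx: "last x = N0" using h_lang_pair by blast
    have "[] @ a # N1 # (t @ [b]) \<in> h_lang" using run1 unfolding 2 by simp
    then have a: "a = N0" using h_lang_pair by blast
    have "(a # x) @ N1 # b # [] \<in> h_lang" using run(1) unfolding 2 by simp
    then have b: "b = N0" using h_lang_pair by blast
    have "[a] @ N1 # hd t # (t0 @ [b]) \<in> h_lang" using run1 t0 unfolding 2 by (metis append_Cons append_Nil)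
    then have d: "hd t = N0" using h_lang_pair by blast
    have "hd x = N1" using run(2,3) 2 by (cases x) auto
    then have "\<exists>c d r. x = c # d # r" using xc lx by auto
    then obtain c d r where x: "x = c # d # r" by blast
    have "C \<le> ?W x" using two[OF x] weight_wt_nonneg[OF tr, of r] by simp
    moreover have "C - A + (C - A) / 2 \<le> 17 / 10 * C" using ineq by argo
    ultimately have "C - A + (C - A) / 2 \<le> (1 + sqrt 2 / 2) * ?W x" using B(3)[OF Wx0] by linarith
    moreover have "?W z + excess A C 1 + gain A C 1 a (last x) + gain A C 1 b (hd t) = C - A + (C - A) / 2"
      unfolding 2 lx a b d ea by simp
    ultimately show ?thesis by simp
  next
    case 3
    have "(a # x0) @ last x # N2 # [b] \<in> h_lang" using run(1) unfolding 3 by (subst (asm) x0) simp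
    then have lx: "last x \<noteq> N1" using h_lang_N2_neighbours by blast
    have "[] @ a # N2 # (t @ [b]) \<in> h_lang" using run1 unfolding 3 by simp
    then have a: "a \<noteq> N1" using h_lang_N2_neighbours by blast
    have "(a # x) @ N2 # b # [] \<in> h_lang" using run(1) unfolding 3 by simp
    then have b: "b \<noteq> N1" using h_lang_N2_neighbours by blast
    have "[a] @ N2 # hd t # (t0 @ [b]) \<in> h_lang" using run1 t0 unfolding 3 by (metis append_Cons append_Nil)
    then have d: "hd t \<noteq> N1" using h_lang_N2_neighbours by blast
    have g: "gain A C 1 a (last x) \<le> (A - 1) / 2" "gain A C 1 b (hd t) \<le> (A - 1) / 2"
      using gain_le_small[OF tr] lx a b d by blast+
    have hx: "hd x = N2" using run(2,3) 3 by (cases x) auto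
    have "C + (C + A) / 2 - 1 \<le> (1 + sqrt 2 / 2) * ?W x"
      using xc
    proof
      assume "\<exists>c. x = [c]"
      then show ?thesis using hx B(2) by auto
    next
      assume "\<exists>c d r. x = c # d # r"
      then obtain c d' r where x: "x = c # d' # r" by blast
      then have c: "c = N2" using hx by simp
      have "[a] @ N2 # d' # (r @ z @ [b]) \<in> h_lang" using run(1) x c by simp
      then have "d' \<noteq> N1" using h_lang_N2_neighbours by blast
      then have "wt A C d' \<ge> A" using ineq by (cases d') auto
      then have "C + A \<le> ?W x" using two[OF x] c weight_wt_nonneg[OF tr, of r] by simp
      moreover have "C + (C + A) / 2 - 1 \<le> 17 / 10 * (C + A)" using ineq by argo
      ultimately show ?thesis using B(3)[OF Wx0] by argo
    qed
    then show ?thesis using g 3 ea by (simp add: field_simps)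
  next
    case 4
    have "\<exists>r. x = N2 # N2 # r"
      using xc
    proof
      assume "\<exists>c. x = [c]"
      then obtain c where "x = [c]" by blast
      then have "[a] @ N2 # N2 # N2 # [b] \<in> h_lang" using run(1,2) 4 by auto
      then show ?thesis using h_lang_no_222 by blast
    next
      assume "\<exists>c d r. x = c # d # r"
      then show ?thesis using run(2) 4 by auto
    qed
    then obtain r where x: "x = N2 # N2 # r" by blast
    have "(a # x0) @ last x # N2 # [N2, b] \<in> h_lang" using run(1) unfolding 4 by (subst (asm) x0) simp
    then have lx: "last x \<noteq> N1" using h_lang_N2_neighbours by blast
    have "[] @ a # N2 # (N2 # t @ [b]) \<in> h_lang" using run1 unfolding 4 by simp
    then have a: "a \<noteq> N1" using h_lang_N2_neighbours by blast
    have "(a # x @ [N2]) @ N2 # b # [] \<in> h_lang" using run(1) unfolding 4 by simp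
    then have b: "b \<noteq> N1" using h_lang_N2_neighbours by blast
    have "[a, N2] @ N2 # hd t # (t0 @ [b]) \<in> h_lang" using run1 t0 unfolding 4 by (metis append_Cons append_Nil)
    then have d: "hd t \<noteq> N1" using h_lang_N2_neighbours by blast
    have g: "gain A C 1 a (last x) \<le> (A - 1) / 2" "gain A C 1 b (hd t) \<le> (A - 1) / 2"
      using gain_le_small[OF tr] lx a b d by blast+
    have "2 * C \<le> ?W x" using x weight_wt_nonneg[OF tr, of r] by simp
    moreover have "2 * C + (C + A) / 2 - 1 \<le> 17 / 10 * (2 * C)" using ineq by argo
    ultimately have "2 * C + (C + A) / 2 - 1 \<le> (1 + sqrt 2 / 2) * ?W x" using B(3)[OF Wx0] by linarith
    then show ?thesis using g 4 ea by (simp add: field_simps)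
  qed
qed

text \<open>Each desubstitution shortens the period and passes to the next pair
  \<open>(C, A + 2 * C)\<close>; hence the induction is on the length of \<open>x\<close> with
  \<open>A\<close> and \<open>C\<close> arbitrary. It ends when the excess has no marker.\<close>

lemma h_lang_power:
  assumes "on_track A C" "a # x @ z @ [b] \<in> h_lang" "x @ z = z @ t" "x \<noteq> []"
  shows "weight (wt A C) z + excess A C 1 + gain A C 1 a (last x) + gain A C 1 b (hd t) \<le> (1 + sqrt 2 / 2) * weight (wt A C) x"
  using assms
proof (induction "length x" arbitrary: a x z t b A C rule: less_induct)
  case less
  note tr = less.prems(1)
  show ?case
  proof (cases "N0 \<in> set z")
    case False
    then show ?thesis using base_power[OF less.prems] by blast
  next
    case True
    have W: "0 \<le> wt A C c" for c using tr unfolding on_track_def by (cases c) auto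
    have nxt: "nxt_of h_block h_ext c d \<noteq> nxt_of h_block h_ext d c" if "c \<noteq> d" for c d
      using that by (cases c; cases d) (auto simp: nxt_of_def)
    have "a # x @ z @ [b] \<in> image_lang h_block h_lang" using less.prems(2) h_lang_image by blast
    from h.desubst_power[of h_lang "wt A C" "gain A C 1", OF factorial_h_lang extendable_h_lang W gain_nonneg_on_track[OF tr] gain_self nxt
        this less.prems(3,4) True, of "excess A C 1"]
    obtain a' x' z' t' b' where d: "a' # x' @ z' @ [b'] \<in> h_lang" "x' @ z' = z' @ t'" "x' \<noteq> []"
      "(\<forall>a. h_block a \<noteq> []) \<longrightarrow> length x' < length x"
      "weight (\<lambda>a. wt A C N0 + weight (wt A C) (h_block a)) x' = weight (wt A C) x"
      "weight (wt A C) z + excess A C 1 + gain A C 1 a (last x) + gain A C 1 b (hd t)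
        \<le> weight (\<lambda>a. wt A C N0 + weight (wt A C) (h_block a)) z' + (excess A C 1 + wt A C N0)
         + (weight (wt A C) (h_ext a' (last x')) + gain A C 1 (nxt_of h_block h_ext a' (last x')) (nxt_of h_block h_ext (last x') a'))
         + (weight (wt A C) (h_ext b' (hd t')) + gain A C 1 (nxt_of h_block h_ext b' (hd t')) (nxt_of h_block h_ext (hd t') b'))"
      by blast
    have 1: "(\<lambda>a. wt A C N0 + weight (wt A C) (h_block a)) = wt C (A + 2 * C)"
      by (rule ext, case_tac a) auto
    have 2: "weight (wt A C) (h_ext c d) + gain A C 1 (nxt_of h_block h_ext c d) (nxt_of h_block h_ext d c) = gain C (A + 2 * C) 1 c d" for c d
      by (cases c; cases d) (auto simp: nxt_of_def field_simps)
    have 3: "excess A C 1 + wt A C N0 = excess C (A + 2 * C) 1"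
      by (simp add: excess_def field_simps)
    have "h_block c \<noteq> []" for c by (cases c) auto
    then have "length x' < length x" using d(4) by blast
    note less.hyps[OF this on_track_step[OF tr] d(1-3), unfolded d(5)[unfolded 1]]
    then show ?thesis using d(6) unfolding 1 2 3 by linarith
  qed
qed

section \<open>Repetitions in the binary word\<close>

abbreviation "fh_lang \<equiv> image_lang f_block h_lang"

lemma N0_in_h_lang: "[N0] \<in> h_lang"
  unfolding h_lang_def h_iterate_def by (auto intro!: exI[of _ 0])

lemma extendable_fh_lang: "extendable fh_lang"
  using extendable_image_lang extendable_h_lang factorial_h_lang N0_in_h_lang by blast

lemma sublist_zero_free_f:
  "sublist q (subst f_block v @ [N0]) \<Longrightarrow> N0 \<notin> set q \<Longrightarrow> q \<in> {[], [N1], [N1, N1]}"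
proof (induction v)
  case (Cons c v)
  obtain w where "subst f_block v @ [N0] = N0 # w" using subst_snoc_hd by blast
  then show ?case using Cons
    by (cases c) (auto simp: sublist_Cons_right prefix_Cons)
qed (auto simp: sublist_Cons_right prefix_Cons)

text \<open>With all weights 1, one desubstitution by \<open>f\<close> leads to the pair
  \<open>(1, 3)\<close>. A marker-free excess has at most two letters, and period 1 with excess 11
  would give 111.\<close>

lemma fh_lang_power:
  assumes xz: "x @ z \<in> fh_lang" "x @ z = z @ t" "x \<noteq> []"
  shows "real (length z) \<le> (1 + sqrt 2 / 2) * real (length x)"
proof (cases "N0 \<in> set z")
  case True
  obtain a b where ab: "a # x @ z @ [b] \<in> fh_lang"
    using xz extendable_fh_lang unfolding extendable_def by (metis Nil_is_append_conv append.assoc)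
  have nxt: "nxt_of f_block f_ext c d \<noteq> nxt_of f_block f_ext d c" if "c \<noteq> d" for c d
    using that by (cases c; cases d) (auto simp: nxt_of_def)
  have tr: "on_track 1 3" using sqrt2_bounds by (simp add: on_track_def abs_le_iff)
  have "0 \<le> (1::real)" "0 \<le> (0::real)" "(0::real) = 0" by auto
  from f.desubst_power[of h_lang "\<lambda>_. 1" "\<lambda>_ _. 0", OF factorial_h_lang extendable_h_lang this nxt ab xz(2,3) True, of 0]
  obtain a' x' z' t' b' where d: "a' # x' @ z' @ [b'] \<in> h_lang" "x' @ z' = z' @ t'" "x' \<noteq> []"
    "weight (\<lambda>a. 1 + weight (\<lambda>_. 1) (f_block a)) x' = weight (\<lambda>_. 1) x"
    "weight (\<lambda>_. 1) z + 0 + 0 + 0 \<le> weight (\<lambda>a. 1 + weight (\<lambda>_. 1) (f_block a)) z' + (0 + 1)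
       + (weight (\<lambda>_. 1) (f_ext a' (last x')) + 0) + (weight (\<lambda>_. 1) (f_ext b' (hd t')) + 0)"
    by blast
  have 1: "(\<lambda>a. 1 + weight (\<lambda>_. 1) (f_block a)) = wt 1 3"
    by (rule ext, case_tac a) auto
  have 2: "weight (\<lambda>_. 1) (f_ext c d) = gain 1 3 1 c d" for c d
    by (cases c; cases d) auto
  have len: "weight (\<lambda>_. 1) v = real (length v)" for v :: "letter list" by (induction v) auto
  have "weight (wt 1 3) z' + excess 1 3 1 + gain 1 3 1 a' (last x') + gain 1 3 1 b' (hd t') \<le> (1 + sqrt 2 / 2) * weight (wt 1 3) x'"
    using h_lang_power[OF tr d(1-3)] .
  then show ?thesis using d(4,5)[unfolded 1 2] unfolding len by (simp add: excess_def)
next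
  case False
  have "z \<in> fh_lang" using xz(1) factorialD1[OF factorial_image_lang] by blast
  then have z: "z \<in> {[], [N1], [N1, N1]}" using False sublist_zero_free_f unfolding image_lang_def by blast
  have "\<not> (length x = 1 \<and> z = [N1, N1])"
  proof
    assume h: "length x = 1 \<and> z = [N1, N1]"
    then obtain c where "x = [c]" by (auto simp: length_Suc_conv)
    then have "[N1, N1, N1] \<in> fh_lang" using xz h by auto
    then show False using sublist_zero_free_f unfolding image_lang_def by fastforce
  qed
  then have "length z \<le> 1 \<and> length x \<ge> 1 \<or> length z \<le> 2 \<and> length x \<ge> 2"
    using z xz(3) by (cases "length x = 1") (auto simp: Suc_le_eq numeral_2_eq_2 neq_Nil_conv)
  moreover have "17 / 10 * real (length x) \<le> (1 + sqrt 2 / 2) * real (length x)"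
    using sqrt2_bounds by (intro mult_right_mono) auto
  ultimately show ?thesis by auto
qed

section \<open>Richness of the fixed point\<close>

definition return_closed :: "'a list \<Rightarrow> bool" where
  "return_closed r \<longleftrightarrow> palindromic_returns {r}"

lemma return_closedD:
  assumes "return_closed r" "palindrome p" "p \<noteq> []" "prefix p r" "suffix p r"
    "\<And>s t. r = s @ p @ t \<Longrightarrow> s = [] \<or> t = []"
  shows "palindrome r"
  using palindromic_returnsD[of "{r}" r p] assms unfolding return_closed_def by blast

lemma return_closedI:
  assumes "\<And>p. palindrome p \<Longrightarrow> p \<noteq> [] \<Longrightarrow> prefix p r \<Longrightarrow> suffix p r \<Longrightarrow>
     (\<And>s t. r = s @ p @ t \<Longrightarrow> s = [] \<or> t = []) \<Longrightarrow> palindrome r"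
  shows "return_closed r"
  unfolding return_closed_def palindromic_returns_def using assms by blast

lemma palindromic_returns_iff: "palindromic_returns L \<longleftrightarrow> (\<forall>r\<in>L. return_closed r)"
  unfolding return_closed_def palindromic_returns_def by blast

text \<open>True of \<open>f\<close> and \<open>h\<close>, though not of \<open>g\<close>: blocks
  are powers of one letter, and a nonempty suffix of a block determines its letter up to confusing
  \<open>N1\<close> with \<open>N2\<close>.\<close>

locale unary_code = block_code +
  assumes unary: "\<exists>n x. p a = replicate n x"
    and context_cases: "s \<noteq> [] \<Longrightarrow> suffix s (p a) \<Longrightarrow> {b. suffix s (p b)} = {a} \<or> {b. suffix s (p b)} = {N1, N2}"
begin

text \<open>These are the words to which induction is applied: the preimage \<open>R\<close> of the
  complete blocks of \<open>r\<close>, or, if \<open>r\<close> also shows cut-off blocks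
  \<open>s\<close> and \<open>rev s\<close> at its ends, \<open>R\<close> framed by a letter
  standing for them.\<close>

definition smaller :: "letter list \<Rightarrow> letter list \<Rightarrow> bool" where
  "smaller u r \<longleftrightarrow> (\<exists>R s c. r = s @ \<phi> R @ N0 # rev s \<and> (u = R \<or> s \<noteq> [] \<and> u = c # R @ [c]))"

lemma suffix_block_prefix: "suffix s (p a) \<Longrightarrow> prefix (rev s) (p a)"
  using block_palindrome[of a] by (metis suffix_to_prefix)

lemma context_right:
  assumes "\<phi> V @ [N0] = N0 # rev s @ T" "s \<noteq> []" "N0 \<notin> set s"
  shows "\<exists>b V'. V = b # V' \<and> suffix s (p b)"
proof -
  have "V \<noteq> []" using assms by auto
  then obtain b V' where V: "V = b # V'" by (cases V) auto
  obtain w where w: "\<phi> V' @ [N0] = N0 # w" using subst_snoc_hd by blast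
  have eq: "p b @ N0 # w = rev s @ T" using assms(1) V w by simp
  have "prefix (p b @ [N0]) (rev s @ T)" unfolding eq[symmetric] by (auto simp: Sublist.prefix_def)
  moreover have "prefix (rev s) (rev s @ T)" by simp
  ultimately have "prefix (rev s) (p b @ [N0]) \<or> prefix (p b @ [N0]) (rev s)" using prefix_same_cases by blast
  then have "prefix (rev s) (p b)"
  proof
    assume "prefix (p b @ [N0]) (rev s)"
    then obtain zs where "rev s = p b @ N0 # zs" by (auto simp: Sublist.prefix_def)
    then have "set s = set (p b @ N0 # zs)" by (metis set_rev)
    then show ?thesis using assms(3) by simp
  next
    assume "prefix (rev s) (p b @ [N0])"
    then have "rev s = p b @ [N0] \<or> prefix (rev s) (p b)" by (simp only: prefix_snoc)
    moreover have "rev s \<noteq> p b @ [N0]" using assms(3) by (metis in_set_conv_decomp set_rev)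
    ultimately show ?thesis by blast
  qed
  then have "suffix s (p b)" using block_palindrome[of b] by (metis suffix_to_prefix rev_rev_ident)
  then show ?thesis using V by blast
qed

lemma context_left:
  assumes "S @ s = \<phi> V" "s \<noteq> []" "N0 \<notin> set s"
  shows "\<exists>b V'. V = V' @ [b] \<and> suffix s (p b)"
proof -
  have "V \<noteq> []" using assms by auto
  then obtain b V' where V: "V = V' @ [b]" by (metis rev_exhaust)
  have eq: "S @ s = \<phi> V' @ N0 # p b" using assms(1) V by simp
  have "suffix s (S @ s)" "suffix (N0 # p b) (S @ s)" by (auto simp: eq Sublist.suffix_def) (metis eq)
  then have "suffix s (N0 # p b) \<or> suffix (N0 # p b) s" using suffix_same_cases by blast
  then have "suffix s (p b)"
  proof
    assume "suffix (N0 # p b) s"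
    then show ?thesis using assms(3) by (auto simp: Sublist.suffix_def)
  next
    assume "suffix s (N0 # p b)"
    then show ?thesis using assms(3) by (auto simp: suffix_Cons)
  qed
  then show ?thesis using V by blast
qed

lemma zero_split_unique:
  assumes "u @ N0 # x = v @ N0 # y" "N0 \<notin> set x" "N0 \<notin> set y"
  shows "u = v \<and> x = y"
proof -
  have "rev x @ N0 # rev u = rev y @ N0 # rev v" using arg_cong[OF assms(1), of rev] by simp
  then show ?thesis using marker_free_prefix_eq assms(2,3) by (metis rev_rev_ident set_rev)
qed

lemma palindrome_frame: "rev R = R \<Longrightarrow> palindrome (s @ \<phi> R @ N0 # rev s)"
proof -
  assume "rev R = R"
  have "rev (s @ (\<phi> R @ [N0]) @ rev s) = s @ rev (\<phi> R @ [N0]) @ rev s" by simp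
  then show ?thesis unfolding palindrome_def rev_subst \<open>rev R = R\<close> by simp
qed

text \<open>Write \<open>q\<close> as \<open>s @ \<phi> v' @ N0 # rev s\<close> and \<open>r\<close>
  likewise with \<open>R\<close>; then \<open>v'\<close> is a palindromic prefix and suffix of
  \<open>R\<close>, and \<open>R\<close> has to be a palindrome. Apart from the easy case
  \<open>q = [N0]\<close>, either \<open>R\<close> is a complete return to \<open>v'\<close>, or
  both are framed by the letter \<open>a\<close> whose block was cut off to \<open>s\<close>, and
  the framed words form a complete return.\<close>

lemma return_image_marker:
  assumes r: "r \<in> image_lang p h_lang" and q: "palindrome q" "q \<noteq> []" "prefix q r" "suffix q r"
    and two: "\<And>s t. r = s @ q @ t \<Longrightarrow> s = [] \<or> t = []"
    and q0: "N0 \<in> set q"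
    and IH: "\<And>u. u \<in> h_lang \<Longrightarrow> smaller u r \<Longrightarrow> return_closed u"
  shows "palindrome r"
proof -
  obtain v0 S T where v0: "v0 \<in> h_lang" "\<phi> v0 @ [N0] = S @ r @ T"
    using r unfolding image_lang_def sublist_def by blast
  obtain s q1 where s: "q = s @ N0 # q1" "N0 \<notin> set s" using q0 by (meson split_list_first)
  have "N0 \<in> set (N0 # q1)" by simp
  then obtain m s1 where m: "N0 # q1 = m @ N0 # s1" "N0 \<notin> set s1" by (meson split_list_last)
  have "rev q = q" using q(1) by (simp add: palindrome_def)
  have "rev s1 = s"
  proof -
    have "rev s1 @ N0 # (rev m @ rev s) = rev q" using s m by simp
    also have "\<dots> = s @ N0 # q1" using \<open>rev q = q\<close> s by simp
    finally show ?thesis using marker_free_prefix_eq[of "rev s1" _ s] s(2) m(2) by simp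
  qed
  then have qd: "q = s @ m @ N0 # rev s" using s m by auto
  have mhd: "\<exists>w. m @ N0 # Y = N0 # w" for Y using m(1) by (cases m) auto
  obtain t where t: "r = q @ t" using q(3) by (auto simp: Sublist.prefix_def)
  obtain u where u: "r = u @ q" using q(4) by (auto simp: Sublist.suffix_def)
  have "N0 \<in> set (N0 # q1 @ t)" by simp
  then obtain \<rho> s2 where \<rho>: "N0 # q1 @ t = \<rho> @ N0 # s2" "N0 \<notin> set s2" by (meson split_list_last)
  have \<rho>hd: "\<exists>w. \<rho> @ N0 # Y = N0 # w" for Y using \<rho>(1) by (cases \<rho>) auto
  have "r = (s @ \<rho>) @ N0 # s2" using t s \<rho> by simp
  moreover have "r = (u @ s @ m) @ N0 # rev s" using u qd by simp
  ultimately have eq: "s @ \<rho> = u @ s @ m" "s2 = rev s" using zero_split_unique[of "s @ \<rho>" s2 "u @ s @ m" "rev s"] \<rho>(2) s(2) by auto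
  have rd: "r = s @ \<rho> @ N0 # rev s" using t s \<rho> eq by simp
  \<comment> \<open>Three parsings of \<open>v0\<close> follow: around the core of \<open>r\<close>,
    around the first and around the last occurrence of \<open>q\<close>.\<close>
  have o1: "\<phi> v0 @ [N0] = (S @ s) @ \<rho> @ N0 # (rev s @ T)" using v0(2) rd by simp
  obtain V1 R V2 where V: "v0 = V1 @ R @ V2" "S @ s = \<phi> V1" "\<rho> = \<phi> R" "\<phi> V2 @ [N0] = N0 # rev s @ T"
    using split_word[OF o1 \<rho>hd] by blast
  have o2: "\<phi> v0 @ [N0] = (S @ s) @ m @ N0 # (rev s @ t @ T)" using v0(2) t qd by simp
  obtain V1' v' V2' where V': "v0 = V1' @ v' @ V2'" "S @ s = \<phi> V1'" "m = \<phi> v'" "\<phi> V2' @ [N0] = N0 # rev s @ t @ T"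
    using split_word[OF o2 mhd] by blast
  have "V1' = V1" using V(2) V'(2) by simp
  have o3: "\<phi> v0 @ [N0] = (S @ u @ s) @ m @ N0 # (rev s @ T)" using v0(2) u qd by simp
  obtain V3 v'' V4 where V'': "v0 = V3 @ v'' @ V4" "S @ u @ s = \<phi> V3" "m = \<phi> v''" "\<phi> V4 @ [N0] = N0 # rev s @ T"
    using split_word[OF o3 mhd] by blast
  have "v'' = v'" using V''(3) V'(3) by simp
  have "\<phi> V4 @ [N0] = \<phi> V2 @ [N0]" using V(4) V''(4) by simp
  then have "V4 = V2" by simp
  have RV: "R @ V2 = v' @ V2'" using V(1) V'(1) \<open>V1' = V1\<close> by simp
  have VR: "V1 @ R = V3 @ v'" using V(1) V''(1) \<open>v'' = v'\<close> \<open>V4 = V2\<close> by simp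
  have "length r \<ge> length q" using t by simp
  then have le: "length (\<phi> v') \<le> length (\<phi> R)" using rd qd V(3) V'(3) by simp
  have le': "length v' \<le> length R"
  proof (rule ccontr)
    assume "\<not> length v' \<le> length R"
    moreover have "prefix R (v' @ V2')" "prefix v' (v' @ V2')" using RV by (auto intro: prefixI) (metis prefixI)
    ultimately have "prefix R v'" using prefix_length_prefix[of R "v' @ V2'" v'] by simp
    then obtain d where "v' = R @ d" by (auto simp: Sublist.prefix_def)
    moreover have "d \<noteq> []" using calculation \<open>\<not> length v' \<le> length R\<close> by auto
    ultimately show False using le by (cases d) auto
  qed
  have pre: "prefix v' R"
  proof -
    have "prefix R (R @ V2)" "prefix v' (R @ V2)" unfolding RV by (auto intro: prefixI) (metis RV prefixI)
    then show ?thesis using le' prefix_length_prefix by blast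
  qed
  have suf: "suffix v' R"
  proof -
    have "suffix R (V1 @ R)" "suffix v' (V1 @ R)" by (auto simp: suffixI VR) (metis VR suffixI)
    then show ?thesis using le' suffix_length_suffix by blast
  qed
  have pv: "rev v' = v'"
  proof -
    have "rev (m @ [N0]) = m @ [N0]" using \<open>rev q = q\<close> unfolding qd by simp
    then have "palindrome (\<phi> v' @ [N0])" using V'(3) by (simp add: palindrome_def)
    then show ?thesis using palindrome_subst_iff by (simp add: palindrome_def)
  qed
  have RM: "R \<in> h_lang" using v0(1) V(1) factorialD[OF factorial_h_lang] by blast
  \<comment> \<open>An occurrence of \<open>v'\<close> inside \<open>R\<close> whose neighbouring
    blocks continue it by \<open>s\<close> and \<open>rev s\<close> would be an occurrence of
    \<open>q\<close> inside \<open>r\<close>.\<close>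
  have star: False if XY: "R = X @ v' @ Y" "X \<noteq> []" "Y \<noteq> []" "suffix s (p (last X))" "suffix s (p (hd Y))" for X Y
  proof -
    obtain X' where X': "X = X' @ [last X]" using XY(2) by (metis append_butlast_last_id)
    obtain Y' where Y': "Y = hd Y # Y'" using XY(3) by (metis list.collapse)
    obtain g where g: "p (last X) = g @ s" using XY(4) by (auto simp: Sublist.suffix_def)
    obtain g' where g': "p (hd Y) = rev s @ g'" using suffix_block_prefix[OF XY(5)] by (auto simp: Sublist.prefix_def)
    have "\<phi> X = \<phi> X' @ N0 # g @ s" by (subst X') (simp add: g)
    moreover have "\<phi> Y = N0 # rev s @ g' @ \<phi> Y'" by (subst Y') (simp add: g')
    ultimately have "\<phi> R = \<phi> X' @ N0 # g @ s @ m @ N0 # rev s @ g' @ \<phi> Y'" using XY(1) V'(3) by simp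
    then have "r = (s @ \<phi> X' @ N0 # g) @ q @ (g' @ \<phi> Y' @ N0 # rev s)" using rd V(3) qd by simp
    from two[OF this] show False by simp
  qed
  have sm: "smaller R r" unfolding smaller_def using rd V(3) by blast
  have "rev R = R"
  \<comment> \<open>If the right context is automatic, \<open>star\<close> excludes inner
    occurrences of \<open>v'\<close> and induction applies to \<open>R\<close> itself; otherwise
    framing letters must record the context.\<close>
  proof (cases "v' \<noteq> [] \<and> (\<forall>X Y. R = X @ v' @ Y \<longrightarrow> X \<noteq> [] \<longrightarrow> Y \<noteq> [] \<longrightarrow> suffix s (p (last X)) \<and> suffix s (p (hd Y)))")
    case True
    have "palindrome R"
    proof (rule return_closedD[OF IH[OF RM sm] _ _ pre suf])
      fix X Y assume "R = X @ v' @ Y"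
      then show "X = [] \<or> Y = []" using star[of X Y] True by blast
    qed (use pv True in \<open>auto simp: palindrome_def\<close>)
    then show ?thesis by (simp add: palindrome_def)
  next
    case nctx: False
    show ?thesis
    proof (cases "s = []")
      case True
      then have v'e: "v' = []" using nctx by auto
      have "length R \<le> 1"
      proof (rule ccontr)
        assume "\<not> length R \<le> 1"
        then obtain a b R' where R': "R = [a] @ v' @ (b # R')" using v'e
          by (cases R rule: remdups_adj.cases) auto
        then show False using star[OF R'] True by simp
      qed
      then show ?thesis by (cases R) auto
    next
      case sne: False
      obtain a W1 where a: "V1 = W1 @ [a]" "suffix s (p a)" using context_left[OF V(2) sne s(2)] by blast
      obtain b W2 where b: "V2 = b # W2" "suffix s (p b)" using context_right[OF V(4) sne s(2)] by blast
      obtain b' W2' where b': "V2' = b' # W2'" "suffix s (p b')" using context_right[OF V'(4) sne s(2)] by blast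
      obtain a' W3 where a': "V3 = W3 @ [a']" "suffix s (p a')"
        using context_left[of "S @ u" s V3] V''(2) sne s(2) by auto
      have m1: "W1 @ (a # v' @ [b']) @ W2' \<in> h_lang" using v0(1) V'(1) \<open>V1' = V1\<close> a b' by simp
      have m2: "W3 @ (a' # v' @ [b]) @ W2 \<in> h_lang" using v0(1) V''(1) \<open>v'' = v'\<close> \<open>V4 = V2\<close> a' b by simp
      have in1: "d = a" if "suffix s (p d)" "{b. suffix s (p b)} = {a}" for d
      proof -
        have "d \<in> {b. suffix s (p b)}" using that(1) by simp
        then show ?thesis using that(2) by simp
      qed
      have in12: "d \<in> {N1, N2}" if "suffix s (p d)" "{b. suffix s (p b)} = {N1, N2}" for d
        using that by blast
      \<comment> \<open>When \<open>s\<close> fits both \<open>N1\<close> and \<open>N2\<close>, the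
        framing letters must be \<open>N2\<close>. If \<open>v'\<close> began with
        \<open>N0\<close>, its neighbours would be \<open>N1\<close> or \<open>N2\<close> anyway and
        the context automatic; otherwise the only adjacent pair formed from \<open>N1\<close> and
        \<open>N2\<close> is the square of \<open>N2\<close>.\<close>
      have nb: "c = N2 \<and> d = N2" if mem: "s' @ (c # v' @ [d]) @ t' \<in> h_lang" and cd: "c \<in> {N1, N2}" "d \<in> {N1, N2}"
        and S12: "{b. suffix s (p b)} = {N1, N2}" for s' c d t'
      proof (cases v')
        case Nil
        have "s' @ c # d # t' \<in> h_lang" using mem Nil by simp
        then show ?thesis using h_lang_pair cd by blast
      next
        case (Cons e v1)
        then have e: "s' @ c # e # (v1 @ [d] @ t') \<in> h_lang" using mem by simp
        have ve: "v' = rev v1 @ [e]" using pv Cons by (metis rev.simps(2))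
        then have e2: "(s' @ c # rev v1) @ e # d # t' \<in> h_lang" using mem by simp
        have "e \<noteq> N0"
        proof
          assume e0: "e = N0"
          have "suffix s (p (last X)) \<and> suffix s (p (hd Y))" if XY: "R = X @ v' @ Y" "X \<noteq> []" "Y \<noteq> []" for X Y
          proof -
            obtain X' where X': "X = X' @ [last X]" using XY(2) by (metis append_butlast_last_id)
            obtain Y' where Y': "Y = hd Y # Y'" using XY(3) by (metis list.collapse)
            have "X' @ last X # e # (v1 @ Y) \<in> h_lang" using RM XY(1) X' Cons by (metis append.assoc append_Cons append_Nil)
            from h_lang_pair[OF this] have "last X \<noteq> N0" using e0 by auto
            have "(X @ rev v1) @ e # hd Y # Y' \<in> h_lang" using RM XY(1) Y' ve by (metis append.assoc append_Cons append_Nil)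
            from h_lang_pair[OF this] have "hd Y \<noteq> N0" using e0 by auto
            have "last X \<in> {b. suffix s (p b)}" "hd Y \<in> {b. suffix s (p b)}"
              unfolding S12 using \<open>last X \<noteq> N0\<close> \<open>hd Y \<noteq> N0\<close> letter.exhaust by blast+
            then show ?thesis by blast
          qed
          then show False using nctx Cons by blast
        qed
        then show ?thesis using h_lang_pair[OF e] h_lang_pair[OF e2] cd by auto
      qed
      have ctx: "{b. suffix s (p b)} = {a} \<or> {b. suffix s (p b)} = {N1, N2}" using context_cases[OF sne a(2)] .
      have "a = b"
        using ctx
      proof
        assume S12: "{b. suffix s (p b)} = {N1, N2}"
        show "a = b"
          using nb[OF m1 in12[OF a(2) S12] in12[OF b'(2) S12] S12] nb[OF m2 in12[OF a'(2) S12] in12[OF b(2) S12] S12] by simp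
      qed (use in1[OF b(2)] in simp)
      then have uM: "a # R @ [a] \<in> h_lang"
        using v0(1) V(1) a b factorialD[OF factorial_h_lang, of W1 "a # R @ [a]" W2] by simp
      have "palindrome (a # R @ [a])"
      proof (rule return_closedD[OF IH[OF uM]])
        show "smaller (a # R @ [a]) r" unfolding smaller_def using rd V(3) sne by blast
        show "palindrome (a # v' @ [a])" using pv by (simp add: palindrome_def)
        obtain x where x: "R = v' @ x" using pre by (auto simp: Sublist.prefix_def)
        obtain y where y: "R = y @ v'" using suf by (auto simp: Sublist.suffix_def)
        have "b' = a"
          using ctx
        proof
          assume S12: "{b. suffix s (p b)} = {N1, N2}"
          show "b' = a" using nb[OF m1 in12[OF a(2) S12] in12[OF b'(2) S12] S12] by simp
        qed (use in1[OF b'(2)] in simp)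
        moreover have "x @ V2 = b' # W2'" using RV x b' by simp
        ultimately have "\<exists>x'. x @ [a] = a # x'" using b \<open>a = b\<close> by (cases x) auto
        then show "prefix (a # v' @ [a]) (a # R @ [a])" unfolding x by (auto simp: Sublist.prefix_def)
        have "a' = a"
          using ctx
        proof
          assume S12: "{b. suffix s (p b)} = {N1, N2}"
          show "a' = a"
            using nb[OF m1 in12[OF a(2) S12] in12[OF b'(2) S12] S12] nb[OF m2 in12[OF a'(2) S12] in12[OF b(2) S12] S12] by simp
        qed (use in1[OF a'(2)] in simp)
        moreover have "V1 @ y = W3 @ [a']" using VR y a' by simp
        ultimately have "\<exists>y'. a # y = y' @ [a]" using a by (cases y rule: rev_cases) auto
        then obtain y' where "a # y = y' @ [a]" by blast
        then have "a # R @ [a] = y' @ (a # v' @ [a])" unfolding y by simp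
        then show "suffix (a # v' @ [a]) (a # R @ [a])" by (metis suffixI)
        fix X Y assume XY: "a # R @ [a] = X @ (a # v' @ [a]) @ Y"
        show "X = [] \<or> Y = []"
        proof (rule ccontr)
          assume n: "\<not> (X = [] \<or> Y = [])"
          then obtain X1 where X1: "X = a # X1" using XY by (cases X) auto
          obtain Y1 where Y1: "Y = Y1 @ [a]"
          proof -
            obtain Y1 z where "Y = Y1 @ [z]" using n by (metis rev_exhaust)
            moreover then have "z = a" using XY by (metis append_assoc append_is_Nil_conv last_ConsR last_appendR last_snoc not_Cons_self2)
            ultimately show ?thesis using that by blast
          qed
          have "R = (X1 @ [a]) @ v' @ (a # Y1)" using XY X1 Y1 by simp
          from star[OF this] show False using a(2) by simp
        qed
      qed simp
      then show ?thesis by (simp add: palindrome_def)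
    qed
  qed
  then show ?thesis using palindrome_frame[of R s] rd V(3) by simp
qed

text \<open>\<open>r\<close> is a power of one letter, or its parts outside the outermost markers
  are exactly \<open>q\<close>. If \<open>q\<close> determines its letter \<open>a\<close>, then
  \<open>a # R @ [a]\<close> is a complete return to \<open>a\<close>; if \<open>q\<close> fits both
  \<open>N1\<close> and \<open>N2\<close>, neither occurs in \<open>R\<close>, which is then a power
  of \<open>N0\<close>.\<close>

lemma return_image_marker_free:
  assumes r: "r \<in> image_lang p h_lang" and q: "palindrome q" "q \<noteq> []" "prefix q r" "suffix q r"
    and two: "\<And>s t. r = s @ q @ t \<Longrightarrow> s = [] \<or> t = []"
    and q0: "N0 \<notin> set q"
    and IH: "\<And>u. u \<in> h_lang \<Longrightarrow> smaller u r \<Longrightarrow> return_closed u"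
  shows "palindrome r"
proof -
  obtain v0 S T where v0: "v0 \<in> h_lang" "\<phi> v0 @ [N0] = S @ r @ T"
    using r unfolding image_lang_def sublist_def by blast
  have rq: "rev q = q" using q(1) by (simp add: palindrome_def)
  obtain t where t: "r = q @ t" using q(3) by (auto simp: Sublist.prefix_def)
  obtain u where u: "r = u @ q" using q(4) by (auto simp: Sublist.suffix_def)
  have in_block: "\<exists>n x. w = replicate n x" if w: "\<phi> v @ [N0] = A @ w @ B" "N0 \<notin> set w" for v A w B
    using w(1)
  proof (induction v arbitrary: A)
    case Nil
    then have "w = []" using w(2) by (cases A; cases w) auto
    then show ?case by (metis replicate_0)
  next
    case (Cons c v)
    show ?case
    proof (cases A)
      case Nil
      then have "w = []" using Cons.prems w(2) by (cases w) auto
      then show ?thesis by (metis replicate_0)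
    next
      case (Cons y A')
      obtain X where X: "\<phi> v @ [N0] = N0 # X" using subst_snoc_hd by blast
      have eq: "p c @ (\<phi> v @ [N0]) = A' @ w @ B" using Cons.prems Cons by simp
      show ?thesis
      proof (cases "length (p c) \<le> length A'")
        case True
        then obtain A'' where "A' = p c @ A''" using eq
          by (metis append_eq_append_conv_if append_take_drop_id)
        then have "\<phi> v @ [N0] = A'' @ w @ B" using eq by simp
        then show ?thesis by (rule Cons.IH)
      next
        case False
        then obtain d where d: "p c = A' @ d" using eq
          by (metis append_eq_append_conv_if append_take_drop_id nle_le)
        then have "d @ N0 # X = w @ B" using eq X by simp
        then have "prefix w (d @ [N0]) \<or> prefix (d @ [N0]) w"
          by (metis append.assoc append_Cons append_Nil prefixI prefix_same_cases)
        then have "prefix w d"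
        proof
          assume "prefix (d @ [N0]) w"
          then show ?thesis using w(2) by (auto simp: Sublist.prefix_def)
        next
          assume "prefix w (d @ [N0])"
          then show ?thesis using w(2) by (auto simp: prefix_snoc)
        qed
        then have sl: "sublist w (p c)" unfolding d by (metis prefix_imp_sublist sublist_appendI sublist_append_leftI sublist_order.order.trans)
        obtain n x where "p c = replicate n x" using unary by blast
        then have "\<forall>y\<in>set w. y = x" using set_mono_sublist[OF sl] by auto
        then have "w = replicate (length w) x" by (metis replicate_eqI)
        then show ?thesis by blast
      qed
    qed
  qed
  show ?thesis
  proof (cases "N0 \<in> set r")
    case False
    then obtain n x where "r = replicate n x" using in_block v0(2) by blast
    then show ?thesis by (simp add: palindrome_def)
  next
    case True
    obtain s1 r1 where s1: "r = s1 @ N0 # r1" "N0 \<notin> set s1" using True by (meson split_list_first)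
    have "N0 \<in> set (N0 # r1)" by simp
    then obtain \<rho> s2 where \<rho>: "N0 # r1 = \<rho> @ N0 # s2" "N0 \<notin> set s2" by (meson split_list_last)
    have \<rho>hd: "\<exists>w. \<rho> @ N0 # Y = N0 # w" for Y using \<rho>(1) by (cases \<rho>) auto
    have rd: "r = s1 @ \<rho> @ N0 # s2" using s1 \<rho> by simp
    have "s1 = q"
    proof -
      have "prefix q (s1 @ N0 # r1)" "prefix s1 (s1 @ N0 # r1)" using q(3) s1 by auto
      then have "prefix q s1 \<or> prefix s1 q" using prefix_same_cases by blast
      moreover have "prefix q s1" if pre: "prefix s1 q"
      proof -
        obtain d where d: "q = s1 @ d" using pre by (auto simp: Sublist.prefix_def)
        have "d @ t = N0 # r1" using t s1 d by simp
        then have "d = []" using q0 d by (cases d) auto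
        then show ?thesis using d by simp
      qed
      ultimately have "prefix q s1" by blast
      then obtain d where d: "s1 = q @ d" by (auto simp: Sublist.prefix_def)
      obtain n x where n: "s1 = replicate n x" using in_block[of v0 S s1 "N0 # r1 @ T"] v0(2) s1 by auto
      \<comment> \<open>A longer run of one letter would contain \<open>q\<close> shifted by one
        place, an inner occurrence.\<close>
      have "d = []"
      proof (rule ccontr)
        assume "d \<noteq> []"
        then obtain y d' where yd: "d = y # d'" by (cases d) auto
        have all: "\<forall>z\<in>set s1. z = x" using n by simp
        then have d': "d = x # d'" and "\<forall>y\<in>set q. y = x" using d yd by auto
        then have "q @ [x] = [x] @ q" using \<open>\<forall>y\<in>set q. y = x\<close> by (metis append_Cons append_Nil replicate_append_same replicate_eqI)
        then have "r = [x] @ q @ (d' @ N0 # r1)" using s1 d d' by (metis append.assoc append_Cons append_Nil)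
        from two[OF this] show False by simp
      qed
      then show ?thesis using d by simp
    qed
    have "s2 = q"
    proof -
      have "suffix q (s1 @ \<rho> @ N0 # s2)" "suffix s2 (s1 @ \<rho> @ N0 # s2)" using q(4) rd by (auto simp: Sublist.suffix_def)
      then have "suffix q s2 \<or> suffix s2 q" using suffix_same_cases by blast
      moreover have "suffix q s2" if suf: "suffix s2 q"
      proof -
        obtain d where d: "q = d @ s2" using suf by (auto simp: Sublist.suffix_def)
        have "(u @ d) @ s2 = (s1 @ \<rho> @ [N0]) @ s2" using u rd d by simp
        then have "u @ d = (s1 @ \<rho>) @ [N0]" by simp
        then have "d = []" using q0 d by (cases d rule: rev_cases) auto
        then show ?thesis using d by simp
      qed
      ultimately have "suffix q s2" by blast
      then obtain d where d: "s2 = d @ q" by (auto simp: Sublist.suffix_def)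
      have "\<phi> v0 @ [N0] = (S @ s1 @ \<rho> @ [N0]) @ s2 @ T" using v0(2) rd by simp
      then obtain n x where n: "s2 = replicate n x" using in_block \<rho>(2) by blast
      have "d = []"
      proof (rule ccontr)
        assume "d \<noteq> []"
        then obtain d' y where d': "d = d' @ [y]" by (metis rev_exhaust)
        have "\<forall>z\<in>set s2. z = x" using n by simp
        then have "y = x" "\<forall>z\<in>set q. z = x" using d d' by auto
        then have "[x] @ q = q @ [x]" by (metis append_Cons append_Nil replicate_append_same replicate_eqI)
        then have "r = (s1 @ \<rho> @ N0 # d') @ q @ [x]" using rd d d' \<open>y = x\<close> by simp
        from two[OF this] show False by simp
      qed
      then show ?thesis using d by simp
    qed
    have rd': "r = q @ \<rho> @ N0 # rev q" using rd \<open>s1 = q\<close> \<open>s2 = q\<close> rq by simp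
    have o1: "\<phi> v0 @ [N0] = (S @ q) @ \<rho> @ N0 # (rev q @ T)" using v0(2) rd' by simp
    obtain V1 R V2 where V: "v0 = V1 @ R @ V2" "S @ q = \<phi> V1" "\<rho> = \<phi> R" "\<phi> V2 @ [N0] = N0 # rev q @ T"
      using split_word[OF o1 \<rho>hd] by blast
    obtain a W1 where a: "V1 = W1 @ [a]" "suffix q (p a)" using context_left[OF V(2) q(2) q0] by blast
    obtain b W2 where b: "V2 = b # W2" "suffix q (p b)" using context_right[OF V(4) q(2) q0] by blast
    have star: "\<not> suffix q (p d)" if d: "d \<in> set R" for d
    proof
      assume "suffix q (p d)"
      then obtain g where g: "p d = g @ q" by (auto simp: Sublist.suffix_def)
      obtain X Y where "R = X @ d # Y" using d by (meson split_list)
      then have "r = (q @ \<phi> X @ N0 # g) @ q @ (\<phi> Y @ N0 # rev q)" using rd' V(3) g by simp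
      from two[OF this] show False by simp
    qed
    have "rev R = R"
      using context_cases[OF q(2) a(2)]
    proof
      assume sa: "{b. suffix q (p b)} = {a}"
      moreover have "b \<in> {b. suffix q (p b)}" using b(2) by simp
      ultimately have "a = b" by simp
      then have uM: "a # R @ [a] \<in> h_lang"
        using v0(1) V(1) a b factorialD[OF factorial_h_lang, of W1 "a # R @ [a]" W2] by simp
      have "palindrome (a # R @ [a])"
      proof (rule return_closedD[OF IH[OF uM], of "[a]"])
        show "smaller (a # R @ [a]) r" unfolding smaller_def using rd' V(3) q(2) by blast
        show "suffix [a] (a # R @ [a])" by (metis append_Cons suffixI)
        fix X Y assume XY: "a # R @ [a] = X @ [a] @ Y"
        show "X = [] \<or> Y = []"
        proof (rule ccontr)
          assume n: "\<not> (X = [] \<or> Y = [])"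
          then obtain X1 where X1: "X = a # X1" using XY by (cases X) auto
          obtain Y1 z where Y1: "Y = Y1 @ [z]" using n by (metis rev_exhaust)
          have "R @ [a] = (X1 @ a # Y1) @ [z]" using XY X1 Y1 by simp
          then have "a \<in> set R" by simp
          then show False using star a(2) by blast
        qed
      qed (simp_all add: palindrome_def)
      then show ?thesis by (simp add: palindrome_def)
    next
      assume S12: "{b. suffix q (p b)} = {N1, N2}"
      have "d = N0" if "d \<in> set R" for d
      proof -
        have "d \<notin> {b. suffix q (p b)}" using star[OF that] by blast
        then show ?thesis unfolding S12 by (cases d) auto
      qed
      then have "R = replicate (length R) N0" by (metis replicate_eqI)
      then show ?thesis by (metis rev_replicate)
    qed
    then show ?thesis using palindrome_frame[of R q] rd' V(3) by simp
  qed
qed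

lemma return_image:
  assumes "r \<in> image_lang p h_lang" "\<And>u. u \<in> h_lang \<Longrightarrow> smaller u r \<Longrightarrow> return_closed u"
  shows "return_closed r"
  using assms return_image_marker return_image_marker_free by (metis return_closedI)

end

interpretation fu: unary_code f_block
proof
  show "\<exists>n x. f_block a = replicate n x" for a
    by (cases a) (auto intro: exI[of _ 0] exI[of _ "Suc 0"] exI[of _ "Suc (Suc 0)"])
  show "{b. suffix s (f_block b)} = {a} \<or> {b. suffix s (f_block b)} = {N1, N2}"
    if "s \<noteq> []" "suffix s (f_block a)" for s a
    using that by (cases a) (auto simp: suffix_Cons Collect_conv_if set_eq_iff letter_all)
qed

interpretation hu: unary_code h_block
proof
  show "\<exists>n x. h_block a = replicate n x" for a
    by (cases a) (auto intro: exI[of _ 0] exI[of _ "Suc 0"] exI[of _ "Suc (Suc 0)"])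
  show "{b. suffix s (h_block b)} = {a} \<or> {b. suffix s (h_block b)} = {N1, N2}"
    if "s \<noteq> []" "suffix s (h_block a)" for s a
    using that by (cases a) (auto simp: suffix_Cons Collect_conv_if set_eq_iff letter_all)
qed

text \<open>The blocks of \<open>h\<close> are nonempty, so \<open>R\<close> is at most half as long
  as its image, and two framing letters are paid for by \<open>s\<close> and
  \<open>rev s\<close>.\<close>

lemma return_closed_h_lang: "r \<in> h_lang \<Longrightarrow> return_closed r"
proof (induction "length r" arbitrary: r rule: less_induct)
  case less
  show ?case
  proof (rule hu.return_image)
    show "r \<in> image_lang h_block h_lang" using less.prems h_lang_image by blast
    fix u assume u: "u \<in> h_lang" "hu.smaller u r"
    have len: "2 * length v \<le> length (subst h_block v)" for v
    proof (induction v)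
      case (Cons a v)
      have "length (h_block a) \<ge> 1" by (cases a) auto
      then show ?case using Cons by simp
    qed simp
    obtain R s c where "r = s @ subst h_block R @ N0 # rev s" "u = R \<or> s \<noteq> [] \<and> u = c # R @ [c]"
      using u(2) unfolding hu.smaller_def by blast
    moreover have "length s \<ge> 1" if "s \<noteq> []" using that by (simp add: Suc_le_eq)
    ultimately have "length u < length r" using len[of R] by auto
    then show "return_closed u" using less.hyps u(1) by blast
  qed
qed

text \<open>\<open>f\<close> has an empty block, so lengths need not drop; but all words of
  \<open>h_lang\<close> are already known to be return-closed, and one application is
  enough.\<close>

lemma returns_fh_lang: "palindromic_returns fh_lang"
  unfolding palindromic_returns_iff using fu.return_image return_closed_h_lang by blast

lemma rich_fh_lang: "u \<in> fh_lang \<Longrightarrow> rich u"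
  using returns_rich[OF returns_fh_lang factorial_image_lang] .

section \<open>The threshold\<close>

text \<open>The limit of the images under \<open>f\<close> of the iterates of \<open>h\<close>, read
  diagonally: the i-th image is longer than i and is a prefix of all later ones.\<close>

definition fh_word :: "nat word" where
  "fh_word i = enc (subst f_block (h_iterate i) ! i)"

lemma f_iterate_length: "n < length (subst f_block (h_iterate n))"
proof (induction n)
  case 0 then show ?case by (simp add: h_iterate_def)
next
  case (Suc n)
  obtain u where u: "h_iterate (Suc n) = h_iterate n @ u" "u \<noteq> []" using h_iterate_prefix by blast
  then have "length (subst f_block u) \<ge> 1" by (cases u) auto
  then show ?case using Suc u by simp
qed

lemma f_iterate_prefix: "\<exists>u. subst f_block (h_iterate (n + m)) = subst f_block (h_iterate n) @ u"
proof (induction m)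
  case (Suc m)
  obtain u where "subst f_block (h_iterate (n + m)) = subst f_block (h_iterate n) @ u" using Suc by blast
  moreover obtain v where "h_iterate (Suc (n + m)) = h_iterate (n + m) @ v" using h_iterate_prefix by blast
  ultimately show ?case by simp
qed simp

lemma fh_word_nth:
  assumes "i \<le> n" shows "fh_word i = enc (subst f_block (h_iterate n) ! i)"
proof -
  obtain u where "subst f_block (h_iterate (i + (n - i))) = subst f_block (h_iterate i) @ u"
    using f_iterate_prefix by blast
  then show ?thesis using assms f_iterate_length[of i] unfolding fh_word_def by (simp add: nth_append)
qed

lemma factors_fh_word:
  assumes "u \<in> factors fh_word" shows "\<exists>v\<in>fh_lang. u = map enc v"
proof -
  obtain i j where ij: "u = fh_word [i \<rightarrow> j]" "i \<le> j" using assms unfolding factors_def by blast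
  let ?F = "subst f_block (h_iterate j)"
  define v where "v = take (j - i) (drop i ?F)"
  have "sublist v ?F" unfolding v_def by (meson sublist_drop sublist_take sublist_order.order.trans)
  then have "sublist v (?F @ [N0])" by (meson sublist_append_rightI sublist_order.order.trans)
  moreover have "h_iterate j \<in> h_lang" by (auto simp: h_lang_def)
  ultimately have "v \<in> fh_lang" unfolding image_lang_def by blast
  moreover have "u = map enc v"
  proof (rule nth_equalityI)
    show "length u = length (map enc v)" using ij f_iterate_length[of j] by (simp add: v_def subsequence_def)
    fix k assume "k < length u"
    then have k: "k < j - i" using ij by (simp add: subsequence_def)
    then show "u ! k = map enc v ! k"
      using ij fh_word_nth[of "i + k" j] f_iterate_length[of j] by (simp add: v_def subsequence_def)
  qed
  ultimately show ?thesis by blast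
qed

lemma fh_lang_binary: "u \<in> fh_lang \<Longrightarrow> N2 \<notin> set u"
proof -
  have "N2 \<notin> set (subst f_block v @ [N0])" for v
  proof (induction v)
    case (Cons a v) then show ?case by (cases a) auto
  qed simp
  then show "u \<in> fh_lang \<Longrightarrow> N2 \<notin> set u"
    unfolding image_lang_def using set_mono_sublist by blast
qed

lemma rich_map_enc:
  assumes "rich u" shows "rich (map enc u)"
proof -
  have "pal_factors (map enc u) = map enc ` pal_factors u"
  proof (intro set_eqI iffI)
    fix v assume "v \<in> pal_factors (map enc u)"
    then obtain s t where st: "map enc u = s @ v @ t" "v \<noteq> []" "rev v = v"
      by (auto simp: sublist_def palindrome_def)
    then obtain s' v' t' where u: "u = s' @ v' @ t'" "v = map enc v'"
      by (metis map_eq_append_conv)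
    have "rev v' = v'" using st(3) unfolding u(2) rev_map inj_map_eq_map[OF inj_enc] .
    then show "v \<in> map enc ` pal_factors u" using u st(2) by (auto simp: palindrome_def)
  next
    fix v assume "v \<in> map enc ` pal_factors u"
    then obtain v' where "v = map enc v'" "sublist v' u" "v' \<noteq> []" "rev v' = v'"
      by (auto simp: palindrome_def)
    moreover from this have "sublist v (map enc u)" by (auto simp: sublist_def) blast
    ultimately show "v \<in> pal_factors (map enc u)"
      by (auto simp: palindrome_def rev_map)
  qed
  moreover have "inj_on (map enc) (pal_factors u)"
    using inj_enc by (metis inj_mapI inj_on_subset subset_UNIV)
  ultimately show ?thesis using assms unfolding rich_def by (simp add: card_image)
qed

lemma fh_word_in: "fh_word \<in> binary_rich_words"
proof -
  have "fh_word i \<in> {0, 1}" for i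
  proof -
    have "[fh_word i] \<in> factors fh_word"
    proof -
      have "[fh_word i] = fh_word [i \<rightarrow> Suc i]" by (simp add: subsequence_def)
      moreover have "i \<le> Suc i" by simp
      ultimately show ?thesis unfolding factors_def by blast
    qed
    then obtain v where v: "v \<in> fh_lang" "[fh_word i] = map enc v"
      by (rule bexE[OF factors_fh_word]) (rule that)
    then obtain a where "v = [a]" by (cases v) auto
    then have "fh_word i = enc a" "a \<noteq> N2" using v fh_lang_binary[of v] by auto
    then show ?thesis by (cases a) auto
  qed
  then have "range fh_word \<subseteq> {0, 1}" by (rule image_subsetI)
  moreover have "rich_word fh_word"
    unfolding rich_word_def
  proof
    fix u assume "u \<in> factors fh_word"
    from factors_fh_word[OF this] obtain v where "v \<in> fh_lang" "u = map enc v" by blast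
    then show "rich u" using rich_fh_lang rich_map_enc by simp
  qed
  ultimately show ?thesis unfolding binary_rich_words_def by simp
qed

lemma fh_word_power:
  assumes "contains_power fh_word \<alpha>" shows "\<alpha> \<le> 2 + sqrt 2 / 2"
proof -
  obtain u q where u: "u \<in> factors fh_word" "has_period u q" "\<alpha> \<le> real (length u) / real q"
    using assms unfolding contains_power_def exponents_def by blast
  have q: "q \<ge> 1" using u(2) by (simp add: has_period_def)
  obtain v where v: "v \<in> fh_lang" "u = map enc v" using factors_fh_word[OF u(1)] by blast
  have "real (length u) \<le> (2 + sqrt 2 / 2) * real q"
  proof (cases "length v \<le> q")
    case True
    then have "real (length u) \<le> 1 * real q" using v by simp
    also have "\<dots> \<le> (2 + sqrt 2 / 2) * real q" by (intro mult_right_mono) auto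
    finally show ?thesis .
  next
    case False
    define x z where "x = take q v" and "z = drop q v"
    have per: "v ! i = v ! (i + q)" if "i + q < length v" for i
      using u(2) that injD[OF inj_enc] unfolding has_period_def v(2) by simp
    have "z = take (length v - q) v"
      by (rule nth_equalityI) (use False per in \<open>auto simp: z_def add.commute\<close>)
    then have "x @ z = z @ drop (length v - q) v" "x @ z = v"
      unfolding x_def z_def by (metis append_take_drop_id)+
    moreover have "x \<noteq> []" "length x = q" using q False by (auto simp: x_def)
    ultimately have "real (length z) \<le> (1 + sqrt 2 / 2) * real q" using fh_lang_power[of x z] v(1) by metis
    moreover have "length u = q + length z" using False v by (simp add: z_def)
    ultimately show ?thesis by (simp add: algebra_simps)
  qed
  then have "real (length u) / real q \<le> 2 + sqrt 2 / 2" using q by (simp add: divide_le_eq)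
  then show ?thesis using u(3) by simp
qed

lemma contains_power_below:
  assumes "w \<in> binary_rich_words" "\<alpha> < 2 + sqrt 2 / 2"
  shows "contains_power w \<alpha>"
  using power_free_bound[of w \<alpha>] assms unfolding binary_rich_words_def by force

text \<open>Powers of every rational exponent below the threshold are contained, and the rationals
  are dense.\<close>

lemma critical_exponent_ge:
  assumes "w \<in> binary_rich_words"
  shows "ereal (2 + sqrt 2 / 2) \<le> critical_exponent w"
proof (rule dense_le)
  fix x assume x: "x < ereal (2 + sqrt 2 / 2)"
  show "x \<le> critical_exponent w"
  proof (cases x)
    case (real r)
    then have "r < 2 + sqrt 2 / 2" using x by simp
    then obtain s where s: "r < of_rat s" "of_rat s < 2 + sqrt 2 / 2" using of_rat_dense by blast
    then have "contains_power w (of_rat s)" using contains_power_below[OF assms] by blast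
    then have "ereal (of_rat s) \<le> critical_exponent w" unfolding critical_exponent_def by (intro SUP_upper) simp
    moreover have "x \<le> ereal (of_rat s)" using real s by simp
    ultimately show ?thesis by (rule order_trans[rotated])
  qed (use x in auto)
qed

theorem theorem2:
  shows "repetition_threshold binary_rich_words = ereal (2 + sqrt 2 / 2)
    \<and> (\<exists>w \<in> binary_rich_words. critical_exponent w = ereal (2 + sqrt 2 / 2))
    \<and> (\<forall>w \<in> binary_rich_words. ereal (2 + sqrt 2 / 2) \<le> critical_exponent w)"
proof (intro conjI)
  show "repetition_threshold binary_rich_words = ereal (2 + sqrt 2 / 2)"
    unfolding repetition_threshold_def
  proof (rule antisym)
    show "(INF \<alpha>\<in>{\<alpha>. 1 < \<alpha> \<and> (\<exists>w\<in>binary_rich_words. power_free w \<alpha>)}. ereal \<alpha>) \<le> ereal (2 + sqrt 2 / 2)"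
    \<comment> \<open>\<open>fh_word_power\<close> is not strict, so freeness is claimed only above
      the threshold, and the infimum is approached from there.\<close>
    proof (rule dense_ge)
      fix x assume x: "ereal (2 + sqrt 2 / 2) < x"
      show "(INF \<alpha>\<in>{\<alpha>. 1 < \<alpha> \<and> (\<exists>w\<in>binary_rich_words. power_free w \<alpha>)}. ereal \<alpha>) \<le> x"
      proof (cases x)
        case (real r)
        then have r: "2 + sqrt 2 / 2 < r" using x by simp
        then have "power_free fh_word r" unfolding power_free_def using fh_word_power by force
        moreover have "1 < r" using r real_sqrt_ge_zero[of 2] by linarith
        ultimately show ?thesis unfolding real using fh_word_in by (intro INF_lower) auto
      qed (use x in auto)
    qed
    show "ereal (2 + sqrt 2 / 2) \<le> (INF \<alpha>\<in>{\<alpha>. 1 < \<alpha> \<and> (\<exists>w\<in>binary_rich_words. power_free w \<alpha>)}. ereal \<alpha>)"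
    proof (rule INF_greatest)
      fix \<alpha> assume "\<alpha> \<in> {\<alpha>. 1 < \<alpha> \<and> (\<exists>w\<in>binary_rich_words. power_free w \<alpha>)}"
      then show "ereal (2 + sqrt 2 / 2) \<le> ereal \<alpha>"
        using contains_power_below unfolding power_free_def by (auto simp: not_less[symmetric])
    qed
  qed
  show "\<exists>w \<in> binary_rich_words. critical_exponent w = ereal (2 + sqrt 2 / 2)"
  proof (rule bexI[OF antisym fh_word_in])
    show "critical_exponent fh_word \<le> ereal (2 + sqrt 2 / 2)"
      unfolding critical_exponent_def by (rule SUP_least) (use fh_word_power in auto)
    show "ereal (2 + sqrt 2 / 2) \<le> critical_exponent fh_word"
      using critical_exponent_ge[OF fh_word_in] .
  qed
  show "\<forall>w \<in> binary_rich_words. ereal (2 + sqrt 2 / 2) \<le> critical_exponent w"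
    using critical_exponent_ge by blast
qed

end
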